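(* Let $1<q\le p<\infty$, let $r=pq/(p-q)$ if $q<p$ and $r=\infty$ if $p=q$, and assume (N1)–(N2). For every $u,v\in L^p(\Omega;\mathbb R^d)$ there exists $A\in\Theta[u,v]$ with $\mathfrak H[u]-\mathfrak H[v]=A(u-v)$ in $L^q(\Omega;\mathbb R^n)$, where $$\Theta[u,v]=\big\{A\in L^r(\Omega;\mathbb R^{n\times d}): A(x)\in\operatorname{co}\big(\partial^CH(x,[u(x),v(x)])\big)\text{ for a.e. }x\in\Omega\big\}.$$ Furthermore, if $A\in\Theta[u,v]$ satisfies $\mathfrak H[u]-\mathfrak H[v]=A(u-v)$, then there exist measurable functions $\lambda_1,\dots,\lambda_{nd+1}\colon\Omega\to[0,1]$ and measurable $A_1,\dots,A_{nd+1}\colon\Omega\to\mathbb R^{n\times d}$ with $A_i(x)\in\partial^CH(x,[u(x),v(x)])$ for a.e. $x$, such that $\sum_{i=1}^{nd+1}\lambda_i=1$ and $A=\sum_{i=1}^{nd+1}\lambda_iA_i$ a.e. in $\Omega$.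
   Context: Let $(\Omega,\mathcal F,\mu)$ be a complete finite measure space and $H\colon\Omega\times\mathbb R^d\to\mathbb R^n$. $\partial^CH(x,z)$ is the Clarke generalized Jacobian of $H(x,\cdot)$ at $z$ (convex hull of limits of Jacobians of $H(x,\cdot)$ at differentiability points converging to $z$); $\partial^CH(x,[a,b])=\bigcup_{z\in[a,b]}\partial^CH(x,z)$; $\operatorname{co}$ denotes convex hull. (N1): $H$ is $\mathcal F\otimes\mathcal B(\mathbb R^d)$-measurable and locally Lipschitz in $z$ for every $x$. (N2): there exist $C_H>0$, $1<q\le p<\infty$ with $|H(x,z)|\le C_H(1+|z|^{p/q})$ and $|M|\le C_H(1+|z|^{p/q-1})$ for all $M\in\partial^CH(x,z)$. $\mathfrak H\colon L^p(\Omega;\mathbb R^d)\to L^q(\Omega;\mathbb R^n)$, $\mathfrak H[u](x)=H(x,u(x))$; matrices act pointwise: $(Aw)(x)=A(x)w(x)$. *)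

theory Defs
  imports "HOL-Analysis.Analysis"
begin

text \<open>Power with the convention t^0 = 1 (also at t = 0); Isabelle's powr has 0 powr a = 0.\<close>
definition npow :: "real \<Rightarrow> real \<Rightarrow> real" where
  "npow t a = (if a = 0 then 1 else t powr a)"

definition clarke_jacobian ::
  "(real^'d \<Rightarrow> real^'n) \<Rightarrow> real^'d \<Rightarrow> (real^'d^'n) set" where
  "clarke_jacobian f z = convex hull
     {Mx. \<exists>zs::nat \<Rightarrow> real^'d. (\<forall>k. f differentiable (at (zs k))) \<and> zs \<longlonglongrightarrow> z \<and>
          (\<lambda>k. matrix (frechet_derivative f (at (zs k)))) \<longlonglongrightarrow> Mx}"

definition clarke_jacobian_seg ::
  "(real^'d \<Rightarrow> real^'n) \<Rightarrow> real^'d \<Rightarrow> real^'d \<Rightarrow> (real^'d^'n) set" where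
  "clarke_jacobian_seg f a b = (\<Union>z\<in>closed_segment a b. clarke_jacobian f z)"

definition Lp_set :: "'a measure \<Rightarrow> real \<Rightarrow> ('a \<Rightarrow> 'b::{real_normed_vector,second_countable_topology}) set" where
  "Lp_set M p = {f. f \<in> borel_measurable M \<and> integrable M (\<lambda>x. norm (f x) powr p)}"

definition Linf_set :: "'a measure \<Rightarrow> ('a \<Rightarrow> 'b::{real_normed_vector,second_countable_topology}) set" where
  "Linf_set M = {f. f \<in> borel_measurable M \<and> (\<exists>C. AE x in M. norm (f x) \<le> C)}"

definition Lr_set :: "'a measure \<Rightarrow> real \<Rightarrow> real \<Rightarrow> ('a \<Rightarrow> 'b::{real_normed_vector,second_countable_topology}) set" where
  "Lr_set M p q = (if q < p then Lp_set M (p * q / (p - q)) else Linf_set M)"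

definition Theta ::
  "'a measure \<Rightarrow> real \<Rightarrow> real \<Rightarrow> ('a \<Rightarrow> real^'d \<Rightarrow> real^'n) \<Rightarrow> ('a \<Rightarrow> real^'d) \<Rightarrow> ('a \<Rightarrow> real^'d)
     \<Rightarrow> ('a \<Rightarrow> real^'d^'n) set" where
  "Theta M p q H u v = {A. A \<in> Lr_set M p q \<and>
      (AE x in M. A x \<in> convex hull (clarke_jacobian_seg (H x) (u x) (v x)))}"

end

theory Submission
  imports Defs
begin

text \<open>
  For fixed \<open>x\<close> the Jacobian of \<open>H x\<close> exists almost everywhere (Rademacher), and its averages
  \<open>jac_avg (H x) c \<delta>\<close> against a bump of radius \<open>\<delta>\<close> around \<open>c\<close> are measurable in \<open>x\<close>. They lie in
  closed convex hulls of Jacobians at nearby points, so that their limits belong to the Clarke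
  Jacobian; conversely every Jacobian is the limit of such averages with rational data, since
  difference quotients can be moved onto the Lipschitz bump. Hence the set of all representations
  \<open>\<Sum>i. \<lambda>\<^sub>i A\<^sub>i\<close> with \<open>A\<^sub>i\<close> in the Clarke Jacobian along the segment is described by countably many
  measurable functions of \<open>x\<close>, and a measurable representation can be selected subject to any
  equation that has a solution for each \<open>x\<close>. The first claim uses the equation
  \<open>B (u x - v x) = H x (u x) - H x (v x)\<close>, solvable by the mean value theorem, and the second one
  the equation \<open>B = A x\<close>, solvable by assumption.
\<close>

section \<open>Lipschitz functions of one variable\<close>

text \<open>Jacobians at a fixed countable set of points would not do as raw material for the
  selection: for a given \<open>x\<close> they may fail to exist there, or miss limits reached along
  other points. Averages exist at every centre. The delicate direction is then the converse one: the
  Clarke Jacobian admits every differentiability point, and a Jacobian at a single point says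
  nothing about the Jacobians at almost all points nearby. What rescues it is that a remainder small
  in size has a small averaged derivative, whatever its pointwise derivatives do.

  Two nested levels of combinations occur because each \<open>A_i\<close> must belong to the Clarke
  Jacobian at one point, which is itself a hull; at both levels the number of terms is that of
  Caratheodory's theorem in dimension nd. Weights, positions and matrices are selected together, as
  one vector, since decomposing a selected matrix afterwards would leave the measurability of its
  parts open. Rational data satisfy the equation and the normalisations only approximately, so the
  selection is one of cluster points as the tolerance tends to 0. The exponent r is the one with
  \<open>(p / q - 1) * r = p\<close>.\<close>

lemma dini_increasing:
  fixes F :: "real \<Rightarrow> real"
  assumes ab: "a \<le> b" and cont: "continuous_on {a..b} F"
    and step: "\<And>x d. \<lbrakk>a \<le> x; x < b; 0 < d\<rbrakk> \<Longrightarrow> \<exists>h>0. h < d \<and> F x \<le> F (x + h)"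
  shows "F a \<le> F b"
proof -
  define S where "S = {x \<in> {a..b}. F a \<le> F x}"
  have "closed S"
    unfolding S_def by (intro continuous_closed_preimage_constant continuous_on_closed_Collect_le cont) auto
  moreover have bdd: "bdd_above S" by (auto simp: S_def intro!: bdd_aboveI[of _ b])
  moreover have "a \<in> S" using ab by (auto simp: S_def)
  ultimately have sup: "Sup S \<in> S" by (intro closed_contains_Sup) auto
  \<comment> \<open>From a supremum below \<open>b\<close> the hypothesis would lead to a further
    point of \<open>S\<close>; continuity has put the supremum itself into \<open>S\<close>.\<close>
  have "Sup S = b"
  proof (rule ccontr)
    assume "Sup S \<noteq> b"
    with sup have "a \<le> Sup S" "Sup S < b" by (auto simp: S_def)
    from step[OF this, of "b - Sup S"] obtain h where h: "0 < h" "h < b - Sup S" "F (Sup S) \<le> F (Sup S + h)"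
      using \<open>Sup S < b\<close> by auto
    with sup have "Sup S + h \<in> S" by (auto simp: S_def)
    with cSup_upper[OF this bdd] h show False by auto
  qed
  with sup show ?thesis by (auto simp: S_def)
qed

lemma measure_Int_atLeastAtMost_diff:
  fixes a x y :: real
  assumes "A \<in> sets borel" "a \<le> x" "x \<le> y"
  shows "measure lborel (A \<inter> {a..y}) = measure lborel (A \<inter> {a..x}) + measure lborel (A \<inter> {x<..y})"
proof -
  have "A \<inter> {a..y} = A \<inter> {a..x} \<union> A \<inter> {x<..y}" using assms by auto
  moreover have "emeasure lborel (A \<inter> {a..x}) < \<infinity>"
    using emeasure_mono[of "A \<inter> {a..x}" "{a..x}" lborel] assms by (auto simp: le_less_trans)
  moreover have "emeasure lborel (A \<inter> {x<..y}) < \<infinity>"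
    using emeasure_mono[of "A \<inter> {x<..y}" "{x<..y}" lborel] assms by (auto simp: le_less_trans)
  ultimately show ?thesis using assms
    by (simp, intro measure_Union) auto
qed

lemma measure_Int_atLeastAtMost_bounds:
  fixes a x y :: real
  assumes "A \<in> sets borel" "a \<le> x" "x \<le> y"
  shows "measure lborel (A \<inter> {a..x}) \<le> measure lborel (A \<inter> {a..y})"
    and "measure lborel (A \<inter> {a..y}) \<le> measure lborel (A \<inter> {a..x}) + (y - x)"
proof -
  have "measure lborel (A \<inter> {x<..y}) \<le> measure lborel {x<..y}"
    using assms by (intro measure_mono_fmeasurable) (auto simp: fmeasurable_def)
  then show "measure lborel (A \<inter> {a..y}) \<le> measure lborel (A \<inter> {a..x}) + (y - x)"
    and "measure lborel (A \<inter> {a..x}) \<le> measure lborel (A \<inter> {a..y})"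
    using measure_Int_atLeastAtMost_diff[OF assms] assms by auto
qed

lemma continuous_on_measure_Int:
  fixes a b :: real
  assumes "A \<in> sets borel"
  shows "continuous_on {a..b} (\<lambda>x. measure lborel (A \<inter> {a..x}))"
proof -
  have "1-lipschitz_on {a..b} (\<lambda>x. measure lborel (A \<inter> {a..x}))"
  proof (rule lipschitz_on_leI)
    fix x y assume "x \<in> {a..b}" "y \<in> {a..b}" "x \<le> y"
    with measure_Int_atLeastAtMost_bounds[OF assms, of a x y]
    show "dist (measure lborel (A \<inter> {a..x})) (measure lborel (A \<inter> {a..y})) \<le> 1 * dist x y"
      by (auto simp: dist_real_def)
  qed auto
  then show ?thesis by (rule lipschitz_on_continuous_on)
qed

text \<open>The bound is \<open>q\<close> times the measure of \<open>K\<close> minus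
  \<open>L\<close> times the measure of the rest: off \<open>K\<close> the Lipschitz constant alone
  limits the decrease, and from points of \<open>K\<close> there are arbitrarily small steps of
  slope at least \<open>q\<close>.\<close>

lemma lipschitz_increment_ge:
  fixes f :: "real \<Rightarrow> real"
  assumes lip: "L-lipschitz_on {a..b} f" and ab: "a \<le> b" and K: "closed K" and q: "- L \<le> q"
    and step: "\<And>x d. \<lbrakk>x \<in> K; a \<le> x; x < b; 0 < d\<rbrakk> \<Longrightarrow> \<exists>h>0. h < d \<and> q * h \<le> f (x + h) - f x"
  shows "(q + L) * measure lborel (K \<inter> {a..b}) - L * (b - a) \<le> f b - f a"
proof -
  define k where "k x = measure lborel (K \<inter> {a..x})" for x
  have Kb: "K \<in> sets borel" using K by auto
  note kb = measure_Int_atLeastAtMost_bounds[OF Kb, where a = a, folded k_def]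
  \<comment> \<open>Subtracting the claimed growth leaves monotonicity to show. Over a step from
    \<open>K\<close> the measure \<open>k\<close> grows by at most \<open>h\<close>; just to the
    right of a point off \<open>K\<close> it is constant, and the term with \<open>L\<close> pays
    for the decrease of \<open>f\<close>.\<close>
  define F where "F x = f x - (q + L) * k x + L * (x - a)" for x
  have "F a \<le> F b"
  proof (rule dini_increasing[OF ab])
    show "continuous_on {a..b} F" unfolding F_def k_def
      by (intro continuous_intros continuous_on_measure_Int Kb lipschitz_on_continuous_on[OF lip])
    fix x d :: real assume x: "a \<le> x" "x < b" "0 < d"
    show "\<exists>h>0. h < d \<and> F x \<le> F (x + h)"
    proof (cases "x \<in> K")
      case True
      from step[OF True x] obtain h where h: "h > 0" "h < d" "q * h \<le> f (x + h) - f x" by auto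
      have "(q + L) * k (x + h) \<le> (q + L) * (k x + h)"
        using kb(2)[of x "x + h"] x h q by (intro mult_left_mono) auto
      then have "F x \<le> F (x + h)" using h(3) unfolding F_def by (simp add: algebra_simps)
      with h show ?thesis by auto
    next
      case False
      then obtain e where e: "e > 0" "ball x e \<subseteq> - K" using K open_contains_ball[of "- K"] by (auto simp: open_Compl)
      define h where "h = min (min (d/2) (e/2)) (b - x)"
      have h: "h > 0" "h < d" "h < e" "x + h \<le> b" using x e by (auto simp: h_def min_def)
      have "K \<inter> {x<..x + h} = {}"
      proof -
        have "y \<notin> K" if "y \<in> {x<..x+h}" for y
          using that h e(2) by (force simp: dist_real_def)
        then show ?thesis by auto
      qed
      then have "k (x + h) = k x"
        using measure_Int_atLeastAtMost_diff[OF Kb, of a x "x + h"] x h by (simp add: k_def)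
      moreover have "\<bar>f x - f (x + h)\<bar> \<le> L * h"
        using lipschitz_onD[OF lip, of x "x + h"] x h by (simp add: dist_real_def)
      ultimately have "F x \<le> F (x + h)" unfolding F_def by (simp add: algebra_simps)
      with h show ?thesis by auto
    qed
  qed
  moreover have "k a = 0"
  proof -
    have "k a \<le> measure lborel {a..a}" unfolding k_def
      using Kb by (intro measure_mono_fmeasurable) (auto simp: fmeasurable_def)
    then show ?thesis by (simp add: k_def measure_le_0_iff)
  qed
  ultimately show ?thesis by (simp add: F_def k_def)
qed

text \<open>Adding the bounds for \<open>f\<close> and \<open>- f\<close> shows that \<open>K\<close> cannot fill almost all of an interval.
  The Dini argument is then applied once more to the difference of the two sides, integrated along
  an open neighbourhood of \<open>K\<close>.\<close>
lemma lipschitz_quotient_gap_compact: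
  fixes f :: "real \<Rightarrow> real"
  assumes lip: "L-lipschitz_on {a..b} f" and K: "compact K" "K \<subseteq> {a..<b}" and pq: "p < q"
    and up: "\<And>x d. \<lbrakk>x \<in> K; 0 < d\<rbrakk> \<Longrightarrow> \<exists>h>0. h < d \<and> q * h \<le> f (x + h) - f x"
    and lo: "\<And>x d. \<lbrakk>x \<in> K; 0 < d\<rbrakk> \<Longrightarrow> \<exists>h>0. h < d \<and> f (x + h) - f x \<le> p * h"
  shows "emeasure lborel K = 0"
proof (cases "K = {}")
  case False
  then obtain x0 where x0: "x0 \<in> K" by auto
  with K have ab: "a < b" by auto
  have L: "L \<ge> 0" using lip by (rule lipschitz_on_nonneg)
  have clK: "closed K" using K compact_imp_closed by auto
  then have Kb: "K \<in> sets borel" by auto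
  \<comment> \<open>Quotients lie between \<open>- L\<close> and \<open>L\<close>, so the steps at
    \<open>x0\<close> give \<open>q \<le> L\<close> and \<open>- L \<le> p\<close>;
    \<open>p < q\<close> then yields the two sign conditions.\<close>
  have pq': "- L \<le> q" "- L \<le> - p"
  proof -
    have xb: "b - x0 > 0" "a \<le> x0" using x0 K by auto
    from up[OF x0 xb(1)] obtain h where h: "h > 0" "h < b - x0" "q * h \<le> f (x0 + h) - f x0" by auto
    have "\<bar>f x0 - f (x0 + h)\<bar> \<le> L * h"
      using lipschitz_onD[OF lip, of x0 "x0 + h"] xb h by (simp add: dist_real_def)
    with h have "q * h \<le> L * h" by linarith
    with h pq show "- L \<le> - p" by simp
    from lo[OF x0 xb(1)] obtain h where h: "h > 0" "h < b - x0" "f (x0 + h) - f x0 \<le> p * h" by auto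
    have "\<bar>f x0 - f (x0 + h)\<bar> \<le> L * h"
      using lipschitz_onD[OF lip, of x0 "x0 + h"] xb h by (simp add: dist_real_def)
    with h have "(- L) * h \<le> p * h" by linarith
    then have "- L \<le> p" using h(1) by (rule mult_right_le_imp_le)
    with pq show "- L \<le> q" by simp
  qed
  define k where "k x y = measure lborel (K \<inter> {x..y})" for x y
  \<comment> \<open>The density of \<open>K\<close> in every subinterval is thus at most
    \<open>2 * L / (q - p + 2 * L)\<close>, which is less than 1. So \<open>K\<close> has no density
    points; the open set \<open>U\<close> below exploits this without a density theorem.\<close>
  have interval: "(q - p) * k x y \<le> 2 * L * ((y - x) - k x y)" if "a \<le> x" "x \<le> y" "y \<le> b" for x y
  proof -
    have lip': "L-lipschitz_on {x..y} f" using lip by (rule lipschitz_on_subset) (use that in auto)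
    have "(q + L) * k x y - L * (y - x) \<le> f y - f x" unfolding k_def
      by (rule lipschitz_increment_ge[OF lip' that(2) clK pq'(1)]) (use up in auto)
    moreover have "(- p + L) * k x y - L * (y - x) \<le> (- f y) - (- f x)" unfolding k_def
    proof (rule lipschitz_increment_ge[where f = "\<lambda>x. - f x", OF _ that(2) clK pq'(2)])
      show "L-lipschitz_on {x..y} (\<lambda>x. - f x)" using lip' by simp
      show "\<exists>h>0. h < d \<and> - p * h \<le> - f (x + h) - - f x" if "x \<in> K" "0 < d" for x d
        using lo[OF that] by (simp add: algebra_simps) 
    qed
    ultimately show ?thesis by (simp add: algebra_simps)
  qed
  have bound: "(q - p) * k a b \<le> 2 * L * e" if e: "e > 0" for e
  proof -
    obtain U where U: "open U" "K \<subseteq> U" "U - K \<in> lmeasurable" "emeasure lebesgue (U - K) < ennreal e"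
      using sets_lebesgue_outer_open[of K e] Kb e by auto
    define D where "D = U - K"
    have Db: "D \<in> sets borel" using U Kb by (auto simp: D_def)
    define o' where "o' x = measure lborel (D \<inter> {a..x})" for x
    have me: "o' b \<le> e"
    proof -
      have "emeasure lborel (D \<inter> {a..b}) \<le> emeasure lborel D"
        using Db by (intro emeasure_mono) auto
      also have "\<dots> < ennreal e" using U(4) Db by (simp add: D_def)
      finally show ?thesis using e unfolding o'_def measure_def
        by (metis enn2real_leI less_imp_le)
    qed
    \<comment> \<open>A short interval to the right of a point of \<open>K\<close> stays in
      \<open>U\<close>, so its part outside \<open>K\<close> belongs to \<open>D\<close>. By
      \<open>interval\<close> the growth of \<open>(q - p) * k a\<close> is then at most that of
      \<open>2 * L * o'\<close>, and \<open>o' b\<close> is at most \<open>e\<close>.\<close>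
    define G where "G x = 2 * L * o' x - (q - p) * k a x" for x
    have "G a \<le> G b"
    proof (rule dini_increasing[of a b])
      show "continuous_on {a..b} G" unfolding G_def k_def o'_def
        by (intro continuous_intros continuous_on_measure_Int Kb Db)
      fix x d :: real assume x: "a \<le> x" "x < b" "0 < d"
      show "\<exists>h>0. h < d \<and> G x \<le> G (x + h)"
      proof (cases "x \<in> K")
        case False
        then obtain r where r: "r > 0" "ball x r \<subseteq> - K" using clK open_contains_ball[of "- K"] by (auto simp: open_Compl)
        define h where "h = min (d/2) (r/2)"
        have h: "h > 0" "h < d" "h < r" using x r by (auto simp: h_def min_def)
        have "y \<notin> K" if "y \<in> {x<..x+h}" for y
          using that h r(2) by (force simp: dist_real_def)
        then have "K \<inter> {x<..x + h} = {}" by auto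
        then have "k a (x + h) = k a x"
          using measure_Int_atLeastAtMost_diff[OF Kb, of a x "x + h"] x h by (simp add: k_def)
        moreover have "o' x \<le> o' (x + h)" unfolding o'_def
          using measure_Int_atLeastAtMost_bounds(1)[OF Db, of a x "x + h"] x h by auto
        ultimately have "G x \<le> G (x + h)" using L by (simp add: G_def mult_left_mono)
        with h show ?thesis by auto
      next
        case True
        with U have "x \<in> U" by auto
        from openE[OF U(1) this] obtain r where r: "r > 0" "ball x r \<subseteq> U" by blast
        define h where "h = min (min (d/2) (r/2)) (b - x)"
        have h: "h > 0" "h < d" "h < r" "x + h \<le> b" using x r by (auto simp: h_def min_def)
        have sub: "{x..x + h} \<subseteq> U" using h r(2) by (force simp: dist_real_def)
        have ka: "k a (x + h) = k a x + measure lborel (K \<inter> {x<..x+h})"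
          using measure_Int_atLeastAtMost_diff[OF Kb, of a x "x + h"] x h by (simp add: k_def)
        have oa: "o' (x + h) = o' x + measure lborel (D \<inter> {x<..x+h})"
          using measure_Int_atLeastAtMost_diff[OF Db, of a x "x + h"] x h by (simp add: o'_def)
        have kx: "k x (x + h) = measure lborel (K \<inter> {x<..x+h})"
        proof -
          have "measure lborel (K \<inter> {x..x}) \<le> measure lborel {x..x}"
            using Kb by (intro measure_mono_fmeasurable) (auto simp: fmeasurable_def)
          then have "measure lborel (K \<inter> {x..x}) = 0" by (simp add: measure_le_0_iff)
          then show ?thesis
          using measure_Int_atLeastAtMost_diff[OF Kb, of x x "x + h"] x h by (simp add: k_def)
        qed
        have "measure lborel {x<..x+h} = measure lborel (K \<inter> {x<..x+h} \<union> D \<inter> {x<..x+h})"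
          using sub by (intro arg_cong[where f = "measure lborel"]) (auto simp: D_def subset_iff)
        also have "\<dots> = measure lborel (K \<inter> {x<..x+h}) + measure lborel (D \<inter> {x<..x+h})"
        proof (rule measure_Union)
          show "emeasure lborel (K \<inter> {x<..x+h}) \<noteq> \<infinity>"
            using emeasure_mono[of "K \<inter> {x<..x+h}" "{x<..x+h}" lborel] h by (auto simp: top_unique)
          show "emeasure lborel (D \<inter> {x<..x+h}) \<noteq> \<infinity>"
            using emeasure_mono[of "D \<inter> {x<..x+h}" "{x<..x+h}" lborel] h by (auto simp: top_unique)
        qed (use Kb Db in \<open>auto simp: D_def\<close>)
        finally have sum: "measure lborel (D \<inter> {x<..x+h}) = h - k x (x + h)" using h kx by simp
        have "(q - p) * k x (x + h) \<le> 2 * L * (h - k x (x + h))"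
          using interval[of x "x + h"] x h by simp
        then have "G x \<le> G (x + h)" unfolding G_def ka oa kx[symmetric] sum by (simp add: algebra_simps)
        with h show ?thesis by auto
      qed
    qed (use ab in auto)
    moreover have "k a a = 0" 
    proof -
      have "k a a \<le> measure lborel {a..a}" unfolding k_def
        using Kb by (intro measure_mono_fmeasurable) (auto simp: fmeasurable_def)
      then show ?thesis by (simp add: k_def measure_le_0_iff)
    qed
    moreover have "0 \<le> L * o' a" using L by (simp add: o'_def)
    moreover have "o' a = 0"
    proof -
      have "o' a \<le> measure lborel {a..a}" unfolding o'_def
        using Db by (intro measure_mono_fmeasurable) (auto simp: fmeasurable_def)
      then show ?thesis by (simp add: o'_def measure_le_0_iff)
    qed
    ultimately have "(q - p) * k a b \<le> 2 * L * o' b" by (simp add: G_def)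
    also have "\<dots> \<le> 2 * L * e" using me L by (simp add: mult_left_mono)
    finally show ?thesis .
  qed
  have "(q - p) * k a b \<le> 0"
  proof (rule field_le_epsilon)
    fix e :: real assume e: "e > 0"
    \<comment> \<open>The summand 1 keeps the denominator positive when
      \<open>L = 0\<close>.\<close>
    have "(q - p) * k a b \<le> 2 * L * (e / (2 * L + 1))" using L e by (intro bound) auto
    also have "\<dots> \<le> e" using L e by (simp add: field_simps)
    finally show "(q - p) * k a b \<le> 0 + e" by simp
  qed
  with pq have "k a b \<le> 0" by (simp add: mult_le_0_iff)
  then have "measure lborel (K \<inter> {a..b}) = 0" by (simp add: k_def measure_le_0_iff)
  moreover have "K \<inter> {a..b} = K" using K by auto
  moreover have "emeasure lborel K \<noteq> \<infinity>" using emeasure_compact_finite[OF K(1)] by simp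
  ultimately show ?thesis by (simp add: emeasure_eq_ennreal_measure)
qed auto

text \<open>Both step hypotheses pass to subsets, so closed sets that exhaust \<open>E\<close> up to
  measure \<open>e\<close> suffice; they are compact because \<open>E\<close> is bounded.\<close>

lemma lipschitz_quotient_gap_null:
  fixes f :: "real \<Rightarrow> real"
  assumes lip: "L-lipschitz_on {a..b} f" and E: "E \<in> sets borel" "E \<subseteq> {a..<b}" and pq: "p < q"
    and up: "\<And>x d. \<lbrakk>x \<in> E; 0 < d\<rbrakk> \<Longrightarrow> \<exists>h>0. h < d \<and> q * h \<le> f (x + h) - f x"
    and lo: "\<And>x d. \<lbrakk>x \<in> E; 0 < d\<rbrakk> \<Longrightarrow> \<exists>h>0. h < d \<and> f (x + h) - f x \<le> p * h"
  shows "emeasure lborel E = 0"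
proof -
  have *: "emeasure lborel E \<le> 0 + ennreal e" if e: "e > 0" for e
  proof -
    have "E \<in> sets lebesgue" using E(1) by simp
    then obtain T where T: "closed T" "T \<subseteq> E" "E - T \<in> lmeasurable" "emeasure lebesgue (E - T) < ennreal e"
      by (rule sets_lebesgue_inner_closed[OF _ e])
    have "T \<subseteq> {a..b}" using T E by force
    then have "compact T" using T(1) by (meson bounded_closed_interval bounded_subset compact_eq_bounded_closed)
    then have "emeasure lborel T = 0"
    proof (rule lipschitz_quotient_gap_compact[OF lip _ _ pq])
      show "T \<subseteq> {a..<b}" using T E by auto
    qed (use T up lo in blast)+
    have "emeasure lborel E = emeasure lborel (T \<union> (E - T))" using T by (intro arg_cong[where f = "emeasure lborel"]) auto
    also have "\<dots> \<le> emeasure lborel T + emeasure lborel (E - T)"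
      using T E by (intro emeasure_subadditive) auto
    also have "\<dots> \<le> 0 + ennreal e" using T E \<open>emeasure lborel T = 0\<close> by (simp add: less_imp_le)
    finally show ?thesis .
  qed
  have "emeasure lborel E \<le> 0" by (rule ennreal_le_epsilon) (rule *)
  then show ?thesis by simp
qed

section \<open>One-sided directional derivatives\<close>

definition lipschitz_on_balls :: "('a::real_normed_vector \<Rightarrow> 'b::metric_space) \<Rightarrow> bool" where
  "lipschitz_on_balls f \<longleftrightarrow> (\<forall>R. \<exists>L. L-lipschitz_on (cball 0 R) f)"

lemma lipschitz_on_ballsE:
  assumes "lipschitz_on_balls f"
  obtains L where "L \<ge> 0" "L-lipschitz_on (cball 0 R) f"
  using assms lipschitz_on_nonneg unfolding lipschitz_on_balls_def by metis

lemma lipschitz_on_balls_imp_continuous_on: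
  assumes "lipschitz_on_balls f"
  shows "continuous_on S f"
proof -
  have "isCont f x" for x
  proof -
    obtain L where "L-lipschitz_on (cball 0 (norm x + 1)) f" using assms by (rule lipschitz_on_ballsE)
    then have "continuous_on (cball 0 (norm x + 1)) f" by (rule lipschitz_on_continuous_on)
    then have "continuous_on (ball 0 (norm x + 1)) f" by (rule continuous_on_subset) auto
    then show ?thesis by (simp add: continuous_on_eq_continuous_at)
  qed
  then show ?thesis by (simp add: continuous_at_imp_continuous_on)
qed

lemma lipschitz_on_balls_borel_measurable:
  fixes f :: "'a::euclidean_space \<Rightarrow> 'b::metric_space"
  assumes "lipschitz_on_balls f"
  shows "f \<in> borel_measurable borel"
  using lipschitz_on_balls_imp_continuous_on[OF assms] by (rule borel_measurable_continuous_onI)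

definition right_deriv :: "('a::real_normed_vector \<Rightarrow> real) \<Rightarrow> 'a \<Rightarrow> 'a \<Rightarrow> real \<Rightarrow> bool" where
  "right_deriv f e y l \<longleftrightarrow> ((\<lambda>h. (f (y + h *\<^sub>R e) - f y) / h) \<longlongrightarrow> l) (at_right 0)"

lemma lipschitz_on_line:
  assumes "L-lipschitz_on (cball 0 (norm y + T * norm e)) f" "T \<ge> 0"
  shows "(L * norm e)-lipschitz_on {0..T} (\<lambda>t. f (y + t *\<^sub>R e))"
proof (rule lipschitz_onI)
  fix s t assume st: "s \<in> {0..T}" "t \<in> {0..T}"
  have "y + r *\<^sub>R e \<in> cball 0 (norm y + T * norm e)" if "r \<in> {0..T}" for r
  proof -
    have "norm (y + r *\<^sub>R e) \<le> norm y + r * norm e" using norm_triangle_ineq[of y "r *\<^sub>R e"] that by auto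
    also have "\<dots> \<le> norm y + T * norm e" using that by (auto intro: mult_right_mono)
    finally show ?thesis by simp
  qed
  with st have "dist (f (y + s *\<^sub>R e)) (f (y + t *\<^sub>R e)) \<le> L * dist (y + s *\<^sub>R e) (y + t *\<^sub>R e)"
    using assms(1) by (blast dest: lipschitz_onD)
  also have "dist (y + s *\<^sub>R e) (y + t *\<^sub>R e) = norm e * dist s t"
    by (simp add: dist_norm dist_real_def flip: scaleR_diff_left)
  finally show "dist (f (y + s *\<^sub>R e)) (f (y + t *\<^sub>R e)) \<le> L * norm e * dist s t" by (simp add: mult.assoc)
qed (use lipschitz_on_nonneg[OF assms(1)] in auto)

text \<open>A strict inequality at one step persists at nearby steps. Testing quotients at rational
  steps only is what makes the exceptional sets in \<open>AE_right_deriv\<close> Borel.\<close>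

lemma ex_rational_at_right:
  fixes Q :: "real \<Rightarrow> real"
  assumes cont: "continuous_on {0<..} Q" and fr: "\<exists>\<^sub>F h in at_right 0. Q h < c" and d: "d > 0"
  shows "\<exists>r::rat. 0 < real_of_rat r \<and> real_of_rat r < d \<and> Q (real_of_rat r) < c"
proof -
  have "\<forall>\<^sub>F h in at_right 0. h \<in> {0<..<d}" using d by (rule eventually_at_right_real)
  with fr have "\<exists>\<^sub>F h in at_right 0. Q h < c \<and> h \<in> {0<..<d}" by (rule frequently_eventually_frequently)
  then obtain h where h: "Q h < c" "0 < h" "h < d" by (auto dest!: frequently_ex)
  then have "isCont Q h" using cont continuous_on_eq_continuous_at[of "{0<..}" Q] by simp
  then have "\<forall>\<^sub>F x in at h. Q x < c" using h(1) unfolding isCont_def by (rule order_tendstoD)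
  then obtain e where e: "e > 0" "\<And>x. x \<noteq> h \<Longrightarrow> dist x h < e \<Longrightarrow> Q x < c" unfolding eventually_at by auto
  obtain r where r: "max (h - e) 0 < real_of_rat r" "real_of_rat r < h"
    using of_rat_dense[of "max (h - e) 0" h] h e by auto
  then have "Q (real_of_rat r) < c" by (intro e(2)) (auto simp: dist_real_def)
  with r h show ?thesis by (intro exI[of _ r]) auto
qed

text \<open>If the lower and the upper limit differed, two rationals would fit strictly between
  them, with quotients below the smaller and above the larger one at arbitrarily small steps.
  Boundedness makes the common value finite.\<close>

lemma tendsto_at_right_if_no_gap:
  fixes Q :: "real \<Rightarrow> real"
  assumes cont: "continuous_on {0<..} Q" and bdd: "\<forall>\<^sub>F h in at_right 0. \<bar>Q h\<bar> \<le> B"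
    and no_gap: "\<And>p q :: rat. p < q \<Longrightarrow>
      \<not> (\<forall>n::nat. (\<exists>r::rat. 0 < real_of_rat r \<and> real_of_rat r < 1 / Suc n \<and> real_of_rat q \<le> Q (real_of_rat r)) \<and>
                   (\<exists>r::rat. 0 < real_of_rat r \<and> real_of_rat r < 1 / Suc n \<and> Q (real_of_rat r) \<le> real_of_rat p))"
  shows "\<exists>l. (Q \<longlongrightarrow> l) (at_right 0)"
proof -
  let ?F = "at_right (0::real)"
  define l u where "l = Liminf ?F (\<lambda>h. ereal (Q h))" and "u = Limsup ?F (\<lambda>h. ereal (Q h))"
  have "l \<le> u" unfolding l_def u_def by (rule Liminf_le_Limsup) simp
  have "l = u"
  proof (rule ccontr)
    assume "l \<noteq> u"
    with \<open>l \<le> u\<close> have "l < u" by simp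
    then obtain y where y: "l < ereal y" "ereal y < u" using ereal_dense2 by blast
    then obtain z where z: "y < z" "ereal z < u" using ereal_dense2 ereal_less(3) less_ereal.simps(1) by meson
    obtain p q where pq: "y < real_of_rat p" "p < q" "real_of_rat q < z"
      by (metis of_rat_dense of_rat_less z(1))
    have "l < ereal (real_of_rat p)" using y pq by (metis less_ereal.simps(1) order_less_trans)
    then have "\<exists>\<^sub>F h in ?F. Q h < real_of_rat p"
      unfolding l_def frequently_def
      using Liminf_bounded[of "ereal (real_of_rat p)" "\<lambda>h. ereal (Q h)" ?F] by (auto simp: not_less)
    moreover have "ereal (real_of_rat q) < u" using z pq by (metis less_ereal.simps(1) order_less_trans)
    then have "\<exists>\<^sub>F h in ?F. real_of_rat q < Q h"
      unfolding u_def frequently_def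
      using Limsup_bounded[of "\<lambda>h. ereal (Q h)" "ereal (real_of_rat q)" ?F] by (auto simp: not_less)
    then have "\<exists>\<^sub>F h in ?F. - Q h < - real_of_rat q" by simp
    ultimately show False using no_gap[OF pq(2)] ex_rational_at_right[OF cont]
      ex_rational_at_right[of "\<lambda>h. - Q h" "- real_of_rat q"] continuous_on_minus[OF cont]
      by (metis less_imp_le neg_less_iff_less of_nat_0_less_iff zero_less_Suc zero_less_divide_1_iff)
  qed
  then have lim: "((\<lambda>h. ereal (Q h)) \<longlongrightarrow> u) ?F"
    unfolding l_def u_def by (subst tendsto_iff_Liminf_eq_Limsup) auto
  have "u \<le> ereal B"
    unfolding u_def by (rule Limsup_bounded) (use bdd in \<open>auto elim!: eventually_mono\<close>)
  moreover have "ereal (- B) \<le> l"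
    unfolding l_def by (rule Liminf_bounded) (use bdd in \<open>auto elim!: eventually_mono\<close>)
  ultimately have "\<bar>u\<bar> \<noteq> \<infinity>" using \<open>l = u\<close> by auto
  then obtain r where "u = ereal r" by auto
  with lim show ?thesis by auto
qed

text \<open>Failure of convergence is covered by the countably many sets \<open>gap p q\<close> with
  rational \<open>p < q\<close>. Each meets every line in direction \<open>e\<close> in a null set,
  by the result in one variable.\<close>

lemma AE_right_deriv:
  fixes f :: "'a::euclidean_space \<Rightarrow> real"
  assumes f: "lipschitz_on_balls f"
  shows "AE y in lborel. \<exists>l. right_deriv f e y l"
proof -
  have [measurable]: "f \<in> borel_measurable borel" using f by (rule lipschitz_on_balls_borel_measurable)
  define gap where "gap p q y \<longleftrightarrow> (\<forall>n::nat.
     (\<exists>r::rat. 0 < real_of_rat r \<and> real_of_rat r < 1 / Suc n \<and> q * real_of_rat r \<le> f (y + real_of_rat r *\<^sub>R e) - f y) \<and>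
     (\<exists>r::rat. 0 < real_of_rat r \<and> real_of_rat r < 1 / Suc n \<and> f (y + real_of_rat r *\<^sub>R e) - f y \<le> p * real_of_rat r))"
    for p q :: real and y
  have gap_borel[measurable]: "Measurable.pred borel (gap p q)" for p q unfolding gap_def by measurable
  have null: "AE y in lborel. \<not> gap p q y" if pq: "p < q" for p q
  proof -
    define E where "E = {y. gap p q y}"
    have E[measurable]: "E \<in> sets borel" using gap_borel[of p q] by (simp add: E_def pred_def)
    have line: "(\<integral>\<^sup>+t. indicator {0..<1} t * indicator E (y + t *\<^sub>R e) \<partial>lborel) = 0" for y
    proof -
      obtain L where L: "L-lipschitz_on (cball 0 (norm y + 2 * norm e)) f" using f by (rule lipschitz_on_ballsE)
      have lip: "(L * norm e)-lipschitz_on {0..1} (\<lambda>t. f (y + t *\<^sub>R e))"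
        by (rule lipschitz_on_subset[OF lipschitz_on_line[OF L]]) auto
      define G where "G = {t \<in> {0..<1}. y + t *\<^sub>R e \<in> E}"
      have [measurable]: "G \<in> sets borel" unfolding G_def by measurable
      have "emeasure lborel G = 0"
      proof (rule lipschitz_quotient_gap_null[OF lip _ _ pq])
        fix x d :: real assume x: "x \<in> G" and d: "0 < d"
        obtain n where n: "1 / Suc n < d" using nat_approx_posE[OF d] .
        from x have "gap p q (y + x *\<^sub>R e)" by (simp add: G_def E_def)
        then show "\<exists>h>0. h < d \<and> q * h \<le> f (y + (x + h) *\<^sub>R e) - f (y + x *\<^sub>R e)"
          and "\<exists>h>0. h < d \<and> f (y + (x + h) *\<^sub>R e) - f (y + x *\<^sub>R e) \<le> p * h"
          unfolding gap_def using n by (metis (no_types, lifting) add.assoc order_less_trans scaleR_add_left)+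
      qed (auto simp: G_def)
      moreover have "indicator {0..<1} t * indicator E (y + t *\<^sub>R e) = (indicator G t :: ennreal)" for t
        by (auto simp: G_def indicator_def)
      ultimately show ?thesis by simp
    qed
    \<comment> \<open>By translation invariance the measure of \<open>E\<close> is its own average
      over the translates by \<open>t *\<^sub>R e\<close>; exchanging the integrals leaves integrals
      along lines. This avoids coordinates adapted to \<open>e\<close>.\<close>
    have "emeasure lborel E = (\<integral>\<^sup>+t. indicator {0..<1::real} t * emeasure lborel E \<partial>lborel)"
      by (simp add: nn_integral_multc)
    also have "\<dots> = (\<integral>\<^sup>+t. (\<integral>\<^sup>+y. indicator {0..<1} t * indicator E (y + t *\<^sub>R e) \<partial>lborel) \<partial>lborel)"
    proof (rule nn_integral_cong)
      fix t :: real
      have "emeasure lborel E = (\<integral>\<^sup>+y. indicator E y \<partial>distr lborel borel ((+) (t *\<^sub>R e)))"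
        by (simp add: lborel_distr_plus)
      also have "\<dots> = (\<integral>\<^sup>+y. indicator E (y + t *\<^sub>R e) \<partial>lborel)"
        by (subst nn_integral_distr) (auto simp: add.commute)
      finally show "indicator {0..<1::real} t * emeasure lborel E =
        (\<integral>\<^sup>+y. indicator {0..<1} t * indicator E (y + t *\<^sub>R e) \<partial>lborel)"
        by (simp add: nn_integral_cmult)
    qed
    also have "\<dots> = (\<integral>\<^sup>+y. (\<integral>\<^sup>+t. indicator {0..<1} t * indicator E (y + t *\<^sub>R e) \<partial>lborel) \<partial>lborel)"
      by (rule lborel_pair.Fubini') measurable
    also have "\<dots> = 0" by (simp add: line)
    finally have "E \<in> null_sets lborel" by (intro null_setsI) auto
    then show ?thesis by (rule AE_not_in[THEN AE_mp]) (simp add: E_def)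
  qed
  have "AE y in lborel. \<forall>p q :: rat. p < q \<longrightarrow> \<not> gap (real_of_rat p) (real_of_rat q) y"
    by (auto simp: AE_all_countable of_rat_less intro!: null)
  then show ?thesis
  proof (rule AE_mp, intro AE_I2 impI)
    fix y assume no_gap: "\<forall>p q :: rat. p < q \<longrightarrow> \<not> gap (real_of_rat p) (real_of_rat q) y"
    let ?Q = "\<lambda>h. (f (y + h *\<^sub>R e) - f y) / h"
    obtain L where L: "L-lipschitz_on (cball 0 (norm y + 1 * norm e)) f" using f by (rule lipschitz_on_ballsE)
    note lip = lipschitz_on_line[OF L, simplified]
    show "\<exists>l. right_deriv f e y l"
      unfolding right_deriv_def
    proof (rule tendsto_at_right_if_no_gap)
      show "continuous_on {0<..} ?Q"
        by (intro continuous_intros continuous_on_compose2[OF lipschitz_on_balls_imp_continuous_on[OF f, of UNIV]]) auto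
      have "\<bar>?Q h\<bar> \<le> L * norm e" if "h \<in> {0<..<1}" for h
        using lipschitz_onD[OF lip, of h 0] that by (simp add: dist_real_def field_simps)
      then show "\<forall>\<^sub>F h in at_right 0. \<bar>?Q h\<bar> \<le> L * norm e"
        using eventually_at_right_real[of 0 1] by (auto elim!: eventually_mono)
      fix p q :: rat assume "p < q"
      with no_gap have "\<not> gap (real_of_rat p) (real_of_rat q) y" by auto
      moreover have "c \<le> ?Q h \<longleftrightarrow> c * h \<le> f (y + h *\<^sub>R e) - f y" "?Q h \<le> c \<longleftrightarrow> f (y + h *\<^sub>R e) - f y \<le> c * h" if "h > 0" for c h
        using that by (auto simp: field_simps)
      ultimately show "\<not> (\<forall>n::nat. (\<exists>r::rat. 0 < real_of_rat r \<and> real_of_rat r < 1 / Suc n \<and> real_of_rat q \<le> ?Q (real_of_rat r)) \<and>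
                   (\<exists>r::rat. 0 < real_of_rat r \<and> real_of_rat r < 1 / Suc n \<and> ?Q (real_of_rat r) \<le> real_of_rat p))"
        unfolding gap_def by (metis (no_types, lifting))
    qed
  qed
qed

section \<open>Rademacher's theorem\<close>

definition diff_quot :: "('a::real_normed_vector \<Rightarrow> real) \<Rightarrow> 'a \<Rightarrow> nat \<Rightarrow> 'a \<Rightarrow> real" where
  "diff_quot f e k y = real (Suc k) * (f (y + (1 / Suc k) *\<^sub>R e) - f y)"

text \<open>A limit along one sequence of steps is Borel measurable in \<open>y\<close> as soon as
  \<open>f\<close> is; where it does not exist, \<open>lim\<close> has an unspecified value.\<close>

definition dir_deriv :: "('a::real_normed_vector \<Rightarrow> real) \<Rightarrow> 'a \<Rightarrow> 'a \<Rightarrow> real" where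
  "dir_deriv f e y = lim (\<lambda>k. diff_quot f e k y)"

lemma filterlim_inverse_Suc: "filterlim (\<lambda>k. 1 / real (Suc k)) (at_right 0) sequentially"
  using LIMSEQ_inverse_real_of_nat unfolding filterlim_at by (simp add: inverse_eq_divide)

lemma right_deriv_imp_diff_quot:
  assumes "right_deriv f e y l"
  shows "(\<lambda>k. diff_quot f e k y) \<longlonglongrightarrow> l"
  using filterlim_compose[OF assms[unfolded right_deriv_def] filterlim_inverse_Suc]
  by (simp add: diff_quot_def mult.commute)

lemma right_deriv_dir_deriv:
  assumes "right_deriv f e y l"
  shows "dir_deriv f e y = l"
  unfolding dir_deriv_def using right_deriv_imp_diff_quot[OF assms] by (rule limI)

lemma borel_measurable_diff_quot[measurable]:
  fixes f :: "'a::euclidean_space \<Rightarrow> real"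
  assumes [measurable]: "f \<in> borel_measurable borel"
  shows "diff_quot f e k \<in> borel_measurable borel" "dir_deriv f e \<in> borel_measurable borel"
proof -
  show [measurable]: "diff_quot f e k \<in> borel_measurable borel" for k
    unfolding diff_quot_def[abs_def] by measurable
  show "dir_deriv f e \<in> borel_measurable borel" unfolding dir_deriv_def[abs_def] by measurable
qed

lemma norm_diff_quot_vec_le:
  fixes f :: "'a::real_normed_vector \<Rightarrow> 'b::real_normed_vector"
  assumes "L-lipschitz_on (cball 0 (R + norm e)) f" "norm y \<le> R"
  shows "norm (real (Suc k) *\<^sub>R (f (y + (1 / Suc k) *\<^sub>R e) - f y)) \<le> L * norm e"
proof -
  have "norm ((1 / Suc k) *\<^sub>R e) \<le> norm e" by (simp add: field_simps)
  then have "norm (y + (1 / Suc k) *\<^sub>R e) \<le> R + norm e"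
    using norm_triangle_ineq[of y "(1 / Suc k) *\<^sub>R e"] assms(2) by linarith
  then have "dist (f (y + (1 / Suc k) *\<^sub>R e)) (f y) \<le> L * dist (y + (1 / Suc k) *\<^sub>R e) y"
    using assms(2) norm_ge_zero[of e] by (intro lipschitz_onD[OF assms(1)]) (simp_all del: norm_ge_zero)
  then have "real (Suc k) * norm (f (y + (1 / Suc k) *\<^sub>R e) - f y) \<le> real (Suc k) * (L * (1 / Suc k * norm e))"
    by (intro mult_left_mono) (simp_all add: dist_norm)
  also have "\<dots> = L * norm e" by (simp add: field_simps)
  finally show ?thesis by simp
qed

lemma abs_diff_quot_le:
  assumes "L-lipschitz_on (cball 0 (R + norm e)) f" "norm y \<le> R"
  shows "\<bar>diff_quot f e k y\<bar> \<le> L * norm e"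
  using norm_diff_quot_vec_le[OF assms, of k] by (simp add: diff_quot_def abs_mult)

section \<open>Difference quotients integrated over boxes\<close>

lemma integral_lborel_translate:
  fixes g :: "'a::euclidean_space \<Rightarrow> 'b::{banach, second_countable_topology}"
  assumes [measurable]: "g \<in> borel_measurable borel"
  shows "(\<integral>y. g (y + c) \<partial>lborel) = integral\<^sup>L lborel g"
proof -
  have "integral\<^sup>L lborel g = integral\<^sup>L (distr lborel borel ((+) c)) g" by (simp add: lborel_distr_plus)
  also have "\<dots> = (\<integral>y. g (c + y) \<partial>lborel)" by (rule integral_distr) simp_all
  finally show ?thesis by (simp add: add.commute)
qed

lemma null_sets_box_boundary: "cbox a b - box a b \<in> null_sets lborel"
  using negligible_frontier_interval[of a b]
  by (simp add: negligible_iff_null_sets null_sets_completion_iff)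

text \<open>Boxes are stable under intersection and generate the Borel sets, and the sets over which
  the integral vanishes are closed under complements and countable disjoint unions.\<close>

lemma AE_zero_if_box_integrals_zero:
  fixes h :: "'a::euclidean_space \<Rightarrow> real"
  assumes int: "\<And>a b. integrable lborel (\<lambda>x. indicator (box a b) x * h x)"
    and zero: "\<And>a b. (\<integral>x. indicator (box a b) x * h x \<partial>lborel) = 0"
  shows "AE x in lborel. h x = 0"
proof -
  \<comment> \<open>Integrability is given over boxes only; truncation to \<open>V n\<close> makes
    integrals over complements meaningful.\<close>
  define V :: "nat \<Rightarrow> 'a set" where "V n = box (- real n *\<^sub>R One) (real n *\<^sub>R One)" for n
  have V: "AE x in lborel. indicator (V n) x * h x = 0" for n
  proof (rule sigma_finite_measure.density_zero[OF sigma_finite_lborel])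
    let ?g = "\<lambda>x. indicator (V n) x * h x"
    show g: "integrable lborel ?g" unfolding V_def by (rule int)
    have box_case: "(LINT x:box a b|lborel. ?g x) = 0" for a b
    proof -
      obtain c d where "box a b \<inter> V n = box c d" unfolding V_def using box_Int_box by blast
      then have eq: "(\<lambda>x. indicator (box a b) x * (indicator (V n) x * h x)) = (\<lambda>x. indicator (box c d) x * h x)"
        by (auto simp: indicator_def fun_eq_iff)
      show ?thesis unfolding set_lebesgue_integral_def real_scaleR_def eq by (rule zero)
    qed
    have stable: "Int_stable (range (\<lambda>(a, b). box a b :: 'a set))"
      unfolding Int_stable_def by (auto simp: box_Int_box)
    have boxes: "range (\<lambda>(a, b). box a b :: 'a set) \<subseteq> Pow UNIV" by simp
    fix A :: "'a set" assume "A \<in> sets lborel"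
    then have "A \<in> sigma_sets UNIV (range (\<lambda>(a, b). box a b :: 'a set))"
      by (simp add: borel_eq_box)
    then show "(LINT x:A|lborel. ?g x) = 0"
    proof (induction rule: sigma_sets_induct_disjoint[OF stable boxes, consumes 1, case_names basic empty compl union])
      case (basic A)
      then show ?case using box_case by auto
    next
      case empty show ?case by (simp add: set_lebesgue_integral_def)
    next
      case (compl A)
      then have A: "A \<in> sets lborel" by (simp add: borel_eq_box)
      have "(LINT x:UNIV|lborel. ?g x) = (LINT x:A|lborel. ?g x) + (LINT x:UNIV - A|lborel. ?g x)"
        using A g by (subst set_integral_Un[symmetric])
          (auto simp: Un_UNIV_right set_integrable_def intro!: integrable_mult_indicator[of _ lborel ?g, simplified])
      moreover have "(LINT x:UNIV|lborel. ?g x) = 0" using zero by (simp add: set_lebesgue_integral_def V_def)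
      ultimately show ?case using compl by simp
    next
      case (union A)
      then have "A i \<in> sets lborel" for i by (auto simp: borel_eq_box)
      with union(1) have "(LINT x:(\<Union>i. A i)|lborel. ?g x) = (\<Sum>i. (LINT x:A i|lborel. ?g x))"
        by (intro lebesgue_integral_countable_add)
          (auto simp: disjoint_family_on_def set_integrable_def intro!: integrable_mult_indicator[of _ lborel ?g, simplified] g)
      with union show ?case by simp
    qed
  qed
  have "AE x in lborel. \<forall>n. indicator (V n) x * h x = 0" using V unfolding AE_all_countable by blast
  then show ?thesis
  proof (rule AE_mp, intro AE_I2 impI)
    fix x :: 'a assume *: "\<forall>n. indicator (V n) x * h x = 0"
    obtain n :: nat where "norm x < real n" using reals_Archimedean2 by blast
    then have "x \<in> V n" unfolding V_def
      using Basis_le_norm[of _ x] by (force simp: box_def)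
    with * show "h x = 0" by (metis indicator_simps(1) mult_1)
  qed
qed

text \<open>Moving the translation by \<open>a / (k + 1)\<close> from the quotients to the indicator of the box leaves
  a dominated convergence.\<close>
lemma integral_box_translated_tendsto:
  fixes D :: "nat \<Rightarrow> 'a::euclidean_space \<Rightarrow> real"
  assumes [measurable]: "\<And>k. D k \<in> borel_measurable borel" "D' \<in> borel_measurable borel"
    and lim: "AE y in lborel. (\<lambda>k. D k y) \<longlonglongrightarrow> D' y"
    and bound: "\<And>R. \<exists>C. \<forall>k y. norm y \<le> R \<longrightarrow> \<bar>D k y\<bar> \<le> C"
  shows "(\<lambda>k. \<integral>y. indicator (box u v) y * D k (y + (1 / Suc k) *\<^sub>R a) \<partial>lborel)
           \<longlonglongrightarrow> (\<integral>y. indicator (box u v) y * D' y \<partial>lborel)"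
    and "integrable lborel (\<lambda>y. indicator (box u v) y * D' y)"
proof -
  let ?a = "\<lambda>k. (1 / real (Suc k)) *\<^sub>R a"
  obtain R where "\<forall>y\<in>box u v. norm y \<le> R" using bounded_box[of u v] by (auto simp: bounded_iff)
  then have R: "box u v \<subseteq> cball 0 R" by auto
  obtain C where C: "\<And>k y. norm y \<le> R + norm a \<Longrightarrow> \<bar>D k y\<bar> \<le> C" using bound by metis
  define B where "B y = \<bar>C\<bar> * indicator (cball 0 (R + norm a)) y" for y :: 'a
  have B: "integrable lborel B" unfolding B_def
    by (intro integrable_mult_right integrable_real_indicator) (auto simp: emeasure_bounded_finite[simplified])
  have dom: "norm (indicator (box u v) (y - ?a k) * D k y) \<le> B y" for k y
  proof (cases "y - ?a k \<in> box u v")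
    case True
    with R have "norm (y - ?a k) \<le> R" by auto
    moreover have "norm (?a k) \<le> norm a" by (simp add: field_simps)
    ultimately have "norm y \<le> R + norm a" using norm_triangle_ineq2[of y "?a k"] by linarith
    with C[OF this, of k] True show ?thesis by (simp add: B_def)
  qed (simp add: B_def)
  \<comment> \<open>Off the boundary of the box the translated indicators are eventually constant,
    and the boundary is a null set.\<close>
  have conv: "AE y in lborel. (\<lambda>k. indicator (box u v) (y - ?a k) * D k y) \<longlonglongrightarrow> indicator (box u v) y * D' y"
    using lim AE_not_in[OF null_sets_box_boundary[of u v]]
  proof eventually_elim
    fix y assume lim: "(\<lambda>k. D k y) \<longlonglongrightarrow> D' y" and y: "y \<notin> cbox u v - box u v"
    have "(\<lambda>k. y - ?a k) \<longlonglongrightarrow> y - 0 *\<^sub>R a"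
      using filterlim_inverse_Suc unfolding filterlim_at by (intro tendsto_intros) auto
    then have *: "(\<lambda>k. y - ?a k) \<longlonglongrightarrow> y" by simp
    have "\<forall>\<^sub>F k in sequentially. indicator (box u v) (y - ?a k) = (indicator (box u v) y :: real)"
    proof (cases "y \<in> box u v")
      case True
      then have "\<forall>\<^sub>F k in sequentially. y - ?a k \<in> box u v" by (rule topological_tendstoD[OF * open_box])
      then show ?thesis using True by (auto elim!: eventually_mono)
    next
      case False
      with y have "y \<in> - cbox u v" by auto
      then have "\<forall>\<^sub>F k in sequentially. y - ?a k \<in> - cbox u v"
        by (intro topological_tendstoD[OF *]) (auto intro: open_Compl)
      then show ?thesis using False box_subset_cbox[of u v] by (auto elim!: eventually_mono simp: indicator_def)
    qed
    then show "(\<lambda>k. indicator (box u v) (y - ?a k) * D k y) \<longlonglongrightarrow> indicator (box u v) y * D' y"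
      by (intro tendsto_mult lim tendsto_eventually)
  qed
  have "(\<lambda>k. \<integral>y. indicator (box u v) (y - ?a k) * D k y \<partial>lborel) \<longlonglongrightarrow> (\<integral>y. indicator (box u v) y * D' y \<partial>lborel)"
    by (rule integral_dominated_convergence[OF _ _ B conv]) (use dom in auto)
  moreover have "(\<integral>y. indicator (box u v) y * D k (y + ?a k) \<partial>lborel) = (\<integral>y. indicator (box u v) (y - ?a k) * D k y \<partial>lborel)" for k
    using integral_lborel_translate[of "\<lambda>y. indicator (box u v) (y - ?a k) * D k y" "?a k"] by simp
  ultimately show "(\<lambda>k. \<integral>y. indicator (box u v) y * D k (y + (1 / Suc k) *\<^sub>R a) \<partial>lborel)
           \<longlonglongrightarrow> (\<integral>y. indicator (box u v) y * D' y \<partial>lborel)" by simp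
  show "integrable lborel (\<lambda>y. indicator (box u v) y * D' y)"
    by (rule integrable_dominated_convergence[OF _ _ B conv]) (use dom in auto)
qed

lemma diff_quot_locally_bounded:
  assumes "lipschitz_on_balls f"
  shows "\<exists>C. \<forall>k y. norm y \<le> R \<longrightarrow> \<bar>diff_quot f e k y\<bar> \<le> C"
  using assms abs_diff_quot_le by (metis lipschitz_on_ballsE)

lemma AE_diff_quot_tendsto:
  fixes f :: "'a::euclidean_space \<Rightarrow> real"
  assumes "lipschitz_on_balls f"
  shows "AE y in lborel. (\<lambda>k. diff_quot f e k y) \<longlonglongrightarrow> dir_deriv f e y"
  using AE_right_deriv[OF assms, of e]
  by eventually_elim (use right_deriv_imp_diff_quot right_deriv_dir_deriv in blast)

text \<open>The quotient in direction \<open>e + a\<close> minus the one in direction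
  \<open>a\<close> is the quotient in direction \<open>e\<close> at a base point moved by
  \<open>a / (k + 1)\<close>. Pointwise nothing is known about quotients at moving base points, but
  their integrals over boxes converge.\<close>

lemma AE_dir_deriv_add:
  fixes f :: "'a::euclidean_space \<Rightarrow> real"
  assumes f: "lipschitz_on_balls f"
  shows "AE y in lborel. dir_deriv f (e + a) y = dir_deriv f e y + dir_deriv f a y"
proof -
  note meas[measurable] = lipschitz_on_balls_borel_measurable[OF f]
  note lim = integral_box_translated_tendsto[OF borel_measurable_diff_quot(1)[OF meas]
      borel_measurable_diff_quot(2)[OF meas] AE_diff_quot_tendsto[OF f] diff_quot_locally_bounded[OF f]]
  have split: "diff_quot f (e + a) k y - diff_quot f a k y = diff_quot f e k (y + (1 / Suc k) *\<^sub>R a)" for k y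
    by (simp add: diff_quot_def algebra_simps)
  have "AE y in lborel. dir_deriv f (e + a) y - dir_deriv f a y - dir_deriv f e y = 0"
  proof (rule AE_zero_if_box_integrals_zero)
    fix u v :: 'a
    let ?I = "\<lambda>g. (\<integral>y. indicator (box u v) y * g y \<partial>lborel)"
    note int = lim(2)[of u v]
    show "integrable lborel (\<lambda>y. indicator (box u v) y * (dir_deriv f (e + a) y - dir_deriv f a y - dir_deriv f e y))"
      using int by (simp add: right_diff_distrib)
    have int_k: "integrable lborel (\<lambda>y. indicator (box u v) y * diff_quot f b k y)" for b k
    proof -
      obtain R where "\<forall>y\<in>box u v. norm y \<le> R" using bounded_box[of u v] by (auto simp: bounded_iff)
  then have R: "box u v \<subseteq> cball 0 R" by auto
      obtain C where C: "\<And>k y. norm y \<le> R \<Longrightarrow> \<bar>diff_quot f b k y\<bar> \<le> C" using diff_quot_locally_bounded[OF f] by metis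
      have "integrable lborel (\<lambda>y. \<bar>C\<bar> * indicator (box u v) y)"
        by (intro integrable_mult_right integrable_real_indicator) (auto simp: emeasure_bounded_finite[simplified])
      then show ?thesis
      proof (rule Bochner_Integration.integrable_bound)
        have "\<bar>diff_quot f b k y\<bar> \<le> \<bar>C\<bar>" if "y \<in> box u v" for y
          using C[of y k] that R by fastforce
        then show "AE y in lborel. norm (indicator (box u v) y * diff_quot f b k y) \<le> norm (\<bar>C\<bar> * indicator (box u v) y)"
          by (intro AE_I2) (auto simp: indicator_def)
      qed measurable
    qed
    have "(\<lambda>k. ?I (diff_quot f (e + a) k) - ?I (diff_quot f a k)) \<longlonglongrightarrow> ?I (dir_deriv f (e + a)) - ?I (dir_deriv f a)"
      using lim(1)[of u v _ 0] by (intro tendsto_diff) simp_all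
    moreover have "?I (diff_quot f (e + a) k) - ?I (diff_quot f a k)
        = (\<integral>y. indicator (box u v) y * diff_quot f e k (y + (1 / Suc k) *\<^sub>R a) \<partial>lborel)" for k
      by (subst Bochner_Integration.integral_diff[symmetric])
        (auto simp: int_k split simp flip: right_diff_distrib)
    ultimately have "?I (dir_deriv f (e + a)) - ?I (dir_deriv f a) = ?I (dir_deriv f e)"
      using lim(1)[of u v e a] LIMSEQ_unique by simp
    then show "?I (\<lambda>y. dir_deriv f (e + a) y - dir_deriv f a y - dir_deriv f e y) = 0"
      using int by (simp add: right_diff_distrib)
  qed
  then show ?thesis by (rule AE_mp) (auto intro!: AE_I2)
qed

section \<open>Linearity in the direction and total differentiability\<close>

lemma right_deriv_scaleR:
  assumes "right_deriv f e y l" "c > 0"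
  shows "right_deriv f (c *\<^sub>R e) y (c * l)"
proof -
  have "filterlim (\<lambda>h. h * c) (at_right 0) (at_right 0)"
    unfolding filterlim_at
  proof
    show "((\<lambda>h. h * c) \<longlongrightarrow> 0) (at_right 0)" by (auto intro!: tendsto_eq_intros)
    show "\<forall>\<^sub>F h in at_right 0. h * c \<in> {0<..} \<and> h * c \<noteq> 0"
      using eventually_at_right_less[of 0] by eventually_elim (use assms(2) in auto)
  qed
  then have "((\<lambda>h. c * ((f (y + (h * c) *\<^sub>R e) - f y) / (h * c))) \<longlongrightarrow> c * l) (at_right 0)"
    by (intro tendsto_mult tendsto_const filterlim_compose[OF assms(1)[unfolded right_deriv_def]])
  then show ?thesis using assms(2) by (simp add: right_deriv_def)
qed

lemma right_deriv_0: "right_deriv f 0 y 0"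
  by (simp add: right_deriv_def)

text \<open>One-sided derivatives respect only positive factors. For negative ones, additivity in
  the directions \<open>e\<close> and \<open>- e\<close> shows that the two derivatives are
  opposite.\<close>

lemma AE_dir_deriv_scaleR:
  fixes f :: "'a::euclidean_space \<Rightarrow> real"
  assumes f: "lipschitz_on_balls f"
  shows "AE y in lborel. dir_deriv f (c *\<^sub>R e) y = c * dir_deriv f e y"
  using AE_right_deriv[OF f, of e] AE_right_deriv[OF f, of "- e"] AE_dir_deriv_add[OF f, of e "- e"]
proof eventually_elim
  fix y assume "\<exists>l. right_deriv f e y l" "\<exists>l. right_deriv f (- e) y l"
    and add: "dir_deriv f (e + - e) y = dir_deriv f e y + dir_deriv f (- e) y"
  then obtain l m where l: "right_deriv f e y l" and m: "right_deriv f (- e) y m" by auto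
  have "m = - l" using add by (simp add: right_deriv_dir_deriv[OF l] right_deriv_dir_deriv[OF m] right_deriv_dir_deriv[OF right_deriv_0])
  consider "c > 0" | "c = 0" | "c < 0" by linarith
  then show "dir_deriv f (c *\<^sub>R e) y = c * dir_deriv f e y"
  proof cases
    case 1
    show ?thesis using right_deriv_dir_deriv[OF right_deriv_scaleR[OF l 1]] right_deriv_dir_deriv[OF l] by simp
  next
    case 2
    then show ?thesis by (simp add: right_deriv_dir_deriv[OF right_deriv_0])
  next
    case 3
    then have "- c > 0" by simp
    from right_deriv_dir_deriv[OF right_deriv_scaleR[OF m this]] right_deriv_dir_deriv[OF l] \<open>m = - l\<close>
    show ?thesis by simp
  qed
qed

lemma AE_dir_deriv_linear:
  fixes f :: "'a::euclidean_space \<Rightarrow> real"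
  assumes f: "lipschitz_on_balls f"
  shows "AE y in lborel. dir_deriv f e y = (\<Sum>b\<in>Basis. (e \<bullet> b) * dir_deriv f b y)"
proof -
  have "AE y in lborel. dir_deriv f (\<Sum>b\<in>S. (e \<bullet> b) *\<^sub>R b) y = (\<Sum>b\<in>S. (e \<bullet> b) * dir_deriv f b y)"
    if "finite S" for S :: "'a set"
    using that
  proof induction
    case empty
    then show ?case by (simp add: right_deriv_dir_deriv[OF right_deriv_0])
  next
    case (insert b S)
    show ?case
      using insert.IH AE_dir_deriv_scaleR[OF f, of "e \<bullet> b" b]
        AE_dir_deriv_add[OF f, of "(e \<bullet> b) *\<^sub>R b" "\<Sum>b\<in>S. (e \<bullet> b) *\<^sub>R b"]
      by eventually_elim (use insert.hyps in simp)
  qed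
  from this[of Basis] show ?thesis by (simp add: euclidean_representation)
qed

text \<open>The unit sphere is covered by finitely many small balls around the dense directions.\<close>
lemma has_derivative_if_right_deriv_dense:
  fixes f :: "'a::euclidean_space \<Rightarrow> real"
  assumes f: "lipschitz_on_balls f"
    and dense: "closure D = UNIV" and deriv: "\<And>e. e \<in> D \<Longrightarrow> right_deriv f e y (e \<bullet> J)"
  shows "(f has_derivative (\<lambda>v. v \<bullet> J)) (at y)"
  unfolding has_derivative_at_alt
proof (intro conjI allI impI)
  show "bounded_linear (\<lambda>v. v \<bullet> J)" by (rule bounded_linear_inner_left)
  fix r :: real assume r: "0 < r"
  obtain L where L: "L \<ge> 0" "L-lipschitz_on (cball 0 (norm y + 2)) f" using f by (rule lipschitz_on_ballsE)
  \<comment> \<open>The three summands are the costs, per unit of \<open>s\<close>, of replacing the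
    direction \<open>w\<close> by \<open>e\<close> in \<open>f\<close>, of the quotient at
    \<open>e\<close>, and of replacing \<open>e\<close> by \<open>w\<close> in the linear
    term.\<close>
  define s where "s = min 1 (r / (L + 1 + norm J))"
  have pos: "L + 1 + norm J > 0" using L by (simp add: add_nonneg_pos add_pos_nonneg)
  have "s \<le> r / (L + 1 + norm J)" by (simp add: s_def)
  then have s: "s > 0" "s \<le> 1" "s * (L + 1 + norm J) \<le> r"
    using r pos by (simp_all only: pos_le_divide_eq) (auto simp: s_def)
  have "sphere (0::'a) 1 \<subseteq> (\<Union>e\<in>D. ball e s)"
  proof
    fix x :: 'a
    have "x \<in> closure D" using dense by simp
    then show "x \<in> (\<Union>e\<in>D. ball e s)" using s(1) by (force simp: closure_approachable)
  qed
  then obtain T where T: "T \<subseteq> D" "finite T" "sphere 0 1 \<subseteq> (\<Union>e\<in>T. ball e s)"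
    using compactE_image[OF compact_sphere[of "0::'a" 1], of D "\<lambda>e. ball e s"] by auto
  have "\<forall>\<^sub>F h in at_right 0. \<forall>e\<in>T. \<bar>(f (y + h *\<^sub>R e) - f y) / h - e \<bullet> J\<bar> < s"
    using T deriv s(1) by (intro eventually_ball_finite)
      (auto simp: right_deriv_def tendsto_iff dist_real_def)
  then obtain d where d: "d > 0" "\<And>h e. \<lbrakk>0 < h; h < d; e \<in> T\<rbrakk> \<Longrightarrow> \<bar>(f (y + h *\<^sub>R e) - f y) / h - e \<bullet> J\<bar> < s"
    by (auto simp: eventually_at dist_real_def)
  define d' where "d' = min 1 d"
  have "norm (f x - f y - (x - y) \<bullet> J) \<le> r * norm (x - y)" if x: "norm (x - y) < d'" for x
  proof (cases "x = y")
    case False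
    define h where "h = norm (x - y)"
    define w where "w = (1 / h) *\<^sub>R (x - y)"
    have h: "0 < h" "h < d" "h < 1" using False x by (auto simp: h_def d'_def)
    have w: "norm w = 1" and xw: "x = y + h *\<^sub>R w" using h by (auto simp: w_def h_def)
    then obtain e where e: "e \<in> T" "dist e w < s" using T(3) by force
    have "norm (h *\<^sub>R e) \<le> 2"
    proof -
      have "norm e \<le> norm w + norm (e - w)" by (metis norm_triangle_sub)
      with w e s have "norm e \<le> 2" by (simp add: dist_norm)
      then have "h * norm e \<le> 1 * 2" using h by (intro mult_mono) auto
      then show ?thesis using h by simp
    qed
    then have "norm (y + h *\<^sub>R e) \<le> norm y + 2" using norm_triangle_ineq[of y "h *\<^sub>R e"] by linarith
    moreover have "norm (y + h *\<^sub>R w) \<le> norm y + 2" using norm_triangle_ineq[of y "h *\<^sub>R w"] w h by simp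
    ultimately have "dist (f (y + h *\<^sub>R w)) (f (y + h *\<^sub>R e)) \<le> L * dist (y + h *\<^sub>R w) (y + h *\<^sub>R e)"
      by (intro lipschitz_onD[OF L(2)]) auto
    also have "\<dots> = L * (h * dist w e)" using h by (simp add: dist_norm flip: scaleR_diff_right)
    also have "\<dots> \<le> L * (h * s)" using L h e by (intro mult_left_mono) (auto simp: dist_commute)
    finally have 1: "\<bar>f x - f (y + h *\<^sub>R e)\<bar> \<le> L * (h * s)" by (simp add: xw dist_real_def)
    have "\<bar>(f (y + h *\<^sub>R e) - f y) / h - e \<bullet> J\<bar> * h \<le> s * h"
      using d(2)[OF h(1,2) e(1)] h by (intro mult_right_mono) auto
    moreover have "f (y + h *\<^sub>R e) - f y - h * (e \<bullet> J) = ((f (y + h *\<^sub>R e) - f y) / h - e \<bullet> J) * h"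
      using h by (simp add: field_simps)
    ultimately have 2: "\<bar>f (y + h *\<^sub>R e) - f y - h * (e \<bullet> J)\<bar> \<le> s * h"
      using h by (simp add: abs_mult)
    have "\<bar>(e - w) \<bullet> J\<bar> \<le> norm (e - w) * norm J" by (rule Cauchy_Schwarz_ineq2)
    also have "\<dots> \<le> s * norm J" using e by (intro mult_right_mono) (auto simp: dist_norm)
    finally have "h * \<bar>(e - w) \<bullet> J\<bar> \<le> h * (s * norm J)" using h by (intro mult_left_mono) auto
    then have 3: "\<bar>h * (e \<bullet> J) - h * (w \<bullet> J)\<bar> \<le> h * (s * norm J)"
      using h by (simp add: inner_diff_left abs_mult flip: right_diff_distrib)
    have "\<bar>f x - f y - h * (w \<bullet> J)\<bar> \<le> L * (h * s) + s * h + h * (s * norm J)"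
      using 1 2 3 by linarith
    also have "\<dots> = h * (s * (L + 1 + norm J))" by (simp add: algebra_simps)
    also have "\<dots> \<le> h * r" using s h by (intro mult_left_mono) auto
    finally show ?thesis by (simp add: xw w h(1) less_imp_le mult.commute)
  qed simp
  then show "\<exists>d>0. \<forall>x. norm (x - y) < d \<longrightarrow> norm (f x - f y - (x - y) \<bullet> J) \<le> r * norm (x - y)"
    using d(1) by (intro exI[of _ d']) (auto simp: d'_def)
qed

text \<open>Existence and linearity of directional derivatives hold off a null set that depends on
  the direction; a countable dense set of directions leaves one null set.\<close>

lemma rademacher_real:
  fixes f :: "'a::euclidean_space \<Rightarrow> real"
  assumes f: "lipschitz_on_balls f"
  shows "AE y in lborel. f differentiable (at y)"
proof -
  obtain D :: "'a set" where D: "countable D" "\<And>X. open X \<Longrightarrow> X \<noteq> {} \<Longrightarrow> \<exists>d\<in>D. d \<in> X"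
    using countable_dense_exists[where 'a = 'a] by auto
  have dense: "closure D = UNIV"
  proof (intro set_eqI iffI UNIV_I)
    fix x
    show "x \<in> closure D" unfolding closure_approachable
      using D(2)[of "ball x e" for e] by (force simp: dist_commute)
  qed
  have "AE y in lborel. \<forall>e\<in>D. (\<exists>l. right_deriv f e y l) \<and> dir_deriv f e y = (\<Sum>b\<in>Basis. (e \<bullet> b) * dir_deriv f b y)"
    using AE_right_deriv[OF f] AE_dir_deriv_linear[OF f] by (auto simp: AE_ball_countable[OF D(1)])
  then show ?thesis
  proof (rule AE_mp, intro AE_I2 impI)
    fix y assume *: "\<forall>e\<in>D. (\<exists>l. right_deriv f e y l) \<and> dir_deriv f e y = (\<Sum>b\<in>Basis. (e \<bullet> b) * dir_deriv f b y)"
    define J where "J = (\<Sum>b\<in>Basis. dir_deriv f b y *\<^sub>R b)"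
    have "right_deriv f e y (e \<bullet> J)" if e: "e \<in> D" for e
    proof -
      obtain l where l: "right_deriv f e y l" using bspec[OF * e] by blast
      have "l = e \<bullet> J" using bspec[OF * e]
        by (simp add: right_deriv_dir_deriv[OF l, symmetric] J_def inner_sum_right mult.commute)
      with l show ?thesis by simp
    qed
    from has_derivative_if_right_deriv_dense[OF f dense this]
    show "f differentiable (at y)" by (auto simp: differentiable_def)
  qed
qed

theorem rademacher:
  fixes f :: "'a::euclidean_space \<Rightarrow> 'b::euclidean_space"
  assumes f: "lipschitz_on_balls f"
  shows "AE y in lborel. f differentiable (at y)"
proof -
  have "lipschitz_on_balls (\<lambda>y. f y \<bullet> b)" for b
    unfolding lipschitz_on_balls_def
  proof
    fix R
    obtain L where L: "L \<ge> 0" "L-lipschitz_on (cball 0 R) f" using f by (rule lipschitz_on_ballsE)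
    have "(L * norm b)-lipschitz_on (cball 0 R) (\<lambda>y. f y \<bullet> b)"
    proof (rule lipschitz_onI)
      fix x y :: 'a assume xy: "x \<in> cball 0 R" "y \<in> cball 0 R"
      have "dist (f x \<bullet> b) (f y \<bullet> b) \<le> dist (f x) (f y) * norm b"
        using Cauchy_Schwarz_ineq2[of "f x - f y" b] by (simp add: dist_norm inner_diff_left)
      also have "\<dots> \<le> L * dist x y * norm b" using lipschitz_onD[OF L(2) xy] by (intro mult_right_mono) auto
      finally show "dist (f x \<bullet> b) (f y \<bullet> b) \<le> L * norm b * dist x y" by (simp add: algebra_simps)
    qed (use L in auto)
    then show "\<exists>L. L-lipschitz_on (cball 0 R) (\<lambda>y. f y \<bullet> b)" by blast
  qed
  then have "AE y in lborel. \<forall>b\<in>Basis. (\<lambda>y. f y \<bullet> b) differentiable (at y)"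
    by (auto simp: AE_ball_countable[OF countable_finite[OF finite_Basis]] intro!: rademacher_real)
  then show ?thesis by (rule AE_mp) (use differentiable_componentwise_within[of f _ UNIV] in auto)
qed

section \<open>Averaged Jacobians\<close>

text \<open>A normalised cone: the kernel is never differentiated, so compact support and a
  Lipschitz constant are enough.\<close>

definition bump :: "'a::euclidean_space \<Rightarrow> real" where
  "bump w = max 0 (1 - norm w) / (\<integral>w. max 0 (1 - norm (w::'a)) \<partial>lborel)"

abbreviation jacobian_at :: "(real^'d \<Rightarrow> real^'n) \<Rightarrow> real^'d \<Rightarrow> real^'d^'n" where
  "jacobian_at f y \<equiv> matrix (frechet_derivative f (at y))"

text \<open>A version of the Jacobian that is measurable without any assumption on differentiability.\<close>
definition jac_lim :: "(real^'d \<Rightarrow> real^'n) \<Rightarrow> real^'d \<Rightarrow> real^'d^'n" where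
  "jac_lim f y = (\<chi> i j. dir_deriv (\<lambda>y. f y $ i) (axis j 1) y)"

text \<open>By \<open>bump_avg_diff_quot_tendsto\<close> this is the directional derivative matrix
  at \<open>c\<close> of \<open>f\<close> mollified at scale \<open>\<delta>\<close>.\<close>

definition jac_avg :: "(real^'d \<Rightarrow> real^'n) \<Rightarrow> real^'d \<Rightarrow> real \<Rightarrow> real^'d^'n" where
  "jac_avg f c \<delta> = (\<integral>w. bump w *\<^sub>R jac_lim f (c + \<delta> *\<^sub>R w) \<partial>lborel)"

lemma integrable_cone: "integrable lborel (\<lambda>w::'a::euclidean_space. max 0 (1 - norm w))"
proof (rule Bochner_Integration.integrable_bound)
  show "integrable lborel (indicator (cball 0 1) :: 'a \<Rightarrow> real)"
    by (intro integrable_real_indicator) (auto simp: emeasure_bounded_finite[simplified])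
qed (auto simp: indicator_def)

lemma integral_cone_pos: "0 < (\<integral>w. max 0 (1 - norm (w::'a::euclidean_space)) \<partial>lborel)"
proof -
  have "0 < 1/2 * measure lborel (ball (0::'a) (1/2))"
    using content_ball_pos[of "1/2" "0::'a"] by simp
  also have "\<dots> = (\<integral>w. 1/2 * indicator (ball (0::'a) (1/2)) w \<partial>lborel)" by simp
  also have "\<dots> \<le> (\<integral>w. max 0 (1 - norm (w::'a)) \<partial>lborel)"
  proof (rule integral_mono)
    show "integrable lborel (\<lambda>w::'a. 1/2 * indicator (ball 0 (1/2)) w :: real)"
      by (intro integrable_mult_right integrable_real_indicator) (auto simp: emeasure_bounded_finite[simplified])
  qed (auto simp: integrable_cone indicator_def)
  finally show ?thesis .
qed

lemma bump_nonneg: "0 \<le> bump w"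
  unfolding bump_def using integral_cone_pos[where 'a = 'a] by simp

lemma bump_eq_0: "1 \<le> norm w \<Longrightarrow> bump w = 0"
  by (simp add: bump_def)

lemma borel_measurable_bump[measurable]: "bump \<in> borel_measurable borel"
  unfolding bump_def[abs_def] by measurable

lemma integrable_bump: "integrable lborel bump"
  unfolding bump_def[abs_def] using integrable_cone by (rule integrable_divide_zero) 

lemma integral_bump: "(\<integral>w. bump (w::'a::euclidean_space) \<partial>lborel) = 1"
  unfolding bump_def using integral_cone_pos[where 'a = 'a] by simp

lemma bump_lipschitz: "\<exists>K\<ge>0. \<forall>v w :: 'a::euclidean_space. \<bar>bump v - bump w\<bar> \<le> K * norm (v - w)"
proof -
  let ?c = "\<integral>w. max 0 (1 - norm (w::'a)) \<partial>lborel"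
  have c: "?c > 0" by (rule integral_cone_pos)
  have "\<bar>bump v - bump w\<bar> \<le> (1 / ?c) * norm (v - w)" for v w :: 'a
  proof -
    have "\<bar>max 0 (1 - norm v) - max 0 (1 - norm w)\<bar> \<le> norm (v - w)"
      using norm_triangle_ineq3[of v w] by linarith
    then have "\<bar>max 0 (1 - norm v) - max 0 (1 - norm w)\<bar> / ?c \<le> norm (v - w) / ?c"
      using c by (intro divide_right_mono) auto
    then show ?thesis using c unfolding bump_def by (simp flip: diff_divide_distrib)
  qed
  with c show ?thesis by (intro exI[of _ "1 / ?c"]) auto
qed

lemma integrable_bump_scaleR:
  fixes g :: "'a::euclidean_space \<Rightarrow> 'b::{banach, second_countable_topology}"
  assumes [measurable]: "g \<in> borel_measurable borel" and bound: "AE w in lborel. norm w \<le> 1 \<longrightarrow> norm (g w) \<le> B"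
  shows "integrable lborel (\<lambda>w. bump w *\<^sub>R g w)"
proof (rule Bochner_Integration.integrable_bound)
  show "integrable lborel (\<lambda>w::'a. bump w * B)" by (simp add: integrable_bump)
  show "AE w in lborel. norm (bump w *\<^sub>R g w) \<le> norm (bump w * B)"
    using bound
  proof eventually_elim
    fix w assume *: "norm w \<le> 1 \<longrightarrow> norm (g w) \<le> B"
    show "norm (bump w *\<^sub>R g w) \<le> norm (bump w * B)"
    proof (cases "norm w \<le> 1")
      case True
      with * have "norm (g w) \<le> \<bar>B\<bar>" by linarith
      then show ?thesis by (simp add: abs_mult mult_left_mono)
    qed (simp add: bump_eq_0)
  qed
qed measurable

text \<open>Moving the increment from \<open>g\<close> to the Lipschitz kernel.\<close>
lemma norm_integral_bump_diff_le:
  "\<exists>K\<ge>0. \<forall>(g :: 'a::euclidean_space \<Rightarrow> 'b::{banach, second_countable_topology}) a M.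
      continuous_on UNIV g \<longrightarrow> norm a \<le> 1 \<longrightarrow> (\<forall>w. norm w \<le> 2 \<longrightarrow> norm (g w) \<le> M) \<longrightarrow>
      norm (\<integral>w. bump w *\<^sub>R (g (w + a) - g w) \<partial>lborel) \<le> K * norm a * M"
proof -
  obtain K where K: "K \<ge> 0" "\<And>v w :: 'a. \<bar>bump v - bump w\<bar> \<le> K * norm (v - w)" using bump_lipschitz by blast
  \<comment> \<open>The supports of \<open>bump\<close> and of its translate by \<open>a\<close> lie
    in the ball of radius 2; hence the range on which \<open>g\<close> is bounded, and the volume
    factor.\<close>
  have "norm (\<integral>w. bump w *\<^sub>R (g (w + a) - g w) \<partial>lborel) \<le> (K * measure lborel (cball (0::'a) 2)) * norm a * M"
    if g: "continuous_on UNIV g" and a: "norm a \<le> 1" and M: "\<And>w. norm w \<le> 2 \<Longrightarrow> norm (g w) \<le> M"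
    for g :: "'a \<Rightarrow> 'b" and a M
  proof -
    have [measurable]: "g \<in> borel_measurable borel" using g by (rule borel_measurable_continuous_onI)
    have M0: "M \<ge> 0" using M[of 0] norm_ge_zero[of "g 0"] by (simp del: norm_ge_zero)
    have norm_shift: "norm (w + a) \<le> 2" if "norm w \<le> 1" for w
      using norm_triangle_ineq[of w a] that a by linarith
    have int1: "integrable lborel (\<lambda>w. bump w *\<^sub>R g (w + a))"
      by (rule integrable_bump_scaleR[where B = M]) (use M norm_shift in \<open>auto intro!: AE_I2\<close>)
    have int2: "integrable lborel (\<lambda>w. bump w *\<^sub>R g w)"
      by (rule integrable_bump_scaleR[where B = M]) (use M in \<open>auto intro!: AE_I2\<close>)
    have trans: "(\<integral>w. bump w *\<^sub>R g (w + a) \<partial>lborel) = (\<integral>w. bump (w - a) *\<^sub>R g w \<partial>lborel)"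
      using integral_lborel_translate[of "\<lambda>w. bump (w - a) *\<^sub>R g w" a] by simp
    have int1': "integrable lborel (\<lambda>w. bump (w - a) *\<^sub>R g w)"
    proof -
      have "integrable (distr lborel borel ((+) (- a))) (\<lambda>w. bump w *\<^sub>R g (w + a))"
        using int1 by (simp add: lborel_distr_plus)
      then show ?thesis by (subst (asm) integrable_distr_eq) (auto simp: algebra_simps)
    qed
    have "(\<integral>w. bump w *\<^sub>R (g (w + a) - g w) \<partial>lborel) = (\<integral>w. (bump (w - a) - bump w) *\<^sub>R g w \<partial>lborel)"
      using int1 int2 int1' trans by (simp add: scaleR_diff_right scaleR_diff_left)
    also have "norm \<dots> \<le> (\<integral>w. norm ((bump (w - a) - bump w) *\<^sub>R g w) \<partial>lborel)"
      by (rule Bochner_Integration.integral_norm_bound)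
    also have "\<dots> \<le> (\<integral>w. K * norm a * M * indicator (cball (0::'a) 2) w \<partial>lborel)"
    proof (rule integral_mono)
      show "integrable lborel (\<lambda>w. norm ((bump (w - a) - bump w) *\<^sub>R g w))"
        using int1' int2 by (intro integrable_norm) (simp add: scaleR_diff_left)
      show "integrable lborel (\<lambda>w::'a. K * norm a * M * indicator (cball 0 2) w)"
        by (intro integrable_mult_right integrable_real_indicator) (auto simp: emeasure_bounded_finite[simplified])
      fix w :: 'a
      show "norm ((bump (w - a) - bump w) *\<^sub>R g w) \<le> K * norm a * M * indicator (cball 0 2) w"
      proof (cases "norm w \<le> 2")
        case True
        have "\<bar>bump (w - a) - bump w\<bar> \<le> K * norm a" using K(2)[of "w - a" w] by simp
        then have "\<bar>bump (w - a) - bump w\<bar> * norm (g w) \<le> (K * norm a) * M"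
          using M[OF True] K by (intro mult_mono) auto
        with True show ?thesis by simp
      next
        case False
        then have "norm (w - a) \<ge> 1" using norm_triangle_ineq2[of w a] a by linarith
        with False show ?thesis by (simp add: bump_eq_0)
      qed
    qed
    also have "\<dots> = (K * measure lborel (cball (0::'a) 2)) * norm a * M" by simp
    finally show ?thesis .
  qed
  with K(1) show ?thesis by (intro exI[of _ "K * measure lborel (cball (0::'a) 2)"]) simp
qed

section \<open>Jacobians almost everywhere and properties of their averages\<close>

lemma AE_lborel_affine:
  fixes c :: "'a::euclidean_space"
  assumes "AE y in lborel. P y" "\<delta> \<noteq> 0"
  shows "AE w in lborel. P (c + \<delta> *\<^sub>R w)"
proof -
  have "AE y in density (distr lborel borel (\<lambda>x. c + \<delta> *\<^sub>R x)) (\<lambda>_. \<bar>\<delta>\<bar>^DIM('a)). P y"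
    using assms(1) by (subst (asm) lborel_affine[OF assms(2), of c])
  then have "AE y in distr lborel borel (\<lambda>x. c + \<delta> *\<^sub>R x). P y"
    using assms(2) by (subst (asm) AE_density) auto
  then show ?thesis by (rule AE_distrD[rotated]) simp
qed

lemma jacobian_at_mult:
  assumes "f differentiable (at y)"
  shows "jacobian_at f y *v e = frechet_derivative f (at y) e"
  using assms by (intro matrix_works)
    (auto simp: frechet_derivative_works linear_matrix_vector_mul_eq dest: has_derivative_linear)

lemma diff_quot_tendsto_jacobian:
  fixes f :: "real^'d \<Rightarrow> real^'n"
  assumes "f differentiable (at y)"
  shows "(\<lambda>k. real (Suc k) *\<^sub>R (f (y + (1 / Suc k) *\<^sub>R e) - f y)) \<longlonglongrightarrow> jacobian_at f y *v e"
proof -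
  let ?D = "frechet_derivative f (at y)"
  have D: "(f has_derivative ?D) (at (y + 0 *\<^sub>R e))"
    using assms by (simp add: frechet_derivative_works)
  have "((\<lambda>t::real. y + t *\<^sub>R e) has_derivative (\<lambda>t. t *\<^sub>R e)) (at 0)"
    by (auto intro!: derivative_eq_intros)
  from has_derivative_compose[OF this D]
  have "((\<lambda>t. norm (f (y + t *\<^sub>R e) - f y - ?D (t *\<^sub>R e)) / norm t) \<longlongrightarrow> 0) (at 0)"
    by (simp add: has_derivative_at)
  moreover have "filterlim (\<lambda>k. 1 / real (Suc k)) (at 0) sequentially"
    using filterlim_inverse_Suc by (rule filterlim_mono) (auto simp: at_le)
  ultimately have "(\<lambda>k. norm (f (y + (1 / Suc k) *\<^sub>R e) - f y - ?D ((1 / Suc k) *\<^sub>R e)) / norm (1 / Suc k)) \<longlonglongrightarrow> 0"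
    by (rule filterlim_compose)
  moreover have "norm (f (y + (1 / Suc k) *\<^sub>R e) - f y - ?D ((1 / Suc k) *\<^sub>R e)) / norm (1 / Suc k)
      = norm (real (Suc k) *\<^sub>R (f (y + (1 / Suc k) *\<^sub>R e) - f y) - jacobian_at f y *v e)" for k
  proof -
    have "real (Suc k) *\<^sub>R (f (y + (1 / Suc k) *\<^sub>R e) - f y) - jacobian_at f y *v e
        = real (Suc k) *\<^sub>R (f (y + (1 / Suc k) *\<^sub>R e) - f y - ?D ((1 / Suc k) *\<^sub>R e))"
      using linear_cmul[OF has_derivative_linear[OF D], of "1 / Suc k" e]
      by (simp only: jacobian_at_mult[OF assms] scaleR_diff_right) simp
    then show ?thesis by simp
  qed
  ultimately have "(\<lambda>k. norm (real (Suc k) *\<^sub>R (f (y + (1 / Suc k) *\<^sub>R e) - f y) - jacobian_at f y *v e)) \<longlonglongrightarrow> 0"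
    by (simp only:)
  then show ?thesis by (rule LIM_zero_cancel[OF tendsto_norm_zero_cancel])
qed

lemma jac_lim_eq_jacobian_at:
  fixes f :: "real^'d \<Rightarrow> real^'n"
  assumes "f differentiable (at y)"
  shows "jac_lim f y = jacobian_at f y"
proof -
  have "dir_deriv (\<lambda>y. f y $ i) (axis j 1) y = jacobian_at f y $ i $ j" for i j
    unfolding dir_deriv_def
    using tendsto_vec_nth[OF diff_quot_tendsto_jacobian[OF assms, of "axis j 1"], of i]
    by (intro limI) (simp add: diff_quot_def matrix_vector_mul_component inner_axis row_def matrix_vector_mult_basis column_def)
  then show ?thesis by (simp add: jac_lim_def vec_eq_iff)
qed

text \<open>Difference quotients see one direction at a time; this crude bound assembles estimates
  for the coordinate directions.\<close>

lemma norm_matrix_le_columns: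
  fixes A :: "real^'d^'n"
  assumes "\<And>j. norm (A *v axis j 1) \<le> C"
  shows "norm A \<le> real CARD('n) * (real CARD('d) * C)"
proof -
  have "\<bar>A $ i $ j\<bar> \<le> C" for i j
    using component_le_norm_cart[of "A *v axis j 1" i] assms[of j]
    by (simp add: matrix_vector_mult_basis column_def)
  then have "norm (A $ i) \<le> real CARD('d) * C" for i
    using norm_le_l1_cart[of "A $ i"] sum_bounded_above[of UNIV "\<lambda>j. \<bar>A $ i $ j\<bar>" C] by force
  moreover have "norm A \<le> (\<Sum>i\<in>UNIV. norm (A $ i))"
    unfolding norm_vec_def by (rule L2_set_le_sum) simp
  ultimately show ?thesis
    using sum_bounded_above[of UNIV "\<lambda>i. norm (A $ i)" "real CARD('d) * C"] by force
qed

lemma jacobian_at_locally_bounded: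
  fixes f :: "real^'d \<Rightarrow> real^'n"
  assumes "lipschitz_on_balls f"
  shows "\<exists>B. \<forall>y. norm y \<le> R \<longrightarrow> f differentiable (at y) \<longrightarrow> norm (jacobian_at f y) \<le> B"
proof -
  obtain L where L: "L \<ge> 0" "L-lipschitz_on (cball 0 (R + 1)) f" using assms by (rule lipschitz_on_ballsE)
  show ?thesis
  proof (intro exI allI impI)
    fix y assume y: "norm y \<le> R" "f differentiable (at y)"
    have "norm (jacobian_at f y *v axis j 1) \<le> L" for j
    proof (rule tendsto_upperbound)
      show "(\<lambda>k. norm (real (Suc k) *\<^sub>R (f (y + (1 / Suc k) *\<^sub>R axis j 1) - f y))) \<longlonglongrightarrow> norm (jacobian_at f y *v axis j 1)"
        by (intro tendsto_norm diff_quot_tendsto_jacobian y)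
      show "\<forall>\<^sub>F k in sequentially. norm (real (Suc k) *\<^sub>R (f (y + (1 / Suc k) *\<^sub>R axis j 1) - f y)) \<le> L"
        using norm_diff_quot_vec_le[of L R "axis j 1" f y] L y by (intro always_eventually) (simp add: norm_axis_1)
    qed simp
    then show "norm (jacobian_at f y) \<le> real CARD('n) * (real CARD('d) * L)" by (rule norm_matrix_le_columns)
  qed
qed

lemma borel_measurable_vec_lambda:
  fixes g :: "'a \<Rightarrow> 'i::finite \<Rightarrow> 'b::euclidean_space"
  assumes "\<And>i. (\<lambda>x. g x i) \<in> borel_measurable M"
  shows "(\<lambda>x. \<chi> i. g x i) \<in> borel_measurable M"
  using assms by (subst borel_measurable_euclidean_space) (auto simp: Basis_vec_def inner_axis)

lemma borel_measurable_vec_nth: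
  fixes g :: "'a \<Rightarrow> 'b::euclidean_space^'i"
  assumes "g \<in> borel_measurable M"
  shows "(\<lambda>x. g x $ i) \<in> borel_measurable M"
  by (rule measurable_compose[OF assms borel_measurable_continuous_onI]) (intro continuous_intros)

lemma borel_measurable_jac_lim:
  assumes "f \<in> borel_measurable borel"
  shows "jac_lim f \<in> borel_measurable borel"
  unfolding jac_lim_def[abs_def]
  by (intro borel_measurable_vec_lambda borel_measurable_diff_quot borel_measurable_vec_nth assms)

lemma AE_jac_lim:
  fixes f :: "real^'d \<Rightarrow> real^'n"
  assumes f: "lipschitz_on_balls f" and \<delta>: "\<delta> > 0"
  shows "AE w in lborel. f differentiable (at (c + \<delta> *\<^sub>R w)) \<and> jac_lim f (c + \<delta> *\<^sub>R w) = jacobian_at f (c + \<delta> *\<^sub>R w)"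
  using AE_lborel_affine[OF rademacher[OF f], of \<delta> c] \<delta>
  by (auto elim!: eventually_mono simp: jac_lim_eq_jacobian_at)

lemma integrable_jac_avg:
  fixes f :: "real^'d \<Rightarrow> real^'n"
  assumes f: "lipschitz_on_balls f" and \<delta>: "\<delta> > 0"
  shows "integrable lborel (\<lambda>w. bump w *\<^sub>R jac_lim f (c + \<delta> *\<^sub>R w))"
proof -
  note [measurable] = borel_measurable_jac_lim[OF lipschitz_on_balls_borel_measurable[OF f]]
  obtain B where B: "\<And>y. \<lbrakk>norm y \<le> norm c + \<delta>; f differentiable (at y)\<rbrakk> \<Longrightarrow> norm (jacobian_at f y) \<le> B"
    using jacobian_at_locally_bounded[OF f] by metis
  have "AE w in lborel. norm w \<le> 1 \<longrightarrow> norm (jac_lim f (c + \<delta> *\<^sub>R w)) \<le> B"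
    using AE_jac_lim[OF f \<delta>, of c]
  proof (eventually_elim, intro impI, elim conjE)
    fix w :: "real^'d" assume w: "norm w \<le> 1" "f differentiable (at (c + \<delta> *\<^sub>R w))"
      "jac_lim f (c + \<delta> *\<^sub>R w) = jacobian_at f (c + \<delta> *\<^sub>R w)"
    have "norm (\<delta> *\<^sub>R w) \<le> \<delta>" using w \<delta> by simp
    then have "norm (c + \<delta> *\<^sub>R w) \<le> norm c + \<delta>" using norm_triangle_ineq[of c "\<delta> *\<^sub>R w"] by linarith
    with w show "norm (jac_lim f (c + \<delta> *\<^sub>R w)) \<le> B" using B by simp
  qed
  then show ?thesis by (intro integrable_bump_scaleR) measurable
qed

text \<open>The dual form of the fact that an average lies in the closed convex hull of the values
  averaged: \<open>bump\<close> is a probability density supported in the unit ball, and by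
  Rademacher's theorem the points without a Jacobian do not contribute.\<close>

lemma jac_avg_le:
  fixes f :: "real^'d \<Rightarrow> real^'n"
  assumes f: "lipschitz_on_balls f" and \<delta>: "\<delta> > 0" and \<phi>: "bounded_linear \<phi>"
    and le: "\<And>y. \<lbrakk>norm (y - c) \<le> \<delta>; f differentiable (at y)\<rbrakk> \<Longrightarrow> \<phi> (jacobian_at f y) \<le> \<beta>"
  shows "\<phi> (jac_avg f c \<delta>) \<le> (\<beta>::real)"
proof -
  note int = integrable_jac_avg[OF f \<delta>, of c]
  have "\<phi> (jac_avg f c \<delta>) = (\<integral>w. \<phi> (bump w *\<^sub>R jac_lim f (c + \<delta> *\<^sub>R w)) \<partial>lborel)"
    unfolding jac_avg_def by (rule integral_bounded_linear[OF \<phi> int, symmetric])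
  also have "\<dots> \<le> (\<integral>w. bump (w::real^'d) * \<beta> \<partial>lborel)"
  proof (rule integral_mono_AE)
    show "integrable lborel (\<lambda>w. \<phi> (bump w *\<^sub>R jac_lim f (c + \<delta> *\<^sub>R w)))"
      by (rule integrable_bounded_linear[OF \<phi> int])
    show "integrable lborel (\<lambda>w::real^'d. bump w * \<beta>)" by (simp add: integrable_bump)
    show "AE w in lborel. \<phi> (bump w *\<^sub>R jac_lim f (c + \<delta> *\<^sub>R w)) \<le> bump w * \<beta>"
      using AE_jac_lim[OF f \<delta>, of c]
    proof (eventually_elim, elim conjE)
      fix w :: "real^'d" assume w: "f differentiable (at (c + \<delta> *\<^sub>R w))"
        "jac_lim f (c + \<delta> *\<^sub>R w) = jacobian_at f (c + \<delta> *\<^sub>R w)"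
      show "\<phi> (bump w *\<^sub>R jac_lim f (c + \<delta> *\<^sub>R w)) \<le> bump w * \<beta>"
      proof (cases "norm w \<le> 1")
        case True
        then have "norm (c + \<delta> *\<^sub>R w - c) \<le> \<delta>" using \<delta> by simp
        from le[OF this w(1)] show ?thesis
          by (simp add: w(2) linear_cmul[OF bounded_linear.linear[OF \<phi>]] mult_left_mono bump_nonneg)
      qed (simp add: bump_eq_0 linear_0[OF bounded_linear.linear[OF \<phi>]])
    qed
  qed
  also have "\<dots> = \<beta>" by (simp add: integral_bump)
  finally show ?thesis .
qed

lemma bounded_linear_matrix_vector_mult_left: "bounded_linear (\<lambda>A::real^'d^'n. A *v e)"
  by (intro linear_conv_bounded_linear[THEN iffD1] linearI) (simp_all add: matrix_vector_mult_add_rdistrib scaleR_matrix_vector_assoc)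

text \<open>The quotients are dominated through the local Lipschitz constant. The result allows
  \<open>jac_avg\<close> to be estimated from values of \<open>f\<close> instead of its
  derivatives.\<close>

lemma integral_diff_quot_tendsto_jac_avg:
  fixes f :: "real^'d \<Rightarrow> real^'n"
  assumes f: "lipschitz_on_balls f" and \<delta>: "\<delta> > 0"
  shows "(\<lambda>k. \<integral>w. bump w *\<^sub>R (real (Suc k) *\<^sub>R (f (c + \<delta> *\<^sub>R w + (1 / Suc k) *\<^sub>R e) - f (c + \<delta> *\<^sub>R w))) \<partial>lborel)
           \<longlonglongrightarrow> jac_avg f c \<delta> *v e"
proof -
  note [measurable] = lipschitz_on_balls_borel_measurable[OF f]
    borel_measurable_jac_lim[OF lipschitz_on_balls_borel_measurable[OF f]]
  note \<phi> = bounded_linear_matrix_vector_mult_left[of e]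
  obtain L where L: "L \<ge> 0" "L-lipschitz_on (cball 0 (norm c + \<delta> + norm e)) f" using f by (rule lipschitz_on_ballsE)
  have "jac_avg f c \<delta> *v e = (\<integral>w. (bump w *\<^sub>R jac_lim f (c + \<delta> *\<^sub>R w)) *v e \<partial>lborel)"
    unfolding jac_avg_def by (rule integral_bounded_linear[OF \<phi> integrable_jac_avg[OF f \<delta>], symmetric])
  moreover have "(\<lambda>k. \<integral>w. bump w *\<^sub>R (real (Suc k) *\<^sub>R (f (c + \<delta> *\<^sub>R w + (1 / Suc k) *\<^sub>R e) - f (c + \<delta> *\<^sub>R w))) \<partial>lborel)
           \<longlonglongrightarrow> (\<integral>w. (bump w *\<^sub>R jac_lim f (c + \<delta> *\<^sub>R w)) *v e \<partial>lborel)"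
  proof (rule integral_dominated_convergence)
    show "(\<lambda>w. (bump w *\<^sub>R jac_lim f (c + \<delta> *\<^sub>R w)) *v e) \<in> borel_measurable lborel"
      using borel_measurable_integrable[OF integrable_bounded_linear[OF \<phi> integrable_jac_avg[OF f \<delta>]]] .
    show "integrable lborel (\<lambda>w::real^'d. bump w * (L * norm e))" by (simp add: integrable_bump)
    show "AE w in lborel. (\<lambda>k. bump w *\<^sub>R (real (Suc k) *\<^sub>R (f (c + \<delta> *\<^sub>R w + (1 / Suc k) *\<^sub>R e) - f (c + \<delta> *\<^sub>R w))))
      \<longlonglongrightarrow> (bump w *\<^sub>R jac_lim f (c + \<delta> *\<^sub>R w)) *v e"
      using AE_jac_lim[OF f \<delta>, of c]
    proof (eventually_elim, elim conjE)
      fix w :: "real^'d" assume w: "f differentiable (at (c + \<delta> *\<^sub>R w))"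
        "jac_lim f (c + \<delta> *\<^sub>R w) = jacobian_at f (c + \<delta> *\<^sub>R w)"
      show "(\<lambda>k. bump w *\<^sub>R (real (Suc k) *\<^sub>R (f (c + \<delta> *\<^sub>R w + (1 / Suc k) *\<^sub>R e) - f (c + \<delta> *\<^sub>R w))))
        \<longlonglongrightarrow> (bump w *\<^sub>R jac_lim f (c + \<delta> *\<^sub>R w)) *v e"
        unfolding w(2) scaleR_matrix_vector_assoc[symmetric]
        by (intro tendsto_scaleR tendsto_const diff_quot_tendsto_jacobian w)
    qed
    fix k
    show "AE w in lborel. norm (bump w *\<^sub>R (real (Suc k) *\<^sub>R (f (c + \<delta> *\<^sub>R w + (1 / Suc k) *\<^sub>R e) - f (c + \<delta> *\<^sub>R w)))) \<le> bump w * (L * norm e)"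
    proof (rule AE_I2)
      fix w :: "real^'d"
      show "norm (bump w *\<^sub>R (real (Suc k) *\<^sub>R (f (c + \<delta> *\<^sub>R w + (1 / Suc k) *\<^sub>R e) - f (c + \<delta> *\<^sub>R w)))) \<le> bump w * (L * norm e)"
      proof (cases "norm w \<le> 1")
        case True
        have "norm (\<delta> *\<^sub>R w) \<le> \<delta>" using True \<delta> by simp
        then have "norm (c + \<delta> *\<^sub>R w) \<le> norm c + \<delta>" using norm_triangle_ineq[of c "\<delta> *\<^sub>R w"] by linarith
        from mult_left_mono[OF norm_diff_quot_vec_le[OF L(2) this, of k] bump_nonneg[of w]] show ?thesis
          by (subst norm_scaleR) (simp only: abs_of_nonneg[OF bump_nonneg])
      qed (simp add: bump_eq_0)
    qed
  qed measurable
  ultimately show ?thesis by simp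
qed

section \<open>Averaged Jacobians and the Clarke Jacobian\<close>

text \<open>The Jacobians around \<open>y\<close> need not be close to the one at \<open>y\<close>.
  But the remainder of \<open>f\<close> at \<open>y\<close> is small compared with
  \<open>\<delta>\<close> on balls of radius comparable to \<open>\<delta>\<close>, and the kernel
  turns its quotients into values at the price of a factor of order \<open>1 / \<delta>\<close>. The
  centre may be off by \<open>\<delta>\<close>, which later admits centres from a countable dense
  set.\<close>

lemma jac_avg_near_jacobian_at:
  fixes f :: "real^'d \<Rightarrow> real^'n"
  assumes f: "lipschitz_on_balls f" and diff: "f differentiable (at y)" and \<epsilon>: "\<epsilon> > 0"
  shows "\<exists>\<eta>>0. \<forall>\<delta> c. 0 < \<delta> \<longrightarrow> \<delta> < \<eta> \<longrightarrow> norm (c - y) \<le> \<delta> \<longrightarrow> norm (jac_avg f c \<delta> - jacobian_at f y) \<le> \<epsilon>"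
proof -
  let ?J = "jacobian_at f y"
  let ?nd = "real CARD('n) * real CARD('d)"
  obtain K where K: "K \<ge> 0"
    "\<forall>(g :: real^'d \<Rightarrow> real^'n) a M. continuous_on UNIV g \<longrightarrow> norm a \<le> 1 \<longrightarrow> (\<forall>w. norm w \<le> 2 \<longrightarrow> norm (g w) \<le> M) \<longrightarrow>
      norm (\<integral>w. bump w *\<^sub>R (g (w + a) - g w) \<partial>lborel) \<le> K * norm a * M"
    using norm_integral_bump_diff_le[where 'a = "real^'d" and 'b = "real^'n"] by (elim exE conjE)
  \<comment> \<open>For \<open>norm w \<le> 2\<close> the point
    \<open>c + \<delta> *\<^sub>R w\<close> is within \<open>3 * \<delta>\<close> of
    \<open>y\<close>, which gives the 3; \<open>?nd\<close> is the loss in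
    \<open>norm_matrix_le_columns\<close>, and the summand 1 covers \<open>K = 0\<close>.\<close>
  define \<epsilon>' where "\<epsilon>' = \<epsilon> / (?nd * (3 * K + 1))"
  have \<epsilon>': "\<epsilon>' > 0" "?nd * (3 * K * \<epsilon>') \<le> \<epsilon>"
  proof -
    have nd: "?nd > 0" by simp
    show "\<epsilon>' > 0" using \<epsilon> nd K unfolding \<epsilon>'_def by (intro divide_pos_pos mult_pos_pos) auto
    have "?nd * (3 * K * \<epsilon>') \<le> ?nd * ((3 * K + 1) * \<epsilon>')"
      using nd \<open>\<epsilon>' > 0\<close> by (intro mult_left_mono mult_right_mono) auto
    also have "\<dots> = \<epsilon>" using nd K unfolding \<epsilon>'_def by (simp add: field_simps add_nonneg_eq_0_iff)
    finally show "?nd * (3 * K * \<epsilon>') \<le> \<epsilon>" .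
  qed
  have "(f has_derivative (*v) ?J) (at y)"
    using diff ext[of "(*v) ?J", OF jacobian_at_mult[OF diff]] by (simp add: frechet_derivative_works)
  then obtain d where d: "d > 0" "\<And>x. norm (x - y) < d \<Longrightarrow> norm (f x - f y - ?J *v (x - y)) \<le> \<epsilon>' * norm (x - y)"
    using \<epsilon>'(1) unfolding has_derivative_at_alt by blast
  define r where "r x = f x - f y - ?J *v (x - y)" for x
  have "norm (jac_avg f c \<delta> - ?J) \<le> \<epsilon>" if \<delta>: "0 < \<delta>" "\<delta> < d / 3" and c: "norm (c - y) \<le> \<delta>" for \<delta> c
  proof -
    define g where "g w = r (c + \<delta> *\<^sub>R w)" for w
    have g: "continuous_on UNIV g" unfolding g_def r_def
      by (intro continuous_intros continuous_on_compose2[OF lipschitz_on_balls_imp_continuous_on[OF f, of UNIV]]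
            continuous_on_compose2[OF matrix_vector_mult_linear_continuous_on[of UNIV]]) auto
    have M: "norm (g w) \<le> 3 * \<delta> * \<epsilon>'" if "norm w \<le> 2" for w
    proof -
      have "norm (\<delta> *\<^sub>R w) \<le> \<delta> * 2" using \<delta> that by simp
      moreover have "norm (c + \<delta> *\<^sub>R w - y) \<le> norm (c - y) + norm (\<delta> *\<^sub>R w)"
        using norm_triangle_ineq[of "c - y" "\<delta> *\<^sub>R w"] by (simp add: algebra_simps)
      ultimately have *: "norm (c + \<delta> *\<^sub>R w - y) \<le> 3 * \<delta>" using c by linarith
      then have "norm (g w) \<le> \<epsilon>' * norm (c + \<delta> *\<^sub>R w - y)"
        unfolding g_def r_def using \<delta> by (intro d(2)) simp
      also have "\<dots> \<le> \<epsilon>' * (3 * \<delta>)" using * \<epsilon>' by (intro mult_left_mono) auto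
      finally show ?thesis by (simp add: mult_ac)
    qed
    have "norm ((jac_avg f c \<delta> - ?J) *v axis j 1) \<le> 3 * K * \<epsilon>'" for j :: 'd
    proof -
      let ?e = "axis j 1 :: real^'d"
      let ?q = "\<lambda>k w. real (Suc k) *\<^sub>R (f (c + \<delta> *\<^sub>R w + (1 / Suc k) *\<^sub>R ?e) - f (c + \<delta> *\<^sub>R w))"
      have "(\<lambda>k. norm ((\<integral>w. bump w *\<^sub>R ?q k w \<partial>lborel) - ?J *v ?e)) \<longlonglongrightarrow> norm (jac_avg f c \<delta> *v ?e - ?J *v ?e)"
        by (intro tendsto_norm tendsto_diff integral_diff_quot_tendsto_jac_avg[OF f \<delta>(1)] tendsto_const)
      moreover have "\<forall>\<^sub>F k in sequentially. norm ((\<integral>w. bump w *\<^sub>R ?q k w \<partial>lborel) - ?J *v ?e) \<le> 3 * K * \<epsilon>'"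
      proof -
        obtain k0 :: nat where k0: "1 / \<delta> < real k0" using reals_Archimedean2 by blast
        have "norm ((\<integral>w. bump w *\<^sub>R ?q k w \<partial>lborel) - ?J *v ?e) \<le> 3 * K * \<epsilon>'" if k: "k \<ge> k0" for k
        proof -
          \<comment> \<open>The step \<open>1 / Suc k\<close> in direction \<open>?e\<close>,
            expressed in the variable \<open>w\<close>. Its norm cancels both the factor
            \<open>Suc k\<close> of the quotient and the \<open>\<delta>\<close> in the bound
            \<open>M\<close>.\<close>
          define a where "a = (1 / (real (Suc k) * \<delta>)) *\<^sub>R ?e"
          have "1 / \<delta> \<le> real (Suc k)" using k0 k by linarith
          then have a: "norm a \<le> 1" using \<delta> by (simp add: a_def norm_axis_1 field_simps)
          obtain L where L: "L-lipschitz_on (cball 0 (norm c + \<delta> + norm ?e)) f" using f by (rule lipschitz_on_ballsE)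
          have int: "integrable lborel (\<lambda>w. bump w *\<^sub>R ?q k w)"
          proof (rule integrable_bump_scaleR)
            show "(\<lambda>w. ?q k w) \<in> borel_measurable borel"
              using lipschitz_on_balls_borel_measurable[OF f] by measurable
            have "norm (?q k w) \<le> L * norm ?e" if "norm w \<le> 1" for w
            proof -
              have "norm (\<delta> *\<^sub>R w) \<le> \<delta>" using that \<delta> by simp
              then have "norm (c + \<delta> *\<^sub>R w) \<le> norm c + \<delta>" using norm_triangle_ineq[of c "\<delta> *\<^sub>R w"] by linarith
              from norm_diff_quot_vec_le[OF L this] show ?thesis .
            qed
            then show "AE w in lborel. norm w \<le> 1 \<longrightarrow> norm (?q k w) \<le> L * norm ?e" by simp
          qed
          have rq: "?q k w - ?J *v ?e = real (Suc k) *\<^sub>R (g (w + a) - g w)" for w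
          proof -
            have eq: "c + \<delta> *\<^sub>R (w + a) = c + \<delta> *\<^sub>R w + (1 / Suc k) *\<^sub>R ?e"
              using \<delta> by (simp add: a_def scaleR_add_right)
            have lin: "?J *v (c + \<delta> *\<^sub>R w + (1 / Suc k) *\<^sub>R ?e - y) = ?J *v (c + \<delta> *\<^sub>R w - y) + (1 / Suc k) *\<^sub>R (?J *v ?e)"
              by (simp add: matrix_vector_mult_diff_distrib matrix_vector_right_distrib matrix_vector_mult_scaleR)
            have "g (w + a) - g w = f (c + \<delta> *\<^sub>R w + (1 / Suc k) *\<^sub>R ?e) - f (c + \<delta> *\<^sub>R w) - (1 / Suc k) *\<^sub>R (?J *v ?e)"
              unfolding g_def r_def eq lin by simp
            then show ?thesis by (simp only: scaleR_diff_right) simp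
          qed
          have "(\<integral>w. bump (w::real^'d) *\<^sub>R (?J *v ?e) \<partial>lborel) = integral\<^sup>L lborel (bump :: real^'d \<Rightarrow> real) *\<^sub>R (?J *v ?e)"
            by (rule integral_scaleR_left) (rule integrable_bump)
          then have "(\<integral>w. bump (w::real^'d) *\<^sub>R (?J *v ?e) \<partial>lborel) = ?J *v ?e" by (simp only: integral_bump scaleR_one)
          then have "(\<integral>w. bump w *\<^sub>R ?q k w \<partial>lborel) - ?J *v ?e
              = (\<integral>w. bump w *\<^sub>R ?q k w \<partial>lborel) - (\<integral>w. bump (w::real^'d) *\<^sub>R (?J *v ?e) \<partial>lborel)" by (simp only:)
          also have "\<dots> = (\<integral>w. bump w *\<^sub>R ?q k w - bump w *\<^sub>R (?J *v ?e) \<partial>lborel)"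
            using int by (intro Bochner_Integration.integral_diff[symmetric] integrable_scaleR_left integrable_bump)
          also have "\<dots> = (\<integral>w. real (Suc k) *\<^sub>R (bump w *\<^sub>R (g (w + a) - g w)) \<partial>lborel)"
            by (intro Bochner_Integration.integral_cong refl) (simp only: rq scaleR_diff_right[symmetric] scaleR_left_commute)
          also have "\<dots> = real (Suc k) *\<^sub>R (\<integral>w. bump w *\<^sub>R (g (w + a) - g w) \<partial>lborel)"
            by (rule integral_scaleR_right)
          finally have "norm ((\<integral>w. bump w *\<^sub>R ?q k w \<partial>lborel) - ?J *v ?e)
              = real (Suc k) * norm (\<integral>w. bump w *\<^sub>R (g (w + a) - g w) \<partial>lborel)" by simp
          also have "\<dots> \<le> real (Suc k) * (K * norm a * (3 * \<delta> * \<epsilon>'))"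
            by (intro mult_left_mono K(2)[rule_format] g a M) auto
          also have "norm a = 1 / (real (Suc k) * \<delta>)" using \<delta> by (simp add: a_def norm_axis_1)
          also have "real (Suc k) * (K * (1 / (real (Suc k) * \<delta>)) * (3 * \<delta> * \<epsilon>')) = 3 * K * \<epsilon>'"
            using \<delta> by (simp del: of_nat_Suc)
          finally show ?thesis .
        qed
        then show ?thesis by (auto simp: eventually_sequentially)
      qed
      ultimately have "norm (jac_avg f c \<delta> *v ?e - ?J *v ?e) \<le> 3 * K * \<epsilon>'"
        by (rule tendsto_upperbound) simp
      then show ?thesis by (simp add: matrix_vector_mult_diff_rdistrib)
    qed
    then have "norm (jac_avg f c \<delta> - ?J) \<le> real CARD('n) * (real CARD('d) * (3 * K * \<epsilon>'))"
      by (rule norm_matrix_le_columns)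
    with \<epsilon>'(2) show ?thesis by (simp add: mult.assoc)
  qed
  then show ?thesis using d(1) by (intro exI[of _ "d / 3"]) auto
qed

text \<open>Limits of Jacobians at points approaching the set \<open>S\<close>. For a point these
  generate the Clarke Jacobian; for a segment they form one compact set instead of a union of hulls.
  Since \<open>infdist\<close> to the empty set is 0, \<open>S\<close> is taken nonempty in what
  follows.\<close>

definition lim_jacobians :: "(real^'d \<Rightarrow> real^'n) \<Rightarrow> (real^'d) set \<Rightarrow> (real^'d^'n) set" where
  "lim_jacobians f S = {J. \<forall>\<eta>>0. \<exists>y. f differentiable (at y) \<and> infdist y S < \<eta> \<and> norm (jacobian_at f y - J) < \<eta>}"

lemma lim_jacobians_sequence:
  assumes "J \<in> lim_jacobians f S"
  obtains ys where "\<And>k. f differentiable (at (ys k))" "(\<lambda>k. infdist (ys k) S) \<longlonglongrightarrow> 0"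
    "(\<lambda>k. jacobian_at f (ys k)) \<longlonglongrightarrow> J"
proof -
  have "\<forall>k::nat. \<exists>y. f differentiable (at y) \<and> infdist y S < 1 / Suc k \<and> norm (jacobian_at f y - J) < 1 / Suc k"
    using assms unfolding lim_jacobians_def by simp
  then obtain ys where ys: "\<And>k. f differentiable (at (ys k))" "\<And>k. infdist (ys k) S < 1 / Suc k"
    "\<And>k. norm (jacobian_at f (ys k) - J) < 1 / Suc k" by metis
  have 0: "(\<lambda>k. 1 / real (Suc k)) \<longlonglongrightarrow> 0" using LIMSEQ_inverse_real_of_nat by (simp add: inverse_eq_divide)
  have "(\<lambda>k. infdist (ys k) S) \<longlonglongrightarrow> 0"
    by (rule tendsto_sandwich[OF _ _ tendsto_const 0]) (use ys in \<open>auto simp: infdist_nonneg less_imp_le intro!: always_eventually\<close>)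
  moreover have "(\<lambda>k. norm (jacobian_at f (ys k) - J)) \<longlonglongrightarrow> 0"
    by (rule tendsto_sandwich[OF _ _ tendsto_const 0]) (use ys in \<open>auto simp: less_imp_le intro!: always_eventually\<close>)
  then have "(\<lambda>k. jacobian_at f (ys k)) \<longlonglongrightarrow> J" by (rule LIM_zero_cancel[OF tendsto_norm_zero_cancel])
  ultimately show ?thesis using that ys(1) by blast
qed

lemma lim_jacobians_limitI:
  assumes diff: "\<And>k. f differentiable (at (ys k))" and S: "(\<lambda>k. infdist (ys k) S) \<longlonglongrightarrow> 0"
    and J: "(\<lambda>k. jacobian_at f (ys k)) \<longlonglongrightarrow> J"
  shows "J \<in> lim_jacobians f S"
  unfolding lim_jacobians_def
proof (intro CollectI allI impI)
  fix \<eta> :: real assume "\<eta> > 0"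
  then have "\<forall>\<^sub>F k in sequentially. infdist (ys k) S < \<eta> \<and> norm (jacobian_at f (ys k) - J) < \<eta>"
    using order_tendstoD(2)[OF S] tendstoD[OF J] by (auto simp: dist_norm eventually_conj_iff)
  then show "\<exists>y. f differentiable (at y) \<and> infdist y S < \<eta> \<and> norm (jacobian_at f y - J) < \<eta>"
    using diff by (auto simp: eventually_sequentially)
qed

lemma lim_jacobians_mono:
  assumes "A \<subseteq> B" "A \<noteq> {}"
  shows "lim_jacobians f A \<subseteq> lim_jacobians f B"
proof
  fix J assume J: "J \<in> lim_jacobians f A"
  show "J \<in> lim_jacobians f B"
    unfolding lim_jacobians_def
  proof (intro CollectI allI impI)
    fix \<eta> :: real assume "\<eta> > 0"
    then obtain y where "f differentiable (at y)" "infdist y A < \<eta>" "norm (jacobian_at f y - J) < \<eta>"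
      using J unfolding lim_jacobians_def by blast
    then show "\<exists>y. f differentiable (at y) \<and> infdist y B < \<eta> \<and> norm (jacobian_at f y - J) < \<eta>"
      using infdist_mono[OF assms, of y] by (intro exI[of _ y]) auto
  qed
qed

lemma clarke_jacobian_eq: "clarke_jacobian f z = convex hull (lim_jacobians f {z})"
proof -
  have "{Mx. \<exists>zs::nat \<Rightarrow> _. (\<forall>k. f differentiable (at (zs k))) \<and> zs \<longlonglongrightarrow> z \<and>
          (\<lambda>k. jacobian_at f (zs k)) \<longlonglongrightarrow> Mx} = lim_jacobians f {z}" (is "?L = _")
  proof (intro set_eqI iffI)
    fix J assume "J \<in> ?L"
    then obtain zs :: "nat \<Rightarrow> _" where zs: "\<And>k. f differentiable (at (zs k))" "zs \<longlonglongrightarrow> z" "(\<lambda>k. jacobian_at f (zs k)) \<longlonglongrightarrow> J"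
      by auto
    have "(\<lambda>k. infdist (zs k) {z}) \<longlonglongrightarrow> 0" using tendsto_dist[OF zs(2) tendsto_const[of z]] by simp
    with zs show "J \<in> lim_jacobians f {z}" by (intro lim_jacobians_limitI)
  next
    fix J assume "J \<in> lim_jacobians f {z}"
    then obtain ys where "\<And>k. f differentiable (at (ys k))" "(\<lambda>k. infdist (ys k) {z}) \<longlonglongrightarrow> 0"
      "(\<lambda>k. jacobian_at f (ys k)) \<longlonglongrightarrow> J" by (rule lim_jacobians_sequence) blast
    then show "J \<in> ?L" by (auto simp: tendsto_dist_iff[symmetric])
  qed
  then show ?thesis by (simp add: clarke_jacobian_def)
qed

lemma bounded_infdist_sublevel:
  assumes "compact S" "S \<noteq> {}"
  obtains R where "\<And>y::'a::euclidean_space. infdist y S \<le> 1 \<Longrightarrow> norm y \<le> R"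
proof -
  obtain B where B: "\<And>x. x \<in> S \<Longrightarrow> norm x \<le> B" using compact_imp_bounded[OF assms(1)] by (auto simp: bounded_iff)
  have "norm y \<le> B + 1" if y: "infdist y S \<le> 1" for y
  proof -
    obtain x where "x \<in> S" "infdist y S = dist y x" using infdist_attains_inf[OF compact_imp_closed[OF assms(1)] assms(2)] by blast
    with B[of x] y show ?thesis using norm_triangle_ineq2[of y x] by (simp add: dist_norm)
  qed
  then show ?thesis by (rule that)
qed

lemma jacobian_at_bounded_near:
  fixes f :: "real^'d \<Rightarrow> real^'n"
  assumes f: "lipschitz_on_balls f" and S: "compact S" "S \<noteq> {}"
  obtains B where "\<And>y. \<lbrakk>infdist y S \<le> 1; f differentiable (at y)\<rbrakk> \<Longrightarrow> norm (jacobian_at f y) \<le> B"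
proof -
  obtain R where R: "\<And>y. infdist y S \<le> 1 \<Longrightarrow> norm y \<le> R" using S by (rule bounded_infdist_sublevel) blast
  obtain B where "\<forall>y. norm y \<le> R \<longrightarrow> f differentiable (at y) \<longrightarrow> norm (jacobian_at f y) \<le> B"
    using jacobian_at_locally_bounded[OF f] by blast
  with R that show ?thesis by blast
qed

text \<open>The convex hull of a compact set in finite dimension is compact, hence closed, as the
  separation arguments require. Boundedness comes from the local Lipschitz constant.\<close>

lemma compact_lim_jacobians:
  fixes f :: "real^'d \<Rightarrow> real^'n"
  assumes f: "lipschitz_on_balls f" and S: "compact S" "S \<noteq> {}"
  shows "compact (lim_jacobians f S)"
proof -
  obtain B where B: "\<And>y. \<lbrakk>infdist y S \<le> 1; f differentiable (at y)\<rbrakk> \<Longrightarrow> norm (jacobian_at f y) \<le> B"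
    using f S by (rule jacobian_at_bounded_near) blast
  have "norm J \<le> B + 1" if J: "J \<in> lim_jacobians f S" for J
  proof -
    obtain y where y: "f differentiable (at y)" "infdist y S < 1" "norm (jacobian_at f y - J) < 1"
      using J unfolding lim_jacobians_def by (auto dest: spec[of _ 1])
    then show ?thesis using B[of y] norm_triangle_ineq2[of J "jacobian_at f y"] by (simp add: norm_minus_commute)
  qed
  then have "bounded (lim_jacobians f S)" by (auto simp: bounded_iff)
  moreover have "closed (lim_jacobians f S)"
    unfolding closed_sequential_limits
  proof (intro allI impI, elim conjE)
    fix Js J assume Js: "\<forall>n. Js n \<in> lim_jacobians f S" and lim: "Js \<longlonglongrightarrow> J"
    show "J \<in> lim_jacobians f S"
      unfolding lim_jacobians_def
    proof (intro CollectI allI impI)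
      fix \<eta> :: real assume \<eta>: "\<eta> > 0"
      obtain n where n: "dist (Js n) J < \<eta> / 2" using tendstoD[OF lim, of "\<eta> / 2"] \<eta> by (auto simp: eventually_sequentially)
      obtain y where y: "f differentiable (at y)" "infdist y S < \<eta> / 2" "norm (jacobian_at f y - Js n) < \<eta> / 2"
        using Js[rule_format, of n, unfolded lim_jacobians_def, simplified, rule_format, of "\<eta> / 2"] \<eta> by auto
      have "norm (jacobian_at f y - J) < \<eta>"
        using n y norm_triangle_ineq[of "jacobian_at f y - Js n" "Js n - J"] by (simp add: dist_norm)
      with y \<eta> show "\<exists>y. f differentiable (at y) \<and> infdist y S < \<eta> \<and> norm (jacobian_at f y - J) < \<eta>"
        by (intro exI[of _ y]) auto
    qed
  qed
  ultimately show ?thesis by (simp add: compact_eq_bounded_closed)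
qed

text \<open>Nearest points in \<open>S\<close> to the approximating points have a convergent
  subsequence, and its limit serves as \<open>z\<close>.\<close>

lemma lim_jacobians_subset_UN:
  fixes f :: "real^'d \<Rightarrow> real^'n"
  assumes S: "compact S" "S \<noteq> {}"
  shows "lim_jacobians f S \<subseteq> (\<Union>z\<in>S. lim_jacobians f {z})"
proof
  fix J assume "J \<in> lim_jacobians f S"
  then obtain ys where ys: "\<And>k. f differentiable (at (ys k))" "(\<lambda>k. infdist (ys k) S) \<longlonglongrightarrow> 0"
    "(\<lambda>k. jacobian_at f (ys k)) \<longlonglongrightarrow> J" by (rule lim_jacobians_sequence) blast
  have "\<forall>k. \<exists>x\<in>S. infdist (ys k) S = dist (ys k) x" using infdist_attains_inf[OF compact_imp_closed[OF S(1)] S(2)] by metis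
  then obtain xs where xs: "\<And>k. xs k \<in> S" "\<And>k. infdist (ys k) S = dist (ys k) (xs k)" by metis
  obtain z s where z: "z \<in> S" "strict_mono (s::nat \<Rightarrow> nat)" "(xs \<circ> s) \<longlonglongrightarrow> z"
    using S(1) xs(1) unfolding compact_def by metis
  have "(\<lambda>k. dist (ys (s k)) (xs (s k)) + dist (xs (s k)) z) \<longlonglongrightarrow> 0 + 0"
    using LIMSEQ_subseq_LIMSEQ[OF ys(2) z(2)] z(3) xs(2)
    by (intro tendsto_add) (simp_all add: o_def tendsto_dist_iff[symmetric])
  then have sum: "(\<lambda>k. dist (ys (s k)) (xs (s k)) + dist (xs (s k)) z) \<longlonglongrightarrow> 0" by simp
  have "(\<lambda>k. dist (ys (s k)) z) \<longlonglongrightarrow> 0"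
    by (rule tendsto_sandwich[OF _ _ tendsto_const sum]) (auto intro!: always_eventually dist_triangle)
  then have "J \<in> lim_jacobians f {z}"
    using ys(1) LIMSEQ_subseq_LIMSEQ[OF ys(3) z(2)]
    by (intro lim_jacobians_limitI[of f "\<lambda>k. ys (s k)"]) (simp_all add: o_def)
  with z show "J \<in> (\<Union>z\<in>S. lim_jacobians f {z})" by blast
qed

text \<open>The left-hand side is the set in \<open>Theta\<close>; the right-hand side is visibly
  compact, so hyperplanes separate points from it.\<close>

lemma convex_hull_clarke_jacobian_seg:
  fixes f :: "real^'d \<Rightarrow> real^'n"
  shows "convex hull (clarke_jacobian_seg f a b) = convex hull (lim_jacobians f (closed_segment a b))"
proof (rule antisym)
  have "clarke_jacobian f z \<subseteq> convex hull (lim_jacobians f (closed_segment a b))" if "z \<in> closed_segment a b" for z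
    unfolding clarke_jacobian_eq using that by (intro hull_mono lim_jacobians_mono) auto
  then show "convex hull (clarke_jacobian_seg f a b) \<subseteq> convex hull (lim_jacobians f (closed_segment a b))"
    by (intro hull_minimal convex_convex_hull) (auto simp: clarke_jacobian_seg_def)
  have "lim_jacobians f (closed_segment a b) \<subseteq> clarke_jacobian_seg f a b"
  proof
    fix J assume "J \<in> lim_jacobians f (closed_segment a b)"
    then obtain z where "z \<in> closed_segment a b" "J \<in> lim_jacobians f {z}"
      using lim_jacobians_subset_UN[of "closed_segment a b" f] by auto
    then show "J \<in> clarke_jacobian_seg f a b"
      unfolding clarke_jacobian_seg_def clarke_jacobian_eq by (blast intro: hull_inc)
  qed
  then show "convex hull (lim_jacobians f (closed_segment a b)) \<subseteq> convex hull (clarke_jacobian_seg f a b)"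
    by (rule hull_mono)
qed

text \<open>Upper semicontinuity in dual form: violations at points tending to \<open>S\<close>
  would have bounded Jacobians, and a limit of these would violate the strict bound.\<close>

lemma jacobian_at_functional_less_near:
  fixes f :: "real^'d \<Rightarrow> real^'n" and \<beta> :: real
  assumes f: "lipschitz_on_balls f" and S: "compact S" "S \<noteq> {}"
    and \<phi>: "bounded_linear \<phi>" and less: "\<And>J. J \<in> lim_jacobians f S \<Longrightarrow> \<phi> J < \<beta>"
  shows "\<exists>\<eta>>0. \<forall>y. f differentiable (at y) \<longrightarrow> infdist y S < \<eta> \<longrightarrow> \<phi> (jacobian_at f y) < \<beta>"
proof (rule ccontr)
  assume neg: "\<not> ?thesis"
  have "\<exists>y. f differentiable (at y) \<and> infdist y S < 1 / Suc k \<and> \<beta> \<le> \<phi> (jacobian_at f y)" for k :: nat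
  proof (rule ccontr)
    assume "\<not> ?thesis"
    then have "\<forall>y. f differentiable (at y) \<longrightarrow> infdist y S < 1 / Suc k \<longrightarrow> \<phi> (jacobian_at f y) < \<beta>" by force
    moreover have "1 / real (Suc k) > 0" by simp
    ultimately show False using neg by blast
  qed
  then obtain ys where ys: "\<And>k. f differentiable (at (ys k))" "\<And>k. infdist (ys k) S < 1 / Suc k"
    "\<And>k. \<beta> \<le> \<phi> (jacobian_at f (ys k))" by metis
  obtain B where B: "\<And>y. \<lbrakk>infdist y S \<le> 1; f differentiable (at y)\<rbrakk> \<Longrightarrow> norm (jacobian_at f y) \<le> B"
    using f S by (rule jacobian_at_bounded_near) blast
  have "jacobian_at f (ys k) \<in> cball 0 B" for k
  proof -
    have "1 / real (Suc k) \<le> 1" by simp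
    then have "infdist (ys k) S \<le> 1" using ys(2)[of k] by linarith
    with B ys show ?thesis by simp
  qed
  then obtain J s where J: "strict_mono (s::nat \<Rightarrow> nat)" "((\<lambda>k. jacobian_at f (ys k)) \<circ> s) \<longlonglongrightarrow> J"
    using compact_cball[of "0::real^'d^'n" B] unfolding compact_def by metis
  have 0: "(\<lambda>k. 1 / real (Suc k)) \<longlonglongrightarrow> 0" using LIMSEQ_inverse_real_of_nat by (simp add: inverse_eq_divide)
  have "(\<lambda>k. infdist (ys k) S) \<longlonglongrightarrow> 0"
    by (rule tendsto_sandwich[OF _ _ tendsto_const 0]) (use ys in \<open>auto simp: infdist_nonneg less_imp_le intro!: always_eventually\<close>)
  then have "J \<in> lim_jacobians f S"
    using ys(1) LIMSEQ_subseq_LIMSEQ[OF _ J(1)] J(2)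
    by (intro lim_jacobians_limitI[of f "\<lambda>k. ys (s k)"]) (simp_all add: o_def)
  moreover have "(\<lambda>k. \<phi> (jacobian_at f (ys (s k)))) \<longlonglongrightarrow> \<phi> J"
    using bounded_linear.tendsto[OF \<phi> J(2)] by (simp add: o_def)
  then have "\<beta> \<le> \<phi> J" by (rule tendsto_lowerbound) (use ys(3) in \<open>auto intro!: always_eventually\<close>)
  ultimately show False using less by force
qed

text \<open>Averages are controlled through linear functionals only, so membership is shown by
  excluding a separating hyperplane.\<close>

lemma jac_avg_limit_in_clarke_jacobian:
  fixes f :: "real^'d \<Rightarrow> real^'n"
  assumes f: "lipschitz_on_balls f" and lim: "(\<lambda>k. jac_avg f (c k) (\<delta> k)) \<longlonglongrightarrow> J"
    and c: "c \<longlonglongrightarrow> z" and \<delta>: "\<delta> \<longlonglongrightarrow> 0" and pos: "\<And>k. \<delta> k > 0"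
  shows "J \<in> clarke_jacobian f z"
proof (rule ccontr)
  assume J: "J \<notin> clarke_jacobian f z"
  let ?C = "convex hull (lim_jacobians f {z})"
  have "closed ?C" by (intro compact_imp_closed compact_convex_hull compact_lim_jacobians f) auto
  then obtain a b where ab: "a \<bullet> J < b" "\<And>x. x \<in> ?C \<Longrightarrow> b < a \<bullet> x"
    using separating_hyperplane_closed_point[of ?C J] J unfolding clarke_jacobian_eq by auto
  have \<phi>: "bounded_linear (\<lambda>x. (- a) \<bullet> x)" by (rule bounded_linear_inner_right)
  obtain \<eta> where \<eta>: "\<eta> > 0" "\<And>y. \<lbrakk>f differentiable (at y); infdist y {z} < \<eta>\<rbrakk> \<Longrightarrow> (- a) \<bullet> jacobian_at f y < - b"
    using jacobian_at_functional_less_near[OF f _ _ \<phi>, of "{z}" "- b"] ab(2) hull_subset[of "lim_jacobians f {z}" convex] by auto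
  have "\<forall>\<^sub>F k in sequentially. (- a) \<bullet> jac_avg f (c k) (\<delta> k) \<le> - b"
    using tendstoD[OF c half_gt_zero[OF \<eta>(1)]] order_tendstoD(2)[OF \<delta> half_gt_zero[OF \<eta>(1)]]
  proof eventually_elim
    fix k assume k: "dist (c k) z < \<eta> / 2" "\<delta> k < \<eta> / 2"
    show "(- a) \<bullet> jac_avg f (c k) (\<delta> k) \<le> - b"
    proof (rule jac_avg_le[OF f pos \<phi>])
      fix y assume y: "norm (y - c k) \<le> \<delta> k" "f differentiable (at y)"
      then have "infdist y {z} < \<eta>" using k dist_triangle[of y z "c k"] by (simp add: dist_norm)
      from \<eta>(2)[OF y(2) this] show "(- a) \<bullet> jacobian_at f y \<le> - b" by simp
    qed
  qed
  then have "(- a) \<bullet> J \<le> - b"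
    by (rule tendsto_upperbound[OF tendsto_inner[OF tendsto_const lim]]) simp
  with ab(1) show False by simp
qed

text \<open>A limit of Jacobians is close to the Jacobian at some differentiability point
  \<open>y\<close> near \<open>z\<close>, and that one is close to averages at small scale.\<close>

lemma jac_avg_approximates:
  fixes f :: "real^'d \<Rightarrow> real^'n"
  assumes f: "lipschitz_on_balls f" and J: "J \<in> lim_jacobians f {z}" and \<epsilon>: "\<epsilon> > 0"
    and dense: "\<And>x r. r > 0 \<Longrightarrow> \<exists>c\<in>D. norm (c - x) < r"
  shows "\<exists>c\<in>D. \<exists>n::nat. norm (c - z) < \<epsilon> \<and> 1 / Suc n < \<epsilon> \<and> norm (jac_avg f c (1 / Suc n) - J) < \<epsilon>"
proof -
  obtain y where y: "f differentiable (at y)" "norm (y - z) < \<epsilon> / 2" "norm (jacobian_at f y - J) < \<epsilon> / 2"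
    using J \<epsilon> unfolding lim_jacobians_def by (auto simp: dist_norm dest!: spec[of _ "\<epsilon> / 2"])
  obtain \<eta> where \<eta>: "\<eta> > 0" "\<And>\<delta> c. \<lbrakk>0 < \<delta>; \<delta> < \<eta>; norm (c - y) \<le> \<delta>\<rbrakk> \<Longrightarrow> norm (jac_avg f c \<delta> - jacobian_at f y) \<le> \<epsilon> / 2"
    using jac_avg_near_jacobian_at[OF f y(1), of "\<epsilon> / 2"] \<epsilon> by auto
  obtain n where n: "1 / Suc n < min \<eta> (\<epsilon> / 2)" using nat_approx_posE[of "min \<eta> (\<epsilon> / 2)"] \<eta> \<epsilon> by auto
  \<comment> \<open>The radius is fixed first; the centre has to approximate \<open>y\<close> only
    to within that radius.\<close>
  obtain c where c: "c \<in> D" "norm (c - y) < 1 / Suc n" using dense[of "1 / Suc n" y] by auto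
  have "norm (c - z) < \<epsilon>" using c n y norm_triangle_ineq[of "c - y" "y - z"] by simp
  moreover have "norm (jac_avg f c (1 / Suc n) - jacobian_at f y) \<le> \<epsilon> / 2" using c n by (intro \<eta>(2)) auto
  then have "norm (jac_avg f c (1 / Suc n) - J) < \<epsilon>"
    using y norm_triangle_ineq[of "jac_avg f c (1 / Suc n) - jacobian_at f y" "jacobian_at f y - J"] by simp
  ultimately show ?thesis using c n \<epsilon> by (intro bexI[of _ c] exI[of _ n]) auto
qed

section \<open>The mean value theorem\<close>

definition bump_avg :: "('a::euclidean_space \<Rightarrow> 'b::euclidean_space) \<Rightarrow> real \<Rightarrow> 'a \<Rightarrow> 'b" where
  "bump_avg f \<delta> z = (\<integral>w. bump w *\<^sub>R f (z + \<delta> *\<^sub>R w) \<partial>lborel)"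

lemma integrable_bump_avg:
  fixes f :: "'a::euclidean_space \<Rightarrow> 'b::euclidean_space"
  assumes f: "lipschitz_on_balls f"
  shows "integrable lborel (\<lambda>w. bump w *\<^sub>R f (z + \<delta> *\<^sub>R w))"
proof -
  note [measurable] = lipschitz_on_balls_borel_measurable[OF f]
  have "compact ((\<lambda>w. f (z + \<delta> *\<^sub>R w)) ` cball 0 1)"
    by (intro compact_continuous_image continuous_intros continuous_on_compose2[OF lipschitz_on_balls_imp_continuous_on[OF f, of UNIV]]) auto
  then obtain B where "\<And>w. norm w \<le> 1 \<Longrightarrow> norm (f (z + \<delta> *\<^sub>R w)) \<le> B"
    using compact_imp_bounded by (fastforce simp: bounded_iff)
  then show ?thesis by (intro integrable_bump_scaleR[where B = B]) auto
qed

lemma norm_bump_average_le: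
  fixes g :: "'a::euclidean_space \<Rightarrow> 'b::euclidean_space"
  assumes g: "integrable lborel (\<lambda>w. bump w *\<^sub>R g w)" and B: "\<And>w. norm w \<le> 1 \<Longrightarrow> norm (g w) \<le> B"
  shows "norm (\<integral>w. bump w *\<^sub>R g w \<partial>lborel) \<le> B"
proof -
  have "norm (\<integral>w. bump w *\<^sub>R g w \<partial>lborel) \<le> (\<integral>w. norm (bump w *\<^sub>R g w) \<partial>lborel)"
    by (rule Bochner_Integration.integral_norm_bound)
  also have "\<dots> \<le> (\<integral>w. bump (w::'a) * B \<partial>lborel)"
  proof (rule integral_mono)
    show "integrable lborel (\<lambda>w. norm (bump w *\<^sub>R g w))" using g by (rule integrable_norm)
    show "integrable lborel (\<lambda>w::'a. bump w * B)" by (simp add: integrable_bump)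
    show "norm (bump w *\<^sub>R g w) \<le> bump w * B" for w :: 'a
    proof (cases "norm w \<le> 1")
      case True
      from mult_left_mono[OF B[OF this] bump_nonneg[of w]] show ?thesis by (simp add: abs_of_nonneg[OF bump_nonneg])
    qed (simp add: bump_eq_0)
  qed
  also have "\<dots> = B" by (simp add: integral_bump)
  finally show ?thesis .
qed

lemma norm_scaled_shift_le:
  fixes z :: "'a::real_normed_vector"
  assumes "norm w \<le> 1" "0 \<le> \<delta>" "norm z \<le> R"
  shows "norm (z + \<delta> *\<^sub>R w) \<le> R + \<delta>"
proof -
  have "norm (\<delta> *\<^sub>R w) \<le> \<delta>" using assms mult_left_mono[of "norm w" 1 \<delta>] by simp
  then show ?thesis using norm_triangle_ineq[of z "\<delta> *\<^sub>R w"] assms(3) by linarith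
qed

lemma bump_avg_lipschitz:
  fixes f :: "'a::euclidean_space \<Rightarrow> 'b::euclidean_space"
  assumes f: "lipschitz_on_balls f" and L: "L-lipschitz_on (cball 0 (R + \<delta>)) f" and \<delta>: "\<delta> \<ge> 0"
  shows "L-lipschitz_on (cball 0 R) (bump_avg f \<delta>)"
proof (rule lipschitz_onI)
  fix z z' :: 'a assume z: "z \<in> cball 0 R" "z' \<in> cball 0 R"
  note int = integrable_bump_avg[OF f]
  have "bump_avg f \<delta> z - bump_avg f \<delta> z' = (\<integral>w. bump w *\<^sub>R (f (z + \<delta> *\<^sub>R w) - f (z' + \<delta> *\<^sub>R w)) \<partial>lborel)"
    by (simp add: bump_avg_def scaleR_diff_right int)
  also have "norm \<dots> \<le> L * dist z z'"
  proof (rule norm_bump_average_le)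
    show "integrable lborel (\<lambda>w. bump w *\<^sub>R (f (z + \<delta> *\<^sub>R w) - f (z' + \<delta> *\<^sub>R w)))"
      using int by (simp add: scaleR_diff_right)
    fix w :: 'a assume "norm w \<le> 1"
    with z \<delta> have "z + \<delta> *\<^sub>R w \<in> cball 0 (R + \<delta>)" "z' + \<delta> *\<^sub>R w \<in> cball 0 (R + \<delta>)"
      by (auto intro: norm_scaled_shift_le)
    from lipschitz_onD[OF L this] show "norm (f (z + \<delta> *\<^sub>R w) - f (z' + \<delta> *\<^sub>R w)) \<le> L * dist z z'"
      by (simp add: dist_norm)
  qed
  finally show "dist (bump_avg f \<delta> z) (bump_avg f \<delta> z') \<le> L * dist z z'" by (simp add: dist_norm)
qed (rule lipschitz_on_nonneg[OF L])

lemma bump_avg_near: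
  fixes f :: "'a::euclidean_space \<Rightarrow> 'b::euclidean_space"
  assumes f: "lipschitz_on_balls f" and L: "L-lipschitz_on (cball 0 (R + \<delta>)) f" and \<delta>: "\<delta> \<ge> 0" and z: "norm z \<le> R"
  shows "norm (bump_avg f \<delta> z - f z) \<le> L * \<delta>"
proof -
  note int = integrable_bump_avg[OF f, of z \<delta>]
  have int': "integrable lborel (\<lambda>w::'a. bump w *\<^sub>R f z)" by (intro integrable_scaleR_left integrable_bump)
  have "(\<integral>w. bump (w::'a) *\<^sub>R f z \<partial>lborel) = integral\<^sup>L lborel (bump :: 'a \<Rightarrow> real) *\<^sub>R f z"
    by (rule integral_scaleR_left) (rule integrable_bump)
  then have "bump_avg f \<delta> z - f z = (\<integral>w. bump w *\<^sub>R (f (z + \<delta> *\<^sub>R w) - f z) \<partial>lborel)"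
    using int int' by (simp add: bump_avg_def scaleR_diff_right integral_bump)
  also have "norm \<dots> \<le> L * \<delta>"
  proof (rule norm_bump_average_le)
    show "integrable lborel (\<lambda>w. bump w *\<^sub>R (f (z + \<delta> *\<^sub>R w) - f z))"
      using int int' by (simp add: scaleR_diff_right)
    fix w :: 'a assume w: "norm w \<le> 1"
    have "z + \<delta> *\<^sub>R w \<in> cball 0 (R + \<delta>)" "z \<in> cball 0 (R + \<delta>)"
      using norm_scaled_shift_le[OF w \<delta> z] z \<delta> by auto
    from lipschitz_onD[OF L this] have "norm (f (z + \<delta> *\<^sub>R w) - f z) \<le> L * (\<delta> * norm w)"
      using \<delta> by (simp add: dist_norm)
    also have "\<dots> \<le> L * (\<delta> * 1)" using w \<delta> lipschitz_on_nonneg[OF L] by (intro mult_left_mono) auto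
    finally show "norm (f (z + \<delta> *\<^sub>R w) - f z) \<le> L * \<delta>" by simp
  qed
  finally show ?thesis .
qed

text \<open>Identifies the derivative of the mollification as far as the Dini argument needs it:
  along one sequence of steps in each direction.\<close>

lemma bump_avg_diff_quot_tendsto:
  fixes f :: "real^'d \<Rightarrow> real^'n"
  assumes f: "lipschitz_on_balls f" and \<delta>: "\<delta> > 0"
  shows "(\<lambda>k. real (Suc k) *\<^sub>R (bump_avg f \<delta> (z + (1 / Suc k) *\<^sub>R e) - bump_avg f \<delta> z)) \<longlonglongrightarrow> jac_avg f z \<delta> *v e"
proof -
  note int = integrable_bump_avg[OF f]
  have "real (Suc k) *\<^sub>R (bump_avg f \<delta> (z + (1 / Suc k) *\<^sub>R e) - bump_avg f \<delta> z)
      = (\<integral>w. bump w *\<^sub>R (real (Suc k) *\<^sub>R (f (z + \<delta> *\<^sub>R w + (1 / Suc k) *\<^sub>R e) - f (z + \<delta> *\<^sub>R w))) \<partial>lborel)" for k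
  proof -
    have "bump_avg f \<delta> (z + (1 / Suc k) *\<^sub>R e) - bump_avg f \<delta> z
      = (\<integral>w. bump w *\<^sub>R f (z + (1 / Suc k) *\<^sub>R e + \<delta> *\<^sub>R w) - bump w *\<^sub>R f (z + \<delta> *\<^sub>R w) \<partial>lborel)"
      unfolding bump_avg_def by (intro Bochner_Integration.integral_diff[symmetric] int)
    then have "real (Suc k) *\<^sub>R (bump_avg f \<delta> (z + (1 / Suc k) *\<^sub>R e) - bump_avg f \<delta> z)
      = (\<integral>w. real (Suc k) *\<^sub>R (bump w *\<^sub>R f (z + (1 / Suc k) *\<^sub>R e + \<delta> *\<^sub>R w) - bump w *\<^sub>R f (z + \<delta> *\<^sub>R w)) \<partial>lborel)"
      by (simp only: integral_scaleR_right)
    also have "\<dots> = (\<integral>w. bump w *\<^sub>R (real (Suc k) *\<^sub>R (f (z + \<delta> *\<^sub>R w + (1 / Suc k) *\<^sub>R e) - f (z + \<delta> *\<^sub>R w))) \<partial>lborel)"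
    proof (intro Bochner_Integration.integral_cong refl)
      fix w :: "real^'d"
      have "z + (1 / Suc k) *\<^sub>R e + \<delta> *\<^sub>R w = z + \<delta> *\<^sub>R w + (1 / Suc k) *\<^sub>R e" by (simp add: algebra_simps)
      then show "real (Suc k) *\<^sub>R (bump w *\<^sub>R f (z + (1 / Suc k) *\<^sub>R e + \<delta> *\<^sub>R w) - bump w *\<^sub>R f (z + \<delta> *\<^sub>R w))
        = bump w *\<^sub>R (real (Suc k) *\<^sub>R (f (z + \<delta> *\<^sub>R w + (1 / Suc k) *\<^sub>R e) - f (z + \<delta> *\<^sub>R w)))"
        by (simp only: scaleR_diff_right[symmetric] scaleR_left_commute)
    qed
    finally show ?thesis .
  qed
  then show ?thesis using integral_diff_quot_tendsto_jac_avg[OF f \<delta>, of z e] by (simp only:)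
qed

text \<open>If the increment were not in the compact convex set on the right, a hyperplane would separate
  them; along the segment the mollified function would then grow too slowly at every point.\<close>
lemma mean_value_clarke:
  fixes f :: "real^'d \<Rightarrow> real^'n"
  assumes f: "lipschitz_on_balls f"
  shows "\<exists>B\<in>convex hull (clarke_jacobian_seg f a b). f b - f a = B *v (b - a)"
proof (rule ccontr)
  assume neg: "\<not> ?thesis"
  let ?S = "closed_segment a b"
  define e where "e = b - a"
  define C where "C = (\<lambda>B. B *v e) ` (convex hull (lim_jacobians f ?S))"
  note bl = bounded_linear_matrix_vector_mult_left[of e, where 'n = 'n]
  have "convex C" unfolding C_def by (intro convex_linear_image bounded_linear.linear bl convex_convex_hull)
  moreover have "compact C" unfolding C_def
    by (intro compact_continuous_image linear_continuous_on bl compact_convex_hull compact_lim_jacobians f) auto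
  then have "closed C" by (rule compact_imp_closed)
  moreover have "f b - f a \<notin> C" using neg unfolding convex_hull_clarke_jacobian_seg C_def e_def by auto
  ultimately obtain \<alpha> \<beta> where sep: "\<alpha> \<bullet> (f b - f a) < \<beta>" "\<And>x. x \<in> C \<Longrightarrow> \<beta> < \<alpha> \<bullet> x"
    using separating_hyperplane_closed_point[of C "f b - f a"] by auto
  \<comment> \<open>The sign turns the lower bound on \<open>C\<close> into an upper bound, the form
    in which \<open>jac_avg_le\<close> is stated.\<close>
  define \<phi> where "\<phi> B = (- \<alpha>) \<bullet> (B *v e)" for B :: "real^'d^'n"
  have \<phi>: "bounded_linear \<phi>" unfolding \<phi>_def
    by (rule bounded_linear_compose[OF bounded_linear_inner_right bl])
  have "\<phi> J < - \<beta>" if "J \<in> lim_jacobians f ?S" for J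
    using sep(2)[of "J *v e"] that by (auto simp: \<phi>_def C_def intro: hull_inc)
  then obtain \<eta> where \<eta>: "\<eta> > 0" "\<And>y. \<lbrakk>f differentiable (at y); infdist y ?S < \<eta>\<rbrakk> \<Longrightarrow> \<phi> (jacobian_at f y) < - \<beta>"
    using jacobian_at_functional_less_near[OF f _ _ \<phi>, of ?S "- \<beta>"] by auto
  have segI: "a + t *\<^sub>R e \<in> ?S" if "0 \<le> t" "t \<le> 1" for t
    using that by (auto simp: closed_segment_def e_def algebra_simps intro!: exI[of _ t])
  obtain R where R: "\<And>z. z \<in> ?S \<Longrightarrow> norm z \<le> R" using bounded_closed_segment[of a b] unfolding bounded_iff by blast
  obtain L where L: "L \<ge> 0" "L-lipschitz_on (cball 0 (R + 1)) f" using f by (rule lipschitz_on_ballsE)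
  \<comment> \<open>The segment may consist of points at which \<open>f\<close> is not
    differentiable. The quotients of the mollification converge at each of its points, and for
    \<open>\<delta> < \<eta>\<close> the averaging balls stay where the strict bound on Jacobians
    holds.\<close>
  have avg: "\<beta> \<le> \<alpha> \<bullet> (bump_avg f \<delta> b - bump_avg f \<delta> a)" if \<delta>: "0 < \<delta>" "\<delta> < \<eta>" "\<delta> < 1" for \<delta>
  proof (rule field_le_epsilon)
    fix \<kappa> :: real assume \<kappa>: "\<kappa> > 0"
    define g where "g t = bump_avg f \<delta> (a + t *\<^sub>R e)" for t
    have "L-lipschitz_on (cball 0 (R + \<delta>)) f" using L(2) by (rule lipschitz_on_subset) (use \<delta> in auto)
    then have lip: "L-lipschitz_on (cball 0 R) (bump_avg f \<delta>)" using f \<delta> by (intro bump_avg_lipschitz) auto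
    have cont: "continuous_on {0..1} g" unfolding g_def
      by (intro continuous_on_compose2[OF lipschitz_on_continuous_on[OF lip]] continuous_intros) (auto intro!: R segI)
    \<comment> \<open>In the limit the quotients are only known to be at least
      \<open>\<beta>\<close>; the slack \<open>\<kappa>\<close> makes the inequality strict, so that
      it holds at some finite step.\<close>
    define F where "F t = \<alpha> \<bullet> g t - (\<beta> - \<kappa>) * t" for t
    have "F 0 \<le> F 1"
    proof (rule dini_increasing[of 0 1])
      show "continuous_on {0..1} F" unfolding F_def by (intro continuous_intros cont)
      fix t d :: real assume t: "0 \<le> t" "t < 1" "0 < d"
      let ?q = "\<lambda>k. real (Suc k) *\<^sub>R (g (t + 1 / Suc k) - g t)"
      have "?q \<longlonglongrightarrow> jac_avg f (a + t *\<^sub>R e) \<delta> *v e"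
        using bump_avg_diff_quot_tendsto[OF f \<delta>(1), of "a + t *\<^sub>R e" e]
        by (simp only: g_def scaleR_add_left add.assoc)
      then have "(\<lambda>k. \<alpha> \<bullet> ?q k) \<longlonglongrightarrow> - \<phi> (jac_avg f (a + t *\<^sub>R e) \<delta>)"
        unfolding \<phi>_def by (simp only: inner_minus_left minus_minus) (intro tendsto_inner tendsto_const)
      moreover have "\<phi> (jac_avg f (a + t *\<^sub>R e) \<delta>) \<le> - \<beta>"
      proof (rule jac_avg_le[OF f \<delta>(1) \<phi>])
        fix y assume y: "norm (y - (a + t *\<^sub>R e)) \<le> \<delta>" "f differentiable (at y)"
        have "infdist y ?S \<le> dist y (a + t *\<^sub>R e)" using t by (intro infdist_le segI) auto
        with y \<delta> show "\<phi> (jacobian_at f y) \<le> - \<beta>" by (intro less_imp_le \<eta>(2)) (auto simp: dist_norm)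
      qed
      then have "\<beta> - \<kappa> < - \<phi> (jac_avg f (a + t *\<^sub>R e) \<delta>)" using \<kappa> by simp
      ultimately have "\<forall>\<^sub>F k in sequentially. \<beta> - \<kappa> < \<alpha> \<bullet> ?q k" by (rule order_tendstoD(1))
      moreover have "(\<lambda>k. 1 / real (Suc k)) \<longlonglongrightarrow> 0" using LIMSEQ_inverse_real_of_nat by (simp add: inverse_eq_divide)
      then have "\<forall>\<^sub>F k in sequentially. 1 / real (Suc k) < d" using t(3) by (rule order_tendstoD(2))
      ultimately have "\<forall>\<^sub>F k in sequentially. \<beta> - \<kappa> < \<alpha> \<bullet> ?q k \<and> 1 / real (Suc k) < d" by (rule eventually_conj)
      then obtain k where k: "\<beta> - \<kappa> < \<alpha> \<bullet> ?q k" "1 / real (Suc k) < d" by (auto simp: eventually_sequentially)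
      define h where "h = 1 / real (Suc k)"
      have h: "h > 0" "real (Suc k) = 1 / h" by (auto simp: h_def)
      from k(1) have "\<beta> - \<kappa> < (1 / h) * (\<alpha> \<bullet> (g (t + h) - g t))" unfolding h(2) by simp
      then have "(\<beta> - \<kappa>) * h < \<alpha> \<bullet> (g (t + h) - g t)" using h(1) by (simp add: field_simps)
      then have "F t \<le> F (t + h)" by (simp add: F_def algebra_simps inner_diff_right)
      with h k(2) show "\<exists>h>0. h < d \<and> F t \<le> F (t + h)"
        by (intro exI[of _ h]) (simp add: h_def)
    qed simp
    then show "\<beta> \<le> \<alpha> \<bullet> (bump_avg f \<delta> b - bump_avg f \<delta> a) + \<kappa>"
      by (simp add: F_def g_def e_def inner_diff_right)
  qed
  define \<gamma> where "\<gamma> = \<beta> - \<alpha> \<bullet> (f b - f a)"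
  have \<gamma>: "\<gamma> > 0" using sep(1) by (simp add: \<gamma>_def)
  \<comment> \<open>Mollification moves each of the two end values by at most
    \<open>L * \<delta>\<close>; the summand 1 keeps \<open>D\<close> positive.\<close>
  define D where "D = norm \<alpha> * (2 * L) + 1"
  have D: "D > 0" using L by (simp add: D_def add_nonneg_pos)
  define \<delta> where "\<delta> = min (min (\<eta> / 2) (1 / 2)) (\<gamma> / (2 * D))"
  have \<delta>: "0 < \<delta>" "\<delta> < \<eta>" "\<delta> < 1" and "\<delta> \<le> \<gamma> / (2 * D)" using \<eta>(1) \<gamma> D by (auto simp: \<delta>_def)
  then have \<delta>D: "\<delta> * D < \<gamma>" using D \<gamma> by (simp add: field_simps)
  have L\<delta>: "L-lipschitz_on (cball 0 (R + \<delta>)) f" using L(2) by (rule lipschitz_on_subset) (use \<delta> in auto)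
  have "norm (bump_avg f \<delta> b - f b) \<le> L * \<delta>" "norm (bump_avg f \<delta> a - f a) \<le> L * \<delta>"
    using \<delta> by (auto intro!: bump_avg_near[OF f L\<delta>] R)
  then have "norm ((bump_avg f \<delta> b - bump_avg f \<delta> a) - (f b - f a)) \<le> 2 * L * \<delta>"
    using norm_triangle_ineq4[of "bump_avg f \<delta> b - f b" "bump_avg f \<delta> a - f a"] by (simp add: algebra_simps)
  then have "\<alpha> \<bullet> ((bump_avg f \<delta> b - bump_avg f \<delta> a) - (f b - f a)) \<le> norm \<alpha> * (2 * L * \<delta>)"
    using norm_cauchy_schwarz[of \<alpha> "(bump_avg f \<delta> b - bump_avg f \<delta> a) - (f b - f a)"]
      mult_left_mono[OF _ norm_ge_zero[of \<alpha>]] by (meson order_trans)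
  also have "\<dots> \<le> \<delta> * D" using \<delta> by (simp add: D_def algebra_simps)
  finally have "\<alpha> \<bullet> (bump_avg f \<delta> b - bump_avg f \<delta> a) - \<alpha> \<bullet> (f b - f a) < \<gamma>"
    using \<delta>D by (simp add: inner_diff_right)
  with avg[OF \<delta>] show False by (simp add: \<gamma>_def)
qed

section \<open>Measurable selection\<close>

text \<open>For fixed \<open>x\<close> the values \<open>X j x\<close> with \<open>P k j x\<close>
  have cluster points as \<open>k\<close> grows, by boundedness and monotonicity. One of them is
  found by successive approximation within a dense sequence, always taking the least index that
  works; the conclusion says that \<open>g x\<close> is such a cluster point.\<close>

lemma measurable_selection:
  fixes X :: "'i::countable \<Rightarrow> 'a \<Rightarrow> 'b::euclidean_space" and P :: "nat \<Rightarrow> 'i \<Rightarrow> 'a \<Rightarrow> bool"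
  assumes X[measurable]: "\<And>j. X j \<in> borel_measurable M" and P[measurable]: "\<And>k j. Measurable.pred M (P k j)"
    and mono: "\<And>k j x. \<lbrakk>x \<in> S; P (Suc k) j x\<rbrakk> \<Longrightarrow> P k j x"
    and ne: "\<And>k x. x \<in> S \<Longrightarrow> \<exists>j. P k j x"
    and bdd: "\<And>x. x \<in> S \<Longrightarrow> \<exists>B. \<forall>j. P 0 j x \<longrightarrow> norm (X j x) \<le> B"
  shows "\<exists>g. g \<in> borel_measurable M \<and> (\<forall>x\<in>S. \<forall>k. \<forall>\<epsilon>>0. \<exists>j. P k j x \<and> dist (X j x) (g x) < \<epsilon>)"
proof -
  \<comment> \<open>A countable condition, hence measurable in \<open>x\<close>, that stands in for
    the existence of a cluster point near \<open>y\<close>.\<close>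
  define near where "near r y x \<longleftrightarrow> (\<forall>k. \<exists>j. P k j x \<and> dist (X j x) y < r)" for r y x
  have [measurable]: "Measurable.pred M (near r y)" for r y unfolding near_def by measurable
  have mono': "P l j x" if "x \<in> S" "P k j x" "l \<le> k" for x k l j
    using that(3,2) by (induction rule: dec_induct) (auto intro: mono[OF that(1)])
  \<comment> \<open>Compactness of the ball produces an actual cluster point, from which the
    approximation can be continued at any smaller radius.\<close>
  have cluster: "\<exists>y. dist y y0 \<le> r \<and> (\<forall>\<epsilon>>0. near \<epsilon> y x)" if x: "x \<in> S" and near: "near r y0 x" for x r y0
  proof -
    obtain js where js: "\<And>k. P k (js k) x" "\<And>k. dist (X (js k) x) y0 < r" using near unfolding near_def by metis
    have "X (js k) x \<in> cball y0 r" for k using js(2)[of k] by (simp add: dist_commute)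
    then obtain y s where y: "y \<in> cball y0 r" "strict_mono (s::nat \<Rightarrow> nat)" "((\<lambda>k. X (js k) x) \<circ> s) \<longlonglongrightarrow> y"
      using compact_cball[of y0 r] unfolding compact_def by metis
    have "near \<epsilon> y x" if \<epsilon>: "\<epsilon> > 0" for \<epsilon>
      unfolding near_def
    proof
      fix k
      obtain N where N: "\<And>n. n \<ge> N \<Longrightarrow> dist (X (js (s n)) x) y < \<epsilon>"
        using tendstoD[OF y(3) \<epsilon>] by (auto simp: eventually_sequentially)
      have "k \<le> s (max N k)" using seq_suble[OF y(2), of "max N k"] by linarith
      with js(1) x have "P k (js (s (max N k))) x" by (blast intro: mono')
      with N[of "max N k"] show "\<exists>j. P k j x \<and> dist (X j x) y < \<epsilon>" by auto
    qed
    with y(1) show ?thesis by (auto simp: dist_commute)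
  qed
  obtain D :: "'b set" where D: "countable D" "\<forall>U. open U \<longrightarrow> U \<noteq> {} \<longrightarrow> (\<exists>d\<in>D. d \<in> U)"
    using countable_dense_exists[where 'a = 'b] by auto
  have "D \<noteq> {}" using D(2)[rule_format, of UNIV] by auto
  define q where "q = from_nat_into D"
  have q: "\<exists>i. dist (q i) y < r" if r: "r > 0" for y r
  proof -
    obtain d where "d \<in> D" "d \<in> ball y r" using D(2)[rule_format, of "ball y r"] r by auto
    then show ?thesis using from_nat_into_surj[OF D(1)] unfolding q_def by (metis dist_commute mem_ball)
  qed
  \<comment> \<open>The new point is within \<open>(1/2)^Suc n\<close> of a cluster point that lies
    within \<open>(1/2)^n\<close> of the old one, so \<open>2 * (1/2)^n\<close> bounds the distance.
    The minimum is measurable also where no index works.\<close>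
  define m where "m = rec_nat (\<lambda>x. LEAST i. near 1 (q i) x)
    (\<lambda>n mn x. LEAST i. near ((1/2)^Suc n) (q i) x \<and> dist (q i) (q (mn x)) < 2 * (1/2)^n)"
  have m0: "m 0 x = (LEAST i. near 1 (q i) x)" for x by (simp add: m_def)
  have mS: "m (Suc n) x = (LEAST i. near ((1/2)^Suc n) (q i) x \<and> dist (q i) (q (m n x)) < 2 * (1/2)^n)" for n x
    by (simp add: m_def)
  have meas_m[measurable]: "m n \<in> measurable M (count_space UNIV)" for n
  proof (induction n)
    case 0
    show ?case unfolding m0[abs_def] by measurable
  next
    case (Suc n)
    note Suc.IH[measurable]
    show ?case unfolding mS[abs_def] by measurable
  qed
  have m_all: "near ((1/2)^n) (q (m n x)) x \<and> dist (q (m (Suc n) x)) (q (m n x)) < 2 * (1/2)^n"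
    if x: "x \<in> S" for x n
  proof -
    have step: "near ((1/2)^Suc n) (q (m (Suc n) x)) x \<and> dist (q (m (Suc n) x)) (q (m n x)) < 2 * (1/2)^n"
      if IH: "near ((1/2)^n) (q (m n x)) x" for n
    proof -
      obtain y where y: "dist y (q (m n x)) \<le> (1/2)^n" "\<And>\<epsilon>. \<epsilon> > 0 \<Longrightarrow> near \<epsilon> y x" using cluster[OF x IH] by auto
      obtain i where i: "dist (q i) y < (1/2)^Suc n" using q[of "(1/2)^Suc n" y] by auto
      have "near ((1/2)^Suc n) (q i) x"
        unfolding near_def
      proof
        fix k
        from i have "0 < (1/2)^Suc n - dist (q i) y" by simp
        from y(2)[OF this] obtain j where "P k j x" "dist (X j x) y < (1/2)^Suc n - dist (q i) y" unfolding near_def by blast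
        then show "\<exists>j. P k j x \<and> dist (X j x) (q i) < (1/2)^Suc n"
          using dist_triangle[of "X j x" "q i" y] by (intro exI[of _ j]) (auto simp: dist_commute)
      qed
      moreover have "dist (q i) (q (m n x)) < 2 * (1/2)^n"
      proof -
        have "(1/2::real)^Suc n < (1/2)^n" by simp
        with dist_triangle[of "q i" "q (m n x)" y] y(1) i show ?thesis by linarith
      qed
      ultimately have "near ((1/2)^Suc n) (q i) x \<and> dist (q i) (q (m n x)) < 2 * (1/2)^n" ..
      then show ?thesis unfolding mS by (rule LeastI)
    qed
    have 0: "near ((1/2)^0) (q (m 0 x)) x"
    proof -
      obtain B where B: "\<And>j. P 0 j x \<Longrightarrow> norm (X j x) \<le> B" using bdd[OF x] by auto
      \<comment> \<open>The bound at level 0 holds at all levels by monotonicity, so a ball around 0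
        provides the first cluster point.\<close>
      have "near (B + 1) 0 x" unfolding near_def
      proof
        fix k
        obtain j where "P k j x" using ne[OF x] by auto
        moreover from this have "P 0 j x" using mono'[OF x] by blast
        ultimately show "\<exists>j. P k j x \<and> dist (X j x) 0 < B + 1" using B[of j] by (intro exI[of _ j]) auto
      qed
      then obtain y where y: "\<And>\<epsilon>. \<epsilon> > 0 \<Longrightarrow> near \<epsilon> y x" using cluster[OF x] by blast
      obtain i where i: "dist (q i) y < 1" using q[of 1 y] by auto
      have "near 1 (q i) x"
        unfolding near_def
      proof
        fix k
        from i have "0 < 1 - dist (q i) y" by simp
        from y[OF this] obtain j where "P k j x" "dist (X j x) y < 1 - dist (q i) y" unfolding near_def by blast
        then show "\<exists>j. P k j x \<and> dist (X j x) (q i) < 1"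
          using dist_triangle[of "X j x" "q i" y] by (intro exI[of _ j]) (auto simp: dist_commute)
      qed
      then show ?thesis unfolding m0 power_0 by (rule LeastI[where P = "\<lambda>i. near 1 (q i) x"])
    qed
    have "near ((1/2)^n) (q (m n x)) x" for n
      by (induction n) (use 0 step in blast)+
    with step show ?thesis by blast
  qed
  note m = m_all[THEN conjunct1] and m_step = m_all[THEN conjunct2]
  \<comment> \<open>The geometric bound on the steps makes the sequence converge on
    \<open>S\<close>; elsewhere \<open>lim\<close> is unspecified but still measurable.\<close>
  define g where "g x = lim (\<lambda>n. q (m n x))" for x
  have qm: "(\<lambda>x. q (m n x)) \<in> borel_measurable M" for n by measurable
  then have "g \<in> borel_measurable M" unfolding g_def[abs_def] by (rule borel_measurable_lim_metric)
  moreover have "\<exists>j. P k j x \<and> dist (X j x) (g x) < \<epsilon>" if x: "x \<in> S" and \<epsilon>: "\<epsilon> > 0" for x k \<epsilon>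
  proof -
    let ?a = "\<lambda>n. q (m n x)"
    have "summable (\<lambda>n. ?a (Suc n) - ?a n)"
    proof (rule summable_comparison_test)
      show "\<exists>N. \<forall>n\<ge>N. norm (?a (Suc n) - ?a n) \<le> 2 * (1/2)^n"
        using m_step[OF x] by (intro exI[of _ 0]) (simp add: dist_norm less_imp_le)
      show "summable (\<lambda>n. 2 * (1/2::real)^n)" by (intro summable_mult summable_geometric) simp
    qed
    then have "(\<lambda>n. ?a 0 + (\<Sum>i<n. ?a (Suc i) - ?a i)) \<longlonglongrightarrow> ?a 0 + (\<Sum>i. ?a (Suc i) - ?a i)"
      by (intro tendsto_add tendsto_const summable_LIMSEQ)
    then have "?a \<longlonglongrightarrow> ?a 0 + (\<Sum>i. ?a (Suc i) - ?a i)" by (simp add: sum_lessThan_telescope[of ?a])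
    then have lim: "?a \<longlonglongrightarrow> g x" unfolding g_def by (simp add: limI)
    have "(\<lambda>n. (1/2::real)^n) \<longlonglongrightarrow> 0" by (rule LIMSEQ_power_zero) simp
    from order_tendstoD(2)[OF this half_gt_zero[OF \<epsilon>]] tendstoD[OF lim half_gt_zero[OF \<epsilon>]]
    have "\<forall>\<^sub>F n in sequentially. (1/2)^n < \<epsilon> / 2 \<and> dist (?a n) (g x) < \<epsilon> / 2" by (rule eventually_conj)
    then obtain n where n: "(1/2)^n < \<epsilon> / 2" "dist (?a n) (g x) < \<epsilon> / 2" by (auto simp: eventually_sequentially)
    obtain j where "P k j x" "dist (X j x) (?a n) < (1/2)^n" using m[OF x, of n] unfolding near_def by blast
    then show ?thesis using n dist_triangle[of "X j x" "g x" "?a n"] by (intro exI[of _ j]) auto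
  qed
  ultimately show ?thesis by blast
qed

section \<open>Convex combinations of fixed length and their rational codes\<close>

lemma convex_hull_indexed_caratheodory:
  fixes S :: "'b::euclidean_space set"
  assumes x: "x \<in> convex hull S" and card: "CARD('k::finite) = DIM('b) + 1"
  shows "\<exists>(\<mu> :: 'k \<Rightarrow> real) s. (\<forall>i. 0 \<le> \<mu> i \<and> \<mu> i \<le> 1 \<and> s i \<in> S) \<and> sum \<mu> UNIV = 1 \<and> x = (\<Sum>i\<in>UNIV. \<mu> i *\<^sub>R s i)"
proof -
  obtain T w where T: "finite T" "T \<subseteq> S" "card T \<le> DIM('b) + 1" "\<forall>y\<in>T. 0 \<le> w y" "sum w T = 1" "(\<Sum>y\<in>T. w y *\<^sub>R y) = x"
    using x unfolding convex_hull_caratheodory by blast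
  then obtain t0 where t0: "t0 \<in> T" by (metis ex_in_conv sum.empty zero_neq_one)
  obtain h :: "'b \<Rightarrow> 'k" where h: "inj_on h T"
    using card_le_inj[of T "UNIV :: 'k set"] T card by auto
  define s where "s i = (if i \<in> h ` T then the_inv_into T h i else t0)" for i
  define \<mu> where "\<mu> i = (if i \<in> h ` T then w (the_inv_into T h i) else 0)" for i
  have inv: "the_inv_into T h (h y) = y" if "y \<in> T" for y using the_inv_into_f_f[OF h that] .
  have "w y \<le> 1" if "y \<in> T" for y
    using member_le_sum[of y T w] that T by auto
  then have "0 \<le> \<mu> i \<and> \<mu> i \<le> 1 \<and> s i \<in> S" for i
  proof (cases "i \<in> h ` T")
    case True
    then obtain y where y: "y \<in> T" "i = h y" by blast
    then have "\<mu> i = w y" "s i = y" using inv by (auto simp: \<mu>_def s_def)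
    with y T(2,4) \<open>\<And>y. y \<in> T \<Longrightarrow> w y \<le> 1\<close> show ?thesis by auto
  next
    case False
    then show ?thesis using t0 T(2) by (auto simp: \<mu>_def s_def)
  qed
  moreover have "sum \<mu> UNIV = sum \<mu> (h ` T)" by (rule sum.mono_neutral_right) (auto simp: \<mu>_def)
  then have "sum \<mu> UNIV = 1" using T inv by (simp add: sum.reindex[OF h] \<mu>_def)
  moreover have "(\<Sum>i\<in>UNIV. \<mu> i *\<^sub>R s i) = (\<Sum>i\<in>h ` T. \<mu> i *\<^sub>R s i)" by (rule sum.mono_neutral_right) (auto simp: \<mu>_def)
  then have "(\<Sum>i\<in>UNIV. \<mu> i *\<^sub>R s i) = x" using T inv by (simp add: sum.reindex[OF h] \<mu>_def s_def)
  ultimately show ?thesis by blast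
qed

text \<open>Since \<open>jac_lim\<close> is a limit of difference quotients, it is jointly
  measurable in \<open>x\<close> and the integration variable, and integration preserves
  measurability in \<open>x\<close>.\<close>

lemma borel_measurable_jac_avg_param:
  fixes H :: "'a \<Rightarrow> real^'d \<Rightarrow> real^'n"
  assumes H: "(\<lambda>(x, z). H x z) \<in> borel_measurable (M \<Otimes>\<^sub>M borel)"
  shows "(\<lambda>x. jac_avg (H x) c \<delta>) \<in> borel_measurable M"
proof -
  have [measurable]: "(\<lambda>p. H (fst p) (g p)) \<in> borel_measurable (M \<Otimes>\<^sub>M borel)"
    if [measurable]: "g \<in> borel_measurable (M \<Otimes>\<^sub>M borel)" for g
    using measurable_compose[OF _ H, of "\<lambda>p. (fst p, g p)" "M \<Otimes>\<^sub>M borel"] by simp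
  have nth[measurable]: "(\<lambda>p. H (fst p) (g p) $ i) \<in> borel_measurable (M \<Otimes>\<^sub>M borel)"
    if [measurable]: "g \<in> borel_measurable (M \<Otimes>\<^sub>M borel)" for g i
    by (rule borel_measurable_vec_nth) measurable
  have "(\<lambda>p. jac_lim (H (fst p)) (c + \<delta> *\<^sub>R snd p)) \<in> borel_measurable (M \<Otimes>\<^sub>M borel)"
    unfolding jac_lim_def dir_deriv_def diff_quot_def
    by (intro borel_measurable_vec_lambda borel_measurable_lim_metric) measurable
  then have "(\<lambda>p. bump (snd p) *\<^sub>R jac_lim (H (fst p)) (c + \<delta> *\<^sub>R snd p)) \<in> borel_measurable (M \<Otimes>\<^sub>M lborel)"
    unfolding measurable_lborel2 measurable_cong_sets[OF sets_pair_measure_cong[OF refl sets_lborel] refl]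
    by measurable
  then show ?thesis unfolding jac_avg_def
    by (intro lborel.borel_measurable_lebesgue_integral) (simp add: case_prod_beta')
qed

lemma norm_jac_avg_le:
  fixes f :: "real^'d \<Rightarrow> real^'n"
  assumes f: "lipschitz_on_balls f" and \<delta>: "\<delta> > 0" and B0: "B \<ge> 0"
    and B: "\<And>y. \<lbrakk>norm (y - c) \<le> \<delta>; f differentiable (at y)\<rbrakk> \<Longrightarrow> norm (jacobian_at f y) \<le> B"
  shows "norm (jac_avg f c \<delta>) \<le> B"
proof (cases "jac_avg f c \<delta> = 0")
  case True
  with B0 show ?thesis by simp
next
  case False
  let ?G = "jac_avg f c \<delta>"
  \<comment> \<open>Testing with the matrix itself turns the bound on linear functionals into a
    bound on the norm.\<close>
  have "?G \<bullet> ?G \<le> norm ?G * B"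
  proof (rule jac_avg_le[OF f \<delta> bounded_linear_inner_right])
    fix y assume "norm (y - c) \<le> \<delta>" "f differentiable (at y)"
    from mult_left_mono[OF B[OF this] norm_ge_zero[of ?G]] norm_cauchy_schwarz[of ?G "jacobian_at f y"]
    show "?G \<bullet> jacobian_at f y \<le> norm ?G * B" by linarith
  qed
  then have "norm ?G * norm ?G \<le> norm ?G * B" by (simp add: dot_square_norm power2_eq_square)
  with False show ?thesis by simp
qed

text \<open>Codes for two-level convex combinations with rational data: outer weights \<open>wt\<close>, positions
  \<open>tm\<close> on the segment, and inner weights \<open>iw\<close> of averaged Jacobians with centres \<open>d \<circ> ci\<close> and
  radii \<open>rad\<close>. The outer level represents \<open>co\<close> of the union, the inner one the convex hull in the
  definition of the Clarke Jacobian at a single point.\<close>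
type_synonym 'k code = "'k \<Rightarrow> rat \<times> rat \<times> ('k \<Rightarrow> rat \<times> nat \<times> nat)"

text \<open>All data form one vector of a Euclidean space, so one selection makes every component
  measurable. The position is kept as a point, so that convergence of combinations includes
  convergence of the points on the segment.\<close>

type_synonym ('d, 'n, 'k) comb = "(real \<times> (real^'d) \<times> ((real \<times> (real^'d^'n))^'k))^'k"

definition wt :: "'k code \<Rightarrow> 'k \<Rightarrow> real" where "wt j i = real_of_rat (fst (j i))"
definition tm :: "'k code \<Rightarrow> 'k \<Rightarrow> real" where "tm j i = real_of_rat (fst (snd (j i)))"
definition iw :: "'k code \<Rightarrow> 'k \<Rightarrow> 'k \<Rightarrow> real" where "iw j i l = real_of_rat (fst (snd (snd (j i)) l))"
definition ci :: "'k code \<Rightarrow> 'k \<Rightarrow> 'k \<Rightarrow> nat" where "ci j i l = fst (snd (snd (snd (j i)) l))"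
definition rad :: "'k code \<Rightarrow> 'k \<Rightarrow> 'k \<Rightarrow> real" where "rad j i l = 1 / real (Suc (snd (snd (snd (snd (j i)) l))))"

definition decode :: "(nat \<Rightarrow> real^'d) \<Rightarrow> (real^'d \<Rightarrow> real^'n) \<Rightarrow> real^'d \<Rightarrow> real^'d \<Rightarrow> 'k::finite code \<Rightarrow> ('d, 'n, 'k) comb" where
  "decode d f a b j = (\<chi> i. (wt j i, a + tm j i *\<^sub>R (b - a), \<chi> l. (iw j i l, jac_avg f (d (ci j i l)) (rad j i l))))"

definition outer_wt :: "('d, 'n, 'k::finite) comb \<Rightarrow> 'k \<Rightarrow> real" where "outer_wt T i = fst (T $ i)"

definition inner_comb :: "('d, 'n, 'k::finite) comb \<Rightarrow> 'k \<Rightarrow> real^'d^'n" where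
  "inner_comb T i = (\<Sum>l\<in>UNIV. fst (snd (snd (T $ i)) $ l) *\<^sub>R snd (snd (snd (T $ i)) $ l))"

definition comb_value :: "('d, 'n, 'k::finite) comb \<Rightarrow> real^'d^'n" where
  "comb_value T = (\<Sum>i\<in>UNIV. outer_wt T i *\<^sub>R inner_comb T i)"

text \<open>Ranges of weights and positions are closed conditions and imposed exactly. Sums, centres
  and radii carry a tolerance: rounding each weight separately need not preserve the sum 1, and
  centres come from a dense sequence.\<close>

definition admissible :: "(nat \<Rightarrow> real^'d) \<Rightarrow> real \<Rightarrow> real^'d \<Rightarrow> real^'d \<Rightarrow> 'k::finite code \<Rightarrow> bool" where
  "admissible d \<epsilon> a b j \<longleftrightarrow>
     (\<forall>i. wt j i \<in> {0..1} \<and> tm j i \<in> {0..1} \<and> \<bar>(\<Sum>l\<in>UNIV. iw j i l) - 1\<bar> < \<epsilon> \<and>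
       (\<forall>l. iw j i l \<in> {0..1} \<and> norm (d (ci j i l) - (a + tm j i *\<^sub>R (b - a))) < \<epsilon> \<and> rad j i l < \<epsilon>)) \<and>
     \<bar>(\<Sum>i\<in>UNIV. wt j i) - 1\<bar> < \<epsilon>"

lemma isCont_outer_wt: "isCont (\<lambda>T. outer_wt T i) T"
  unfolding outer_wt_def isCont_def by (intro tendsto_fst tendsto_vec_nth tendsto_ident_at)

lemma isCont_inner_comb: "isCont (\<lambda>T. inner_comb T i) T"
  unfolding inner_comb_def isCont_def
  by (intro tendsto_sum tendsto_scaleR tendsto_fst tendsto_snd tendsto_vec_nth tendsto_ident_at)

lemma isCont_comb_value: "isCont comb_value T"
  unfolding comb_value_def[abs_def] isCont_def
  by (intro tendsto_sum tendsto_scaleR isCont_outer_wt[unfolded isCont_def] isCont_inner_comb[unfolded isCont_def])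

lemma rad_pos: "rad j i l > 0"
  by (simp add: rad_def)

lemma admissible_mono:
  assumes "admissible d \<epsilon> a b j" "\<epsilon> \<le> \<epsilon>'"
  shows "admissible d \<epsilon>' a b j"
proof -
  have "x < \<epsilon>'" if "x < \<epsilon>" for x using that assms(2) by (rule order_less_le_trans)
  with assms(1) show ?thesis unfolding admissible_def by blast
qed

lemma decode_bounded:
  fixes f :: "real^'d \<Rightarrow> real^'n"
  assumes f: "lipschitz_on_balls f"
  shows "\<exists>B. \<forall>j :: 'k::finite code. admissible d 1 a b j \<longrightarrow> norm (decode d f a b j) \<le> B"
proof -
  let ?R = "norm a + norm (b - a)"
  \<comment> \<open>Centres are within 1 of a point of norm at most \<open>?R\<close>, and radii are
    below 1; hence the 2.\<close>
  obtain B' where B': "\<And>y. \<lbrakk>norm y \<le> ?R + 2; f differentiable (at y)\<rbrakk> \<Longrightarrow> norm (jacobian_at f y) \<le> B'"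
    using jacobian_at_locally_bounded[OF f] by metis
  define B where "B = \<bar>B'\<bar>"
  have B: "B \<ge> 0" "\<And>y. \<lbrakk>norm y \<le> ?R + 2; f differentiable (at y)\<rbrakk> \<Longrightarrow> norm (jacobian_at f y) \<le> B"
    using B' by (force simp: B_def)+
  let ?N = "real CARD('k)"
  have "norm (decode d f a b j) \<le> ?N * (1 + (?R + ?N * (1 + B)))" if adm: "admissible d 1 a b j" for j :: "'k code"
  proof -
    have a: "wt j i \<in> {0..1}" "tm j i \<in> {0..1}" "iw j i l \<in> {0..1}"
      "norm (d (ci j i l) - (a + tm j i *\<^sub>R (b - a))) < 1" "rad j i l < 1" for i l
      using adm unfolding admissible_def by auto
    have z: "norm (a + tm j i *\<^sub>R (b - a)) \<le> ?R" for i
    proof -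
      have "norm (tm j i *\<^sub>R (b - a)) \<le> 1 * norm (b - a)" using a(2)[of i] by (simp add: mult_left_le_one_le)
      then show ?thesis using norm_triangle_ineq[of a "tm j i *\<^sub>R (b - a)"] by linarith
    qed
    have G: "norm (jac_avg f (d (ci j i l)) (rad j i l)) \<le> B" for i l
    proof (rule norm_jac_avg_le[OF f rad_pos B(1)])
      fix y assume y: "norm (y - d (ci j i l)) \<le> rad j i l" "f differentiable (at y)"
      have "norm y \<le> norm (y - d (ci j i l)) + norm (d (ci j i l) - (a + tm j i *\<^sub>R (b - a))) + norm (a + tm j i *\<^sub>R (b - a))"
        using norm_triangle_sub[of y "d (ci j i l)"] norm_triangle_sub[of "d (ci j i l)" "a + tm j i *\<^sub>R (b - a)"]
        by linarith
      also have "\<dots> \<le> ?R + 2" using y(1) a(4)[of i l] a(5)[of i l] z[of i] by linarith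
      finally show "norm (jacobian_at f y) \<le> B" using y(2) by (rule B(2))
    qed
    have vec: "norm (\<chi> i. g i) \<le> ?N * C" if "\<And>i. norm (g i) \<le> C" for g :: "'k \<Rightarrow> 'c::real_normed_vector" and C
    proof -
      have "norm (\<chi> i. g i) \<le> (\<Sum>i\<in>UNIV. norm ((\<chi> i. g i) $ i))" unfolding norm_vec_def by (rule L2_set_le_sum) simp
      also have "\<dots> \<le> ?N * C" using sum_bounded_above[of UNIV "\<lambda>i. norm (g i)" C] that by simp
      finally show ?thesis .
    qed
    have "norm (iw j i l, jac_avg f (d (ci j i l)) (rad j i l)) \<le> 1 + B" for i l
      using norm_Pair_le[of "iw j i l" "jac_avg f (d (ci j i l)) (rad j i l)"] a(3)[of i l] G[of i l] by simp
    then have inner: "norm (\<chi> l. (iw j i l, jac_avg f (d (ci j i l)) (rad j i l))) \<le> ?N * (1 + B)" for i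
      by (rule vec)
    have "norm (wt j i, a + tm j i *\<^sub>R (b - a), \<chi> l. (iw j i l, jac_avg f (d (ci j i l)) (rad j i l))) \<le> 1 + (?R + ?N * (1 + B))" for i
      using norm_Pair_le[of "wt j i" "(a + tm j i *\<^sub>R (b - a), \<chi> l. (iw j i l, jac_avg f (d (ci j i l)) (rad j i l)))"]
        norm_Pair_le[of "a + tm j i *\<^sub>R (b - a)" "\<chi> l. (iw j i l, jac_avg f (d (ci j i l)) (rad j i l))"]
        a(1)[of i] z[of i] inner[of i] by simp
    then show ?thesis unfolding decode_def by (rule vec)
  qed
  then show ?thesis by blast
qed

text \<open>As the tolerance vanishes, the normalisations become exact, and all centres belonging to
  one outer index converge to the same \<open>z\<close>, so the inner combination is formed within
  one Clarke Jacobian.\<close>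

lemma admissible_limit:
  fixes f :: "real^'d \<Rightarrow> real^'n" and js :: "nat \<Rightarrow> 'k::finite code"
  assumes f: "lipschitz_on_balls f" and adm: "\<And>r. admissible d (1 / Suc r) a b (js r)"
    and lim: "(\<lambda>r. decode d f a b (js r)) \<longlonglongrightarrow> T"
  shows "0 \<le> outer_wt T i" "(\<Sum>i\<in>UNIV. outer_wt T i) = 1" "inner_comb T i \<in> clarke_jacobian_seg f a b"
proof -
  have 0: "(\<lambda>r. 1 / real (Suc r)) \<longlonglongrightarrow> 0" using LIMSEQ_inverse_real_of_nat by (simp add: inverse_eq_divide)
  note lim_i = tendsto_vec_nth[OF lim]
  have w: "(\<lambda>r. wt (js r) i) \<longlonglongrightarrow> outer_wt T i" for i
    using tendsto_fst[OF lim_i[of i]] by (simp add: decode_def outer_wt_def)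
  define z where "z = fst (snd (T $ i))"
  have z: "(\<lambda>r. a + tm (js r) i *\<^sub>R (b - a)) \<longlonglongrightarrow> z"
    using tendsto_fst[OF tendsto_snd[OF lim_i[of i]]] by (simp add: decode_def z_def)
  define \<mu> where "\<mu> l = fst (snd (snd (T $ i)) $ l)" for l
  define L where "L l = snd (snd (snd (T $ i)) $ l)" for l
  have \<mu>: "(\<lambda>r. iw (js r) i l) \<longlonglongrightarrow> \<mu> l" for l
    using tendsto_fst[OF tendsto_vec_nth[OF tendsto_snd[OF tendsto_snd[OF lim_i[of i]]], of l]] by (simp add: decode_def \<mu>_def)
  have L: "(\<lambda>r. jac_avg f (d (ci (js r) i l)) (rad (js r) i l)) \<longlonglongrightarrow> L l" for l
    using tendsto_snd[OF tendsto_vec_nth[OF tendsto_snd[OF tendsto_snd[OF lim_i[of i]]], of l]] by (simp add: decode_def L_def)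
  have close: "s = t" if "x \<longlonglongrightarrow> s" "\<And>r. \<bar>x r - t\<bar> < 1 / Suc r" for x :: "nat \<Rightarrow> real" and s t
  proof -
    have "(\<lambda>r. \<bar>x r - t\<bar>) \<longlonglongrightarrow> 0"
      by (rule tendsto_sandwich[OF _ _ tendsto_const 0]) (use that(2) in \<open>auto intro!: always_eventually less_imp_le\<close>)
    then have "(\<lambda>r. x r - t) \<longlonglongrightarrow> 0" by (simp add: tendsto_rabs_zero_iff)
    then have "x \<longlonglongrightarrow> t" by (rule LIM_zero_cancel)
    with that(1) show ?thesis by (rule LIMSEQ_unique)
  qed
  show "0 \<le> outer_wt T i"
    by (rule tendsto_lowerbound[OF w]) (use adm in \<open>auto simp: admissible_def intro!: always_eventually\<close>)
  show "(\<Sum>i\<in>UNIV. outer_wt T i) = 1"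
    by (rule close[OF tendsto_sum[OF w]]) (use adm in \<open>auto simp: admissible_def\<close>)
  have \<mu>0: "0 \<le> \<mu> l" for l
    by (rule tendsto_lowerbound[OF \<mu>]) (use adm in \<open>auto simp: admissible_def intro!: always_eventually\<close>)
  have \<mu>1: "(\<Sum>l\<in>UNIV. \<mu> l) = 1"
    by (rule close[OF tendsto_sum[OF \<mu>]]) (use adm in \<open>auto simp: admissible_def\<close>)
  have zseg: "z \<in> closed_segment a b"
  proof (rule closed_sequentially[OF closed_segment _ z])
    fix r
    have "tm (js r) i \<in> {0..1}" using adm[of r] by (simp add: admissible_def)
    then show "a + tm (js r) i *\<^sub>R (b - a) \<in> closed_segment a b"
      by (auto simp: closed_segment_def algebra_simps intro!: exI[of _ "tm (js r) i"])
  qed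
  have "L l \<in> clarke_jacobian f z" for l
  proof (rule jac_avg_limit_in_clarke_jacobian[OF f L _ _ rad_pos])
    have "(\<lambda>r. norm (d (ci (js r) i l) - (a + tm (js r) i *\<^sub>R (b - a)))) \<longlonglongrightarrow> 0"
      by (rule tendsto_sandwich[OF _ _ tendsto_const 0]) (use adm in \<open>auto simp: admissible_def intro!: always_eventually less_imp_le\<close>)
    then have "(\<lambda>r. d (ci (js r) i l) - (a + tm (js r) i *\<^sub>R (b - a))) \<longlonglongrightarrow> 0" by (rule tendsto_norm_zero_cancel)
    from tendsto_add[OF this z] show "(\<lambda>r. d (ci (js r) i l)) \<longlonglongrightarrow> z" by simp
    show "(\<lambda>r. rad (js r) i l) \<longlonglongrightarrow> 0"
      by (rule tendsto_sandwich[OF _ _ tendsto_const 0])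
        (use adm rad_pos in \<open>auto simp: admissible_def intro!: always_eventually less_imp_le\<close>)
  qed
  then have "(\<Sum>l\<in>UNIV. \<mu> l *\<^sub>R L l) \<in> clarke_jacobian f z"
    unfolding clarke_jacobian_eq using \<mu>0 \<mu>1 by (intro convex_sum convex_convex_hull) auto
  with zseg show "inner_comb T i \<in> clarke_jacobian_seg f a b"
    unfolding clarke_jacobian_seg_def inner_comb_def \<mu>_def L_def by blast
qed

lemma ex_rat_unit_near:
  assumes "y \<in> {0..1::real}" "\<epsilon> > 0"
  shows "\<exists>r::rat. real_of_rat r \<in> {0..1} \<and> \<bar>real_of_rat r - y\<bar> < \<epsilon>"
proof (cases "y < 1")
  case True
  \<comment> \<open>Approximating from above preserves nonnegativity; only \<open>y = 1\<close>
    leaves no room for it.\<close>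
  then obtain r where "y < real_of_rat r" "real_of_rat r < min 1 (y + \<epsilon>)"
    using of_rat_dense[of y "min 1 (y + \<epsilon>)"] assms by auto
  with assms have "0 \<le> real_of_rat r" "real_of_rat r \<le> 1" "\<bar>real_of_rat r - y\<bar> < \<epsilon>"
    unfolding atLeastAtMost_iff by linarith+
  then show ?thesis unfolding atLeastAtMost_iff by blast
next
  case False
  with assms show ?thesis by (intro exI[of _ 1]) auto
qed

text \<open>Caratheodory's theorem is applied to \<open>B\<close> and then to each of its terms;
  afterwards all reals are rounded and the limiting Jacobians replaced by averages.\<close>

lemma admissible_approximation:
  fixes f :: "real^'d \<Rightarrow> real^'n"
  assumes f: "lipschitz_on_balls f" and B: "B \<in> convex hull (clarke_jacobian_seg f a b)"
    and card: "CARD('k::finite) = CARD('n) * CARD('d) + 1"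
    and dense: "\<And>x r. r > 0 \<Longrightarrow> \<exists>c\<in>range d. norm (c - x) < r"
  shows "\<exists>js :: nat \<Rightarrow> 'k code. (\<forall>\<epsilon>>0. \<forall>\<^sub>F r in sequentially. admissible d \<epsilon> a b (js r)) \<and>
           (\<lambda>r. comb_value (decode d f a b (js r))) \<longlonglongrightarrow> B"
proof -
  \<comment> \<open>Both levels combine matrices of the same space, so one index type serves for
    both.\<close>
  have card': "CARD('k) = DIM(real^'d^'n) + 1" using card by (simp add: mult.commute)
  obtain \<nu> A where A: "\<And>i::'k. 0 \<le> \<nu> i \<and> \<nu> i \<le> 1 \<and> A i \<in> clarke_jacobian_seg f a b"
    and \<nu>1: "sum \<nu> UNIV = 1" and BA: "B = (\<Sum>i\<in>UNIV. \<nu> i *\<^sub>R A i)"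
    using convex_hull_indexed_caratheodory[OF B card'] by blast
  have "\<forall>i. \<exists>t. t \<in> {0..1} \<and> A i \<in> convex hull (lim_jacobians f {a + t *\<^sub>R (b - a)})"
  proof
    fix i
    obtain z where z: "z \<in> closed_segment a b" "A i \<in> clarke_jacobian f z"
      using A unfolding clarke_jacobian_seg_def by blast
    then obtain t where t: "0 \<le> t" "t \<le> 1" "z = (1 - t) *\<^sub>R a + t *\<^sub>R b" by (auto simp: closed_segment_def)
    then have "z = a + t *\<^sub>R (b - a)" by (simp add: algebra_simps)
    with z t show "\<exists>t. t \<in> {0..1} \<and> A i \<in> convex hull (lim_jacobians f {a + t *\<^sub>R (b - a)})"
      unfolding clarke_jacobian_eq by auto
  qed
  then obtain t where t: "\<And>i. t i \<in> {0..1}" "\<And>i. A i \<in> convex hull (lim_jacobians f {a + t i *\<^sub>R (b - a)})" by metis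
  define R where "R i \<mu> s \<longleftrightarrow> (\<forall>l. 0 \<le> \<mu> l \<and> \<mu> l \<le> 1 \<and> s l \<in> lim_jacobians f {a + t i *\<^sub>R (b - a)}) \<and>
      sum \<mu> UNIV = 1 \<and> A i = (\<Sum>l\<in>UNIV. \<mu> l *\<^sub>R s l)" for i and \<mu> :: "'k \<Rightarrow> real" and s
  have "\<forall>i. \<exists>\<mu> s. R i \<mu> s"
    unfolding R_def using convex_hull_indexed_caratheodory[OF t(2) card'] by blast
  then obtain \<mu> J where R: "\<And>i. R i (\<mu> i) (J i)" by metis
  then have J: "\<And>i l. 0 \<le> \<mu> i l \<and> \<mu> i l \<le> 1 \<and> J i l \<in> lim_jacobians f {a + t i *\<^sub>R (b - a)}"
    and \<mu>1: "\<And>i. sum (\<mu> i) UNIV = 1" and AJ: "\<And>i. A i = (\<Sum>l\<in>UNIV. \<mu> i l *\<^sub>R J i l)"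
    unfolding R_def by blast+
  have pos: "1 / real (Suc r) > 0" for r by simp
  have "\<forall>r i. \<exists>p::rat. real_of_rat p \<in> {0..1} \<and> \<bar>real_of_rat p - \<nu> i\<bar> < 1 / Suc r"
    using A by (intro allI ex_rat_unit_near) auto
  then obtain W where W: "\<And>r i. real_of_rat (W r i) \<in> {0..1} \<and> \<bar>real_of_rat (W r i) - \<nu> i\<bar> < 1 / Suc r" by metis
  have "\<forall>r i. \<exists>p::rat. real_of_rat p \<in> {0..1} \<and> \<bar>real_of_rat p - t i\<bar> < 1 / Suc r"
    using t(1) by (intro allI ex_rat_unit_near) auto
  then obtain Q where Q: "\<And>r i. real_of_rat (Q r i) \<in> {0..1} \<and> \<bar>real_of_rat (Q r i) - t i\<bar> < 1 / Suc r" by metis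
  have "\<forall>r i l. \<exists>p::rat. real_of_rat p \<in> {0..1} \<and> \<bar>real_of_rat p - \<mu> i l\<bar> < 1 / Suc r"
    using J by (intro allI ex_rat_unit_near) auto
  then obtain I where I: "\<And>r i l. real_of_rat (I r i l) \<in> {0..1} \<and> \<bar>real_of_rat (I r i l) - \<mu> i l\<bar> < 1 / Suc r" by metis
  have "\<forall>r i l. \<exists>c n. norm (d c - (a + t i *\<^sub>R (b - a))) < 1 / Suc r \<and> 1 / real (Suc n) < 1 / Suc r \<and>
      norm (jac_avg f (d c) (1 / real (Suc n)) - J i l) < 1 / Suc r"
  proof (intro allI)
    fix r i l
    have "\<exists>c\<in>range d. \<exists>n::nat. norm (c - (a + t i *\<^sub>R (b - a))) < 1 / Suc r \<and> 1 / Suc n < 1 / real (Suc r) \<and>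
        norm (jac_avg f c (1 / Suc n) - J i l) < 1 / Suc r"
      using J[of i l] by (intro jac_avg_approximates[OF f _ pos dense]) auto
    then show "\<exists>c n. norm (d c - (a + t i *\<^sub>R (b - a))) < 1 / Suc r \<and> 1 / real (Suc n) < 1 / Suc r \<and>
      norm (jac_avg f (d c) (1 / real (Suc n)) - J i l) < 1 / Suc r" by blast
  qed
  then obtain c n where cn: "\<And>r i l. norm (d (c r i l) - (a + t i *\<^sub>R (b - a))) < 1 / Suc r"
    "\<And>r i l. 1 / real (Suc (n r i l)) < 1 / Suc r"
    "\<And>r i l. norm (jac_avg f (d (c r i l)) (1 / real (Suc (n r i l))) - J i l) < 1 / Suc r" by metis
  define js :: "nat \<Rightarrow> 'k code" where "js r i = (W r i, Q r i, \<lambda>l. (I r i l, c r i l, n r i l))" for r i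
  have js: "wt (js r) i = real_of_rat (W r i)" "tm (js r) i = real_of_rat (Q r i)" "iw (js r) i l = real_of_rat (I r i l)"
    "ci (js r) i l = c r i l" "rad (js r) i l = 1 / real (Suc (n r i l))" for r i l
    by (simp_all add: js_def wt_def tm_def iw_def ci_def rad_def)
  have 0: "(\<lambda>r. 1 / real (Suc r)) \<longlonglongrightarrow> 0" using LIMSEQ_inverse_real_of_nat by (simp add: inverse_eq_divide)
  have conv: "x \<longlonglongrightarrow> s" if "\<And>r. norm (x r - s) < 1 / Suc r" for x :: "nat \<Rightarrow> 'c::real_normed_vector" and s
  proof -
    have "(\<lambda>r. norm (x r - s)) \<longlonglongrightarrow> 0"
      by (rule tendsto_sandwich[OF _ _ tendsto_const 0]) (use that in \<open>auto intro!: always_eventually less_imp_le\<close>)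
    then show ?thesis by (rule LIM_zero_cancel[OF tendsto_norm_zero_cancel])
  qed
  have W': "(\<lambda>r. wt (js r) i) \<longlonglongrightarrow> \<nu> i" for i unfolding js by (rule conv) (use W in auto)
  have Q': "(\<lambda>r. tm (js r) i) \<longlonglongrightarrow> t i" for i unfolding js by (rule conv) (use Q in auto)
  have I': "(\<lambda>r. iw (js r) i l) \<longlonglongrightarrow> \<mu> i l" for i l unfolding js by (rule conv) (use I in auto)
  have c': "(\<lambda>r. d (ci (js r) i l)) \<longlonglongrightarrow> a + t i *\<^sub>R (b - a)" for i l unfolding js by (rule conv) (use cn in auto)
  have G': "(\<lambda>r. jac_avg f (d (ci (js r) i l)) (rad (js r) i l)) \<longlonglongrightarrow> J i l" for i l unfolding js by (rule conv) (use cn in auto)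
  have n': "(\<lambda>r. rad (js r) i l) \<longlonglongrightarrow> 0" for i l unfolding js
    by (rule conv) (use cn(2) in \<open>simp del: of_nat_Suc\<close>)
  have "(\<lambda>r. \<Sum>l\<in>UNIV. iw (js r) i l) \<longlonglongrightarrow> (\<Sum>l\<in>UNIV. \<mu> i l)" for i by (intro tendsto_sum I')
  then have I_sum: "(\<lambda>r. \<Sum>l\<in>UNIV. iw (js r) i l) \<longlonglongrightarrow> 1" for i by (simp add: \<mu>1)
  have "(\<lambda>r. \<Sum>i\<in>UNIV. wt (js r) i) \<longlonglongrightarrow> (\<Sum>i\<in>UNIV. \<nu> i)" by (intro tendsto_sum W')
  then have W_sum: "(\<lambda>r. \<Sum>i\<in>UNIV. wt (js r) i) \<longlonglongrightarrow> 1" by (simp add: \<nu>1)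
  have "\<forall>\<^sub>F r in sequentially. admissible d \<epsilon> a b (js r)" if \<epsilon>: "\<epsilon> > 0" for \<epsilon>
    unfolding admissible_def
  proof (intro eventually_conj eventually_all_finite)
    fix i l :: 'k
    show "\<forall>\<^sub>F r in sequentially. wt (js r) i \<in> {0..1}" "\<forall>\<^sub>F r in sequentially. tm (js r) i \<in> {0..1}"
      "\<forall>\<^sub>F r in sequentially. iw (js r) i l \<in> {0..1}" unfolding js using W Q I by simp_all
    have "(\<lambda>r. d (ci (js r) i l) - (a + tm (js r) i *\<^sub>R (b - a))) \<longlonglongrightarrow> (a + t i *\<^sub>R (b - a)) - (a + t i *\<^sub>R (b - a))"
      by (intro tendsto_intros c' Q')
    from tendstoD[OF this \<epsilon>]
    show "\<forall>\<^sub>F r in sequentially. norm (d (ci (js r) i l) - (a + tm (js r) i *\<^sub>R (b - a))) < \<epsilon>" by (simp add: dist_norm)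
    show "\<forall>\<^sub>F r in sequentially. rad (js r) i l < \<epsilon>" using order_tendstoD(2)[OF n' \<epsilon>] .
    show "\<forall>\<^sub>F r in sequentially. \<bar>(\<Sum>l\<in>UNIV. iw (js r) i l) - 1\<bar> < \<epsilon>"
      using tendstoD[OF I_sum[of i] \<epsilon>] by (simp add: dist_real_def)
    show "\<forall>\<^sub>F r in sequentially. \<bar>(\<Sum>i\<in>UNIV. wt (js r) i) - 1\<bar> < \<epsilon>"
      using tendstoD[OF W_sum \<epsilon>] by (simp add: dist_real_def)
  qed
  moreover have "(\<lambda>r. comb_value (decode d f a b (js r))) \<longlonglongrightarrow> B"
    unfolding BA AJ comb_value_def outer_wt_def inner_comb_def decode_def by (simp, intro tendsto_intros W' I' G')
  ultimately show ?thesis by blast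
qed

text \<open>The real function \<open>\<psi>\<close> encodes the equation to be solved. Exact
  solvability at \<open>x\<close> provides codes that solve it up to any tolerance, and continuity
  makes it exact at the selected cluster point.\<close>

lemma clarke_measurable_selection:
  fixes H :: "'a \<Rightarrow> real^'d \<Rightarrow> real^'n" and \<psi> :: "'a \<Rightarrow> real^'d^'n \<Rightarrow> real"
  assumes H: "(\<lambda>(x, z). H x z) \<in> borel_measurable (M \<Otimes>\<^sub>M borel)"
    and lip: "\<And>x. x \<in> S \<Longrightarrow> lipschitz_on_balls (H x)"
    and u[measurable]: "u \<in> borel_measurable M" and v[measurable]: "v \<in> borel_measurable M"
    and \<psi>_meas: "\<And>B. B \<in> borel_measurable M \<Longrightarrow> (\<lambda>x. \<psi> x (B x)) \<in> borel_measurable M"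
    and \<psi>_cont: "\<And>x B. x \<in> S \<Longrightarrow> isCont (\<psi> x) B"
    and sol: "\<And>x. x \<in> S \<Longrightarrow> \<exists>B\<in>convex hull (clarke_jacobian_seg (H x) (u x) (v x)). \<psi> x B = 0"
    and card: "CARD('k::finite) = CARD('n) * CARD('d) + 1"
  shows "\<exists>(lam :: 'k \<Rightarrow> 'a \<Rightarrow> real) As. (\<forall>i. lam i \<in> borel_measurable M \<and> As i \<in> borel_measurable M) \<and>
    (\<forall>x\<in>S. (\<forall>i. 0 \<le> lam i x \<and> As i x \<in> clarke_jacobian_seg (H x) (u x) (v x)) \<and>
      (\<Sum>i\<in>UNIV. lam i x) = 1 \<and> \<psi> x (\<Sum>i\<in>UNIV. lam i x *\<^sub>R As i x) = 0)"
proof -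
  obtain D :: "(real^'d) set" where D: "countable D" "\<forall>U. open U \<longrightarrow> U \<noteq> {} \<longrightarrow> (\<exists>y\<in>D. y \<in> U)"
    using countable_dense_exists[where 'a = "real^'d"] by auto
  have "D \<noteq> {}" using D(2)[rule_format, of UNIV] by auto
  define d where "d = from_nat_into D"
  have dense: "\<exists>c\<in>range d. norm (c - x) < r" if r: "r > 0" for x r
  proof -
    obtain c where "c \<in> D" "c \<in> ball x r" using D(2)[rule_format, of "ball x r"] r by auto
    then show ?thesis using range_from_nat_into[OF \<open>D \<noteq> {}\<close> D(1)]
      by (intro bexI[of _ c]) (auto simp: d_def dist_norm norm_minus_commute)
  qed
  define X where "X j x = decode d (H x) (u x) (v x) j" for j :: "'k code" and x
  \<comment> \<open>The requirement on \<open>\<psi>\<close> is part of the selection criterion, so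
    the cluster points to choose from all solve the equation.\<close>
  define P where "P k j x \<longleftrightarrow> admissible d (1 / Suc k) (u x) (v x) j \<and> \<bar>\<psi> x (comb_value (X j x))\<bar> < 1 / Suc k"
    for k :: nat and j :: "'k code" and x
  have pair: "(\<lambda>x. (g x, h x)) \<in> borel_measurable M"
    if "g \<in> borel_measurable M" "h \<in> borel_measurable M"
    for g :: "'a \<Rightarrow> 'e::euclidean_space" and h :: "'a \<Rightarrow> 'g::euclidean_space"
    using that by (rule borel_measurable_Pair)
  have X[measurable]: "X j \<in> borel_measurable M" for j
    unfolding X_def[abs_def] decode_def
    by (intro borel_measurable_vec_lambda pair borel_measurable_jac_avg_param[OF H]) measurable
  have cont_meas: "(\<lambda>x. F (g x)) \<in> borel_measurable M" if "\<And>T. isCont F T" "g \<in> borel_measurable M"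
    for F :: "('d, 'n, 'k) comb \<Rightarrow> 'e::euclidean_space" and g
    by (rule measurable_compose[OF that(2) borel_measurable_continuous_onI])
      (simp add: continuous_at_imp_continuous_on that(1))
  have [measurable]: "(\<lambda>x. \<psi> x (comb_value (X j x))) \<in> borel_measurable M" for j
    by (rule \<psi>_meas[OF cont_meas[OF isCont_comb_value X]])
  have P: "Measurable.pred M (P k j)" for k j
    unfolding P_def[abs_def] admissible_def by measurable
  have "\<exists>g. g \<in> borel_measurable M \<and> (\<forall>x\<in>S. \<forall>k. \<forall>\<epsilon>>0. \<exists>j. P k j x \<and> dist (X j x) (g x) < \<epsilon>)"
  proof (rule measurable_selection[OF X P])
    fix k j x assume "P (Suc k) j x"
    moreover have "1 / real (Suc (Suc k)) \<le> 1 / real (Suc k)" by (simp add: frac_le)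
    ultimately show "P k j x" unfolding P_def using admissible_mono by (meson order_less_le_trans)
  next
    fix k x assume x: "x \<in> S"
    obtain B where B: "B \<in> convex hull (clarke_jacobian_seg (H x) (u x) (v x))" "\<psi> x B = 0" using sol[OF x] by blast
    obtain js :: "nat \<Rightarrow> 'k code" where js: "\<And>\<epsilon>. \<epsilon> > 0 \<Longrightarrow> \<forall>\<^sub>F r in sequentially. admissible d \<epsilon> (u x) (v x) (js r)"
      "(\<lambda>r. comb_value (X (js r) x)) \<longlonglongrightarrow> B"
      using admissible_approximation[OF lip[OF x] B(1) card dense] unfolding X_def by blast
    have "(\<lambda>r. \<psi> x (comb_value (X (js r) x))) \<longlonglongrightarrow> 0"
      using isCont_tendsto_compose[OF \<psi>_cont[OF x] js(2)] B(2) by simp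
    from tendstoD[OF this, of "1 / Suc k"] js(1)[of "1 / Suc k"]
    have "\<forall>\<^sub>F r in sequentially. P k (js r) x" unfolding P_def by (simp add: eventually_conj_iff)
    then show "\<exists>j. P k j x" by (auto simp: eventually_sequentially)
  next
    fix x assume x: "x \<in> S"
    obtain B where "\<And>j :: 'k code. admissible d 1 (u x) (v x) j \<Longrightarrow> norm (X j x) \<le> B"
      using decode_bounded[OF lip[OF x]] unfolding X_def by blast
    then show "\<exists>B. \<forall>j. P 0 j x \<longrightarrow> norm (X j x) \<le> B" by (intro exI[of _ B]) (simp add: P_def)
  qed
  then obtain g where g: "g \<in> borel_measurable M"
    and near: "\<And>x k \<epsilon>. \<lbrakk>x \<in> S; \<epsilon> > 0\<rbrakk> \<Longrightarrow> \<exists>j. P k j x \<and> dist (X j x) (g x) < \<epsilon>" by blast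
  have "(\<forall>i. 0 \<le> outer_wt (g x) i \<and> inner_comb (g x) i \<in> clarke_jacobian_seg (H x) (u x) (v x)) \<and>
      (\<Sum>i\<in>UNIV. outer_wt (g x) i) = 1 \<and> \<psi> x (comb_value (g x)) = 0" if x: "x \<in> S" for x
  proof -
    \<comment> \<open>Taking level and distance together to 0 yields codes of vanishing tolerance
      whose combinations converge to \<open>g x\<close>.\<close>
    have "\<forall>r. \<exists>j. P r j x \<and> dist (X j x) (g x) < 1 / Suc r" using near[OF x] by simp
    then obtain js where js: "\<And>r. P r (js r) x" "\<And>r. dist (X (js r) x) (g x) < 1 / Suc r" by metis
    have 0: "(\<lambda>r. 1 / real (Suc r)) \<longlonglongrightarrow> 0" using LIMSEQ_inverse_real_of_nat by (simp add: inverse_eq_divide)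
    have "(\<lambda>r. dist (X (js r) x) (g x)) \<longlonglongrightarrow> 0"
      by (rule tendsto_sandwich[OF _ _ tendsto_const 0]) (use js(2) in \<open>auto intro!: always_eventually less_imp_le\<close>)
    then have lim: "(\<lambda>r. X (js r) x) \<longlonglongrightarrow> g x" by (rule tendsto_dist_iff[THEN iffD2])
    have adm: "admissible d (1 / Suc r) (u x) (v x) (js r)" for r using js(1)[of r] by (simp add: P_def)
    have "(\<lambda>r. \<psi> x (comb_value (X (js r) x))) \<longlonglongrightarrow> \<psi> x (comb_value (g x))"
      by (rule isCont_tendsto_compose[OF \<psi>_cont[OF x] isCont_tendsto_compose[OF isCont_comb_value lim]])
    moreover have "(\<lambda>r. \<bar>\<psi> x (comb_value (X (js r) x))\<bar>) \<longlonglongrightarrow> 0"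
      by (rule tendsto_sandwich[OF _ _ tendsto_const 0]) (use js(1) in \<open>auto simp: P_def intro!: always_eventually less_imp_le\<close>)
    then have "(\<lambda>r. \<psi> x (comb_value (X (js r) x))) \<longlonglongrightarrow> 0" by (simp add: tendsto_rabs_zero_iff)
    ultimately have "\<psi> x (comb_value (g x)) = 0" by (rule LIMSEQ_unique)
    with admissible_limit[OF lip[OF x] adm lim[unfolded X_def]] show ?thesis by blast
  qed
  moreover have "(\<lambda>x. outer_wt (g x) i) \<in> borel_measurable M" "(\<lambda>x. inner_comb (g x) i) \<in> borel_measurable M" for i
    using cont_meas[OF isCont_outer_wt g] cont_meas[OF isCont_inner_comb g] by blast+
  ultimately show ?thesis unfolding comb_value_def
    by (intro exI[of _ "\<lambda>i x. outer_wt (g x) i"] exI[of _ "\<lambda>i x. inner_comb (g x) i"]) blast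
qed

section \<open>The superposition operator\<close>

lemma locally_lipschitz_imp_lipschitz_on_balls:
  fixes f :: "'a::euclidean_space \<Rightarrow> 'b::metric_space"
  assumes "\<And>z. \<exists>e>0. \<exists>L. L-lipschitz_on (ball z e) f"
  shows "lipschitz_on_balls f"
  unfolding lipschitz_on_balls_def
proof
  fix R
  \<comment> \<open>The time parameter is a single dummy point; compactness of the ball turns local
    constants into one.\<close>
  have "local_lipschitz {0::real} (cball 0 R) (\<lambda>_. f)"
  proof (rule local_lipschitzI)
    fix x :: 'a
    obtain e L where e: "e > 0" "L-lipschitz_on (ball x e) f" using assms by blast
    have "L-lipschitz_on (cball x (e / 2) \<inter> cball 0 R) f"
      by (rule lipschitz_on_subset[OF e(2)]) (use e in auto)
    with e show "\<exists>u>0. \<exists>L. \<forall>t\<in>cball t u \<inter> {0}. L-lipschitz_on (cball x u \<inter> cball 0 R) f" for t :: real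
      by (intro exI[of _ "e / 2"]) auto
  qed
  then obtain L where "\<And>t. t \<in> {0::real} \<Longrightarrow> L-lipschitz_on (cball 0 R) f"
    by (rule local_lipschitz_compact_implies_lipschitz) auto
  then show "\<exists>L. L-lipschitz_on (cball 0 R) f" by blast
qed

lemma borel_measurable_matrix_vector_mult:
  fixes B :: "'a \<Rightarrow> real^'d^'n"
  assumes "B \<in> borel_measurable M" "w \<in> borel_measurable M"
  shows "(\<lambda>x. B x *v w x) \<in> borel_measurable M"
  unfolding matrix_vector_mult_def
  by (intro borel_measurable_vec_lambda borel_measurable_sum borel_measurable_times borel_measurable_vec_nth assms)

lemma borel_measurable_superposition:
  assumes H: "(\<lambda>(x, z). H x z) \<in> borel_measurable (M \<Otimes>\<^sub>M borel)" and "u \<in> borel_measurable M"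
  shows "(\<lambda>x. H x (u x)) \<in> borel_measurable M"
  using measurable_compose[OF _ H, of "\<lambda>x. (x, u x)" M] assms(2) by simp

lemma npow_mono: "\<lbrakk>0 \<le> s; s \<le> t; 0 \<le> a\<rbrakk> \<Longrightarrow> npow s a \<le> npow t a"
  by (auto simp: npow_def intro: powr_mono2)

lemma norm_convex_combination_le:
  fixes J :: "'k::finite \<Rightarrow> 'b::real_normed_vector"
  assumes "\<And>i. 0 \<le> l i" "(\<Sum>i\<in>UNIV. l i) = 1" "\<And>i. norm (J i) \<le> K"
  shows "norm (\<Sum>i\<in>UNIV. l i *\<^sub>R J i) \<le> K"
proof -
  have "norm (\<Sum>i\<in>UNIV. l i *\<^sub>R J i) \<le> (\<Sum>i\<in>UNIV. l i * K)"
    using assms by (intro sum_norm_le) (auto intro: mult_left_mono)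
  also have "\<dots> = K" using assms(2) by (simp flip: sum_distrib_right)
  finally show ?thesis .
qed

text \<open>With \<open>s = p / q - 1\<close> and \<open>r = p * q / (p - q)\<close> one has
  \<open>s * r = p\<close>, so the growth of order \<open>s\<close> allowed for Jacobians becomes
  integrable when raised to the power \<open>r\<close>.\<close>

lemma powr_growth_bound:
  fixes C m p q :: real
  assumes C: "C > 0" and q: "1 < q" "q < p" and y: "0 \<le> y" "y \<le> C * (1 + npow m (p / q - 1))"
    and m: "m = max a b" "0 \<le> a" "0 \<le> b"
  shows "y powr (p * q / (p - q)) \<le> (2 * C) powr (p * q / (p - q)) * (1 + (a powr p + b powr p))"
proof -
  define r where "r = p * q / (p - q)"
  define s where "s = p / q - 1"
  have r: "r > 0" using q by (simp add: r_def)
  have s: "s > 0" using q by (simp add: s_def)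
  have "s * r = p" using q by (simp add: s_def r_def field_simps)
  \<comment> \<open>Both summands of the growth bound are at most \<open>t\<close>, so the power
    \<open>r\<close> is applied to a product instead of a sum.\<close>
  define t where "t = max 1 (m powr s)"
  have "y \<le> C * (1 + m powr s)" using y(2) s unfolding s_def[symmetric] by (simp add: npow_def)
  also have "\<dots> \<le> C * (2 * t)" using C by (intro mult_left_mono) (auto simp: t_def)
  finally have "y powr r \<le> (C * (2 * t)) powr r" using r y(1) by (intro powr_mono2) auto
  also have "\<dots> = (2 * C) powr r * t powr r" using C by (simp add: powr_mult t_def mult_ac)
  also have "t powr r \<le> 1 + (a powr p + b powr p)"
  proof (cases "m powr s \<le> 1")
    case True
    then have "t = 1" by (simp add: t_def)
    then show ?thesis by simp
  next
    case False
    then have "t powr r = m powr p" by (simp add: t_def powr_powr \<open>s * r = p\<close>)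
    also have "m powr p \<le> a powr p + b powr p" using m(1) by (simp add: max_def)
    finally show ?thesis by simp
  qed
  finally show ?thesis using C by (simp add: r_def mult_left_mono)
qed

lemma growth_bound_in_Lr_set:
  fixes A :: "'a \<Rightarrow> 'b::{real_normed_vector, second_countable_topology}"
  assumes fin: "finite_measure M" and C: "C > 0" and pq: "1 < q" "q \<le> p"
    and u: "u \<in> Lp_set M p" and v: "v \<in> Lp_set M p" and A[measurable]: "A \<in> borel_measurable M"
    and bound: "\<And>x. x \<in> space M \<Longrightarrow> norm (A x) \<le> C * (1 + npow (max (norm (u x)) (norm (v x))) (p / q - 1))"
  shows "A \<in> Lr_set M p q"
proof (cases "q < p")
  case True
  let ?r = "p * q / (p - q)"
  have int: "integrable M (\<lambda>x. norm (u x) powr p)" "integrable M (\<lambda>x. norm (v x) powr p)"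
    using u v by (auto simp: Lp_set_def)
  have "integrable M (\<lambda>x. norm (A x) powr ?r)"
  proof (rule Bochner_Integration.integrable_bound)
    show "integrable M (\<lambda>x. (2 * C) powr ?r * (1 + (norm (u x) powr p + norm (v x) powr p)))"
      using int fin by (intro integrable_mult_right Bochner_Integration.integrable_add finite_measure.integrable_const)
    show "AE x in M. norm (norm (A x) powr ?r) \<le> norm ((2 * C) powr ?r * (1 + (norm (u x) powr p + norm (v x) powr p)))"
    proof (rule AE_I2)
      fix x assume x: "x \<in> space M"
      have "norm (A x) powr ?r \<le> (2 * C) powr ?r * (1 + (norm (u x) powr p + norm (v x) powr p))"
        by (rule powr_growth_bound[OF C pq(1) True norm_ge_zero bound[OF x] refl norm_ge_zero norm_ge_zero])
      then show "norm (norm (A x) powr ?r) \<le> norm ((2 * C) powr ?r * (1 + (norm (u x) powr p + norm (v x) powr p)))"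
        by simp
    qed
  qed measurable
  with True show ?thesis by (simp add: Lr_set_def Lp_set_def)
next
  case False
  \<comment> \<open>This is the case \<open>p = q\<close>; by the convention in \<open>npow\<close>
    the growth term is then 1 even where both functions vanish.\<close>
  with pq have "p / q - 1 = 0" by simp
  then have "AE x in M. norm (A x) \<le> C * 2" using bound by (intro AE_I2) (simp add: npow_def)
  with False show ?thesis by (auto simp: Lr_set_def Linf_set_def)
qed

theorem mainTheorem11:
  fixes M :: "'a measure" and H :: "'a \<Rightarrow> real^'d \<Rightarrow> real^'n"
    and p q C\<^sub>H :: real
  assumes fin: "finite_measure M" and compl: "complete_measure M"
    and pq: "1 < q" "q \<le> p"
    and N1_meas: "(\<lambda>(x, z). H x z) \<in> borel_measurable (M \<Otimes>\<^sub>M borel)"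
    and N1_lip: "\<forall>x\<in>space M. \<forall>z. \<exists>e>0. \<exists>L. L-lipschitz_on (ball z e) (H x)"
    and CH: "C\<^sub>H > 0"
    and N2_H: "\<forall>x\<in>space M. \<forall>z. norm (H x z) \<le> C\<^sub>H * (1 + npow (norm z) (p / q))"
    and N2_J: "\<forall>x\<in>space M. \<forall>z. \<forall>J\<in>clarke_jacobian (H x) z.
                 norm J \<le> C\<^sub>H * (1 + npow (norm z) (p / q - 1))"
  shows "(\<forall>u\<in>Lp_set M p. \<forall>v\<in>Lp_set M p. \<exists>A\<in>Theta M p q H u v.
            AE x in M. H x (u x) - H x (v x) = A x *v (u x - v x))
       \<and> (\<forall>u\<in>Lp_set M p. \<forall>v\<in>Lp_set M p. \<forall>A\<in>Theta M p q H u v.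
            (AE x in M. H x (u x) - H x (v x) = A x *v (u x - v x)) \<longrightarrow>
            (\<exists>(lam :: nat \<Rightarrow> 'a \<Rightarrow> real) (As :: nat \<Rightarrow> 'a \<Rightarrow> real^'d^'n).
               (\<forall>i < CARD('n) * CARD('d) + 1.
                  lam i \<in> borel_measurable M \<and> (\<forall>x\<in>space M. lam i x \<in> {0..1}) \<and>
                  As i \<in> borel_measurable M \<and>
                  (AE x in M. As i x \<in> clarke_jacobian_seg (H x) (u x) (v x))) \<and>
               (\<forall>x\<in>space M. (\<Sum>i<CARD('n) * CARD('d) + 1. lam i x) = 1) \<and>
               (AE x in M. A x = (\<Sum>i<CARD('n) * CARD('d) + 1. lam i x *\<^sub>R As i x))))"
proof -
  have lip: "lipschitz_on_balls (H x)" if "x \<in> space M" for x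
    using N1_lip that by (intro locally_lipschitz_imp_lipschitz_on_balls) blast
  \<comment> \<open>\<open>option\<close> supplies the additional index of Caratheodory's
    theorem.\<close>
  have card: "CARD(('n \<times> 'd) option) = CARD('n) * CARD('d) + 1" by simp
  have increment: "\<exists>A\<in>Theta M p q H u v. AE x in M. H x (u x) - H x (v x) = A x *v (u x - v x)"
    if u: "u \<in> Lp_set M p" and v: "v \<in> Lp_set M p" for u v :: "'a \<Rightarrow> real^'d"
  proof -
    from u v have [measurable]: "u \<in> borel_measurable M" "v \<in> borel_measurable M" by (auto simp: Lp_set_def)
    \<comment> \<open>Taking the norm turns the vector equation into the vanishing of one real
      function.\<close>
    let ?\<psi> = "\<lambda>x B. norm (B *v (u x - v x) - (H x (u x) - H x (v x)))"
    have "\<exists>(lam :: ('n \<times> 'd) option \<Rightarrow> 'a \<Rightarrow> real) As. (\<forall>i. lam i \<in> borel_measurable M \<and> As i \<in> borel_measurable M) \<and>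
      (\<forall>x\<in>space M. (\<forall>i. 0 \<le> lam i x \<and> As i x \<in> clarke_jacobian_seg (H x) (u x) (v x)) \<and>
        (\<Sum>i\<in>UNIV. lam i x) = 1 \<and> ?\<psi> x (\<Sum>i\<in>UNIV. lam i x *\<^sub>R As i x) = 0)"
    proof (rule clarke_measurable_selection[OF N1_meas lip _ _ _ _ _ card])
      fix B :: "'a \<Rightarrow> real^'d^'n" assume B: "B \<in> borel_measurable M"
      have [measurable]: "(\<lambda>x. B x *v (u x - v x)) \<in> borel_measurable M"
        by (rule borel_measurable_matrix_vector_mult[OF B]) measurable
      have [measurable]: "(\<lambda>x. H x (u x)) \<in> borel_measurable M" "(\<lambda>x. H x (v x)) \<in> borel_measurable M"
        by (intro borel_measurable_superposition[OF N1_meas]; measurable)+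
      show "(\<lambda>x. ?\<psi> x (B x)) \<in> borel_measurable M" by measurable
    next
      fix x and B :: "real^'d^'n"
      show "isCont (?\<psi> x) B"
        by (intro continuous_intros bounded_linear.isCont[OF bounded_linear_matrix_vector_mult_left])
    next
      fix x assume "x \<in> space M"
      then obtain B where B: "B \<in> convex hull (clarke_jacobian_seg (H x) (u x) (v x))"
        "H x (v x) - H x (u x) = B *v (v x - u x)" using mean_value_clarke[OF lip] by blast
      have "B *v (u x - v x) = - (B *v (v x - u x))" by (simp add: matrix_vector_mult_diff_distrib)
      also have "\<dots> = H x (u x) - H x (v x)" by (simp flip: B(2))
      finally show "\<exists>B\<in>convex hull (clarke_jacobian_seg (H x) (u x) (v x)). ?\<psi> x B = 0" using B(1) by auto
    qed auto
    then obtain lam :: "('n \<times> 'd) option \<Rightarrow> 'a \<Rightarrow> real" and As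
      where meas[measurable]: "\<And>i. lam i \<in> borel_measurable M" "\<And>i. As i \<in> borel_measurable M"
        and sel: "\<And>x. x \<in> space M \<Longrightarrow> (\<forall>i. 0 \<le> lam i x \<and> As i x \<in> clarke_jacobian_seg (H x) (u x) (v x)) \<and>
        (\<Sum>i\<in>UNIV. lam i x) = 1 \<and> ?\<psi> x (\<Sum>i\<in>UNIV. lam i x *\<^sub>R As i x) = 0"
      by blast
    define A where "A x = (\<Sum>i\<in>UNIV. lam i x *\<^sub>R As i x)" for x
    have A: "A \<in> borel_measurable M" unfolding A_def[abs_def] by measurable
    have "A x \<in> convex hull (clarke_jacobian_seg (H x) (u x) (v x))" if "x \<in> space M" for x
      unfolding A_def using sel[OF that] by (intro convex_sum convex_convex_hull) (auto intro: hull_inc)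
    moreover have "A \<in> Lr_set M p q"
    proof (rule growth_bound_in_Lr_set[OF fin CH pq u v A])
      fix x assume x: "x \<in> space M"
      show "norm (A x) \<le> C\<^sub>H * (1 + npow (max (norm (u x)) (norm (v x))) (p / q - 1))"
        unfolding A_def
      proof (rule norm_convex_combination_le)
        fix i
        obtain z where z: "z \<in> closed_segment (u x) (v x)" "As i x \<in> clarke_jacobian (H x) z"
          using sel[OF x] unfolding clarke_jacobian_seg_def by blast
        have "norm (As i x) \<le> C\<^sub>H * (1 + npow (norm z) (p / q - 1))" using N2_J x z(2) by blast
        also have "\<dots> \<le> C\<^sub>H * (1 + npow (max (norm (u x)) (norm (v x))) (p / q - 1))"
        \<comment> \<open>The point \<open>z\<close> depends on \<open>i\<close> and
          \<open>x\<close>; the ball through the endpoint of larger norm contains the whole segment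
          and removes it from the bound.\<close>
        proof (intro mult_left_mono add_left_mono npow_mono)
          have "closed_segment (u x) (v x) \<subseteq> cball 0 (max (norm (u x)) (norm (v x)))"
            by (intro closed_segment_subset) auto
          with z(1) show "norm z \<le> max (norm (u x)) (norm (v x))" by auto
        qed (use CH pq in auto)
        finally show "norm (As i x) \<le> C\<^sub>H * (1 + npow (max (norm (u x)) (norm (v x))) (p / q - 1))" .
      qed (use sel[OF x] in auto)
    qed
    ultimately have "A \<in> Theta M p q H u v" by (auto simp: Theta_def)
    moreover have "AE x in M. H x (u x) - H x (v x) = A x *v (u x - v x)"
      using sel by (intro AE_I2) (simp add: A_def)
    ultimately show ?thesis by blast
  qed
  have decomposition: "\<exists>(lam :: nat \<Rightarrow> 'a \<Rightarrow> real) (As :: nat \<Rightarrow> 'a \<Rightarrow> real^'d^'n).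
               (\<forall>i < CARD('n) * CARD('d) + 1.
                  lam i \<in> borel_measurable M \<and> (\<forall>x\<in>space M. lam i x \<in> {0..1}) \<and>
                  As i \<in> borel_measurable M \<and>
                  (AE x in M. As i x \<in> clarke_jacobian_seg (H x) (u x) (v x))) \<and>
               (\<forall>x\<in>space M. (\<Sum>i<CARD('n) * CARD('d) + 1. lam i x) = 1) \<and>
               (AE x in M. A x = (\<Sum>i<CARD('n) * CARD('d) + 1. lam i x *\<^sub>R As i x))"
    if u: "u \<in> Lp_set M p" and v: "v \<in> Lp_set M p" and A: "A \<in> Theta M p q H u v"
    for u v :: "'a \<Rightarrow> real^'d" and A
  proof -
    from u v have [measurable]: "u \<in> borel_measurable M" "v \<in> borel_measurable M" by (auto simp: Lp_set_def)
    have A_meas[measurable]: "A \<in> borel_measurable M" and A_AE: "AE x in M. A x \<in> convex hull (clarke_jacobian_seg (H x) (u x) (v x))"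
      using A by (auto simp: Theta_def Lr_set_def Lp_set_def Linf_set_def split: if_splits)
    \<comment> \<open>The equation \<open>B = A x\<close> is solvable only where \<open>A x\<close>
      lies in the hull, so the selection is made off a measurable null set.\<close>
    obtain N where N: "{x \<in> space M. A x \<notin> convex hull (clarke_jacobian_seg (H x) (u x) (v x))} \<subseteq> N"
      "emeasure M N = 0" "N \<in> sets M" using A_AE by (rule AE_E)
    have N_null: "N \<in> null_sets M" and [measurable]: "N \<in> sets M" using N by auto
    let ?\<psi> = "\<lambda>x B. norm (B - A x)"
    have "\<exists>(lam :: ('n \<times> 'd) option \<Rightarrow> 'a \<Rightarrow> real) As. (\<forall>i. lam i \<in> borel_measurable M \<and> As i \<in> borel_measurable M) \<and>
        (\<forall>x\<in>space M - N. (\<forall>i. 0 \<le> lam i x \<and> As i x \<in> clarke_jacobian_seg (H x) (u x) (v x)) \<and>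
          (\<Sum>i\<in>UNIV. lam i x) = 1 \<and> ?\<psi> x (\<Sum>i\<in>UNIV. lam i x *\<^sub>R As i x) = 0)"
    proof (rule clarke_measurable_selection[OF N1_meas lip _ _ _ _ _ card])
      fix B :: "'a \<Rightarrow> real^'d^'n" assume [measurable]: "B \<in> borel_measurable M"
      show "(\<lambda>x. ?\<psi> x (B x)) \<in> borel_measurable M" by measurable
    next
      fix x and B :: "real^'d^'n"
      show "isCont (?\<psi> x) B" by (intro continuous_intros)
    next
      fix x assume "x \<in> space M - N"
      then show "\<exists>B\<in>convex hull (clarke_jacobian_seg (H x) (u x) (v x)). ?\<psi> x B = 0"
        using N(1) by (intro bexI[of _ "A x"]) auto
    qed auto
    then obtain lam :: "('n \<times> 'd) option \<Rightarrow> 'a \<Rightarrow> real" and As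
      where meas[measurable]: "\<And>i. lam i \<in> borel_measurable M" "\<And>i. As i \<in> borel_measurable M"
        and sel: "\<And>x. x \<in> space M - N \<Longrightarrow> (\<forall>i. 0 \<le> lam i x \<and> As i x \<in> clarke_jacobian_seg (H x) (u x) (v x)) \<and>
          (\<Sum>i\<in>UNIV. lam i x) = 1 \<and> ?\<psi> x (\<Sum>i\<in>UNIV. lam i x *\<^sub>R As i x) = 0"
      by blast
    let ?m = "CARD('n) * CARD('d) + 1"
    \<comment> \<open>Carries the finite index type over to the numbers below nd + 1.\<close>
    obtain h :: "nat \<Rightarrow> ('n \<times> 'd) option" where h: "bij_betw h {..<?m} UNIV"
      using finite_same_card_bij[of "{..<?m}" "UNIV :: ('n \<times> 'd) option set"] card by auto
    \<comment> \<open>The weights must lie in the unit interval and sum to 1 at every point, not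
      just almost everywhere. On \<open>N\<close> the selection guarantees nothing, so all weight is
      put on the index \<open>None\<close> there.\<close>
    define lam' where "lam' i x = (if x \<in> N then (if i = None then 1 else 0) else lam i x)" for i x
    have off_N: "AE x in M. x \<in> space M - N" using AE_not_in[OF N_null] by (auto intro: AE_mp)
    have lam'_sum: "(\<Sum>i\<in>UNIV. lam' i x) = 1" if "x \<in> space M" for x
      using sel[of x] that by (cases "x \<in> N") (auto simp: lam'_def)
    have lam'_nonneg: "0 \<le> lam' i x" if "x \<in> space M" for i x
      using sel[of x] that by (auto simp: lam'_def)
    have lam'_le: "lam' i x \<le> 1" if "x \<in> space M" for i x
      using member_le_sum[of i UNIV "\<lambda>i. lam' i x"] lam'_nonneg[OF that] lam'_sum[OF that] by simp
    have sum_h: "(\<Sum>i<?m. g (h i)) = (\<Sum>i\<in>UNIV. g i)" for g :: "('n \<times> 'd) option \<Rightarrow> 'c::comm_monoid_add"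
      using sum.reindex_bij_betw[OF h] .
    show ?thesis
    proof (intro exI[of _ "\<lambda>i. lam' (h i)"] exI[of _ "\<lambda>i. As (h i)"] conjI allI impI ballI)
      fix i
      show "lam' (h i) \<in> borel_measurable M" unfolding lam'_def[abs_def] by measurable
      show "lam' (h i) x \<in> {0..1}" if "x \<in> space M" for x using lam'_nonneg[OF that] lam'_le[OF that] by simp
      show "As (h i) \<in> borel_measurable M" by (rule meas)
      show "AE x in M. As (h i) x \<in> clarke_jacobian_seg (H x) (u x) (v x)"
        using off_N by eventually_elim (use sel in blast)
    next
      fix x assume "x \<in> space M"
      then show "(\<Sum>i<?m. lam' (h i) x) = 1" using sum_h[of "\<lambda>i. lam' i x"] lam'_sum by simp
    next
      show "AE x in M. A x = (\<Sum>i<?m. lam' (h i) x *\<^sub>R As (h i) x)"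
        using off_N
      proof eventually_elim
        fix x assume x: "x \<in> space M - N"
        then have "(\<Sum>i\<in>UNIV. lam' i x *\<^sub>R As i x) = A x" using sel[OF x] by (simp add: lam'_def)
        then show "A x = (\<Sum>i<?m. lam' (h i) x *\<^sub>R As (h i) x)"
          using sum_h[of "\<lambda>i. lam' i x *\<^sub>R As i x"] by simp
      qed
    qed
  qed
  show ?thesis by (intro conjI ballI impI increment decomposition)
qed

end
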